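(* Let $U\in\mathcal G$ be a two-qubit Clifford+$CS$ operator and let $k=\mathrm{lde}(\overline U)$. Then $U$ can be represented by a Clifford+$CS$ circuit of $CS$-count $k$. This circuit is optimal in $CS$-count (no Clifford+$CS$ circuit for $U$ contains fewer than $k$ $CS$ gates), and it can be constructed in $O(k)$ arithmetic operations.
   Context: Gates: $H=\frac1{\sqrt2}\begin{bmatrix}1&1\\1&-1\end{bmatrix}$, $S=\mathrm{diag}(1,i)$, $CZ=\mathrm{diag}(1,1,1,-1)$, $CS=\mathrm{diag}(1,1,1,i)$. The two-qubit Clifford group $\mathcal C$ is the group of $4\times4$ unitaries generated by $H\otimes I$, $I\otimes H$, $S\otimes I$, $I\otimes S$, $CZ$. The Clifford+$CS$ group $\mathcal G$ is generated by $\mathcal C$ and $CS$; its elements are the Clifford+$CS$ operators. A Clifford+$CS$ circuit for $U$ is a product of gates from $\mathcal C\cup\{CS\}$ equal to $U$; its $CS$-count is the number of $CS$ gates in it. $SO(6)$ representation: let $e_1,\dots,e_4$ be the standard basis of $\mathbb C^4$. Order the orthonormal basis $B$ of $\bigwedge^2\mathbb C^4$ as $B_1=\frac{i}{\sqrt2}(e_1\wedge e_2-e_3\wedge e_4)$, $B_2=\frac{1}{\sqrt2}(e_1\wedge e_2+e_3\wedge e_4)$, $B_3=\frac{i}{\sqrt2}(e_2\wedge e_3-e_1\wedge e_4)$, $B_4=\frac{1}{\sqrt2}(e_2\wedge e_4+e_3\wedge e_1)$, $B_5=\frac{i}{\sqrt2}(e_2\wedge e_4-e_3\wedge e_1)$,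 $B_6=\frac{1}{\sqrt2}(e_2\wedge e_3+e_1\wedge e_4)$. For $U\in SU(4)$, $\overline U\in SO(6)$ is the matrix in the basis $B$ of the map $v\wedge w\mapsto (Uv)\wedge(Uw)$. For a general $U\in U(4)$, $\overline U$ means $\overline{\lambda U}$ for a phase $\lambda$ with $\det(\lambda U)=1$; this is well defined up to an overall sign, which does not affect the statement. Let $\mathcal D=\{\frac{1}{\sqrt2^{\,k}}M\in SO(6): k\in\mathbb N, M\in\mathbb Z^{6\times6}\}$; $\overline U\in\mathcal D$ for every $U\in\mathcal G$. For $V\in\mathcal D$, $\mathrm{lde}(V)$ (least denominator exponent) is the least $\ell\in\mathbb N$ with $\sqrt2^{\,\ell}V\in\mathbb Z^{6\times6}$. *)

theory Defs
  imports
    "HOL-Analysis.Analysis"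
    "HOL-Algebra.Generated_Groups"
    "HOL-Library.Landau_Symbols"
begin

section \<open>Gates, groups and circuits\<close>

type_synonym op2 = "complex^2^2"
type_synonym op4 = "complex^4^4"

text \<open>
  The index type \<open>4\<close> has the elements \<open>1\<close>, \<open>2\<close>, \<open>3\<close>, \<open>4\<close>, where the numeral \<open>4\<close> equals \<open>0\<close>;
  rows and columns are numbered from \<open>1\<close> to \<open>4\<close> as usual. Likewise for the index type \<open>6\<close>.
\<close>

definition cscale :: "complex \<Rightarrow> complex^'n^'m \<Rightarrow> complex^'n^'m" where
  "cscale c A = (\<chi> i j. c * A $ i $ j)"

definition adjoint_mat :: "op4 \<Rightarrow> op4" where
  "adjoint_mat A = (\<chi> i j. cnj (A $ j $ i))"

definition kron :: "op2 \<Rightarrow> op2 \<Rightarrow> op4" where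
  "kron A B = vector
     [vector [A$1$1 * B$1$1, A$1$1 * B$1$2, A$1$2 * B$1$1, A$1$2 * B$1$2],
      vector [A$1$1 * B$2$1, A$1$1 * B$2$2, A$1$2 * B$2$1, A$1$2 * B$2$2],
      vector [A$2$1 * B$1$1, A$2$1 * B$1$2, A$2$2 * B$1$1, A$2$2 * B$1$2],
      vector [A$2$1 * B$2$1, A$2$1 * B$2$2, A$2$2 * B$2$1, A$2$2 * B$2$2]]"

definition H_gate :: op2 where
  "H_gate = cscale (1 / complex_of_real (sqrt 2)) (vector [vector [1, 1], vector [1, -1]])"

definition S_gate :: op2 where
  "S_gate = vector [vector [1, 0], vector [0, \<i>]]"

definition diag4 :: "complex \<Rightarrow> complex \<Rightarrow> complex \<Rightarrow> complex \<Rightarrow> op4" where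
  "diag4 a b c d =
     vector [vector [a, 0, 0, 0], vector [0, b, 0, 0], vector [0, 0, c, 0], vector [0, 0, 0, d]]"

definition CZ_gate :: op4 where
  "CZ_gate = diag4 1 1 1 (-1)"

definition CS_gate :: op4 where
  "CS_gate = diag4 1 1 1 \<i>"

definition unitary_group :: "op4 monoid" where
  "unitary_group =
     \<lparr>carrier = {A. A ** adjoint_mat A = mat 1 \<and> adjoint_mat A ** A = mat 1},
      monoid.mult = (**), one = mat 1\<rparr>"

definition clifford :: "op4 set" where
  "clifford = generate unitary_group
     {kron H_gate (mat 1), kron (mat 1) H_gate, kron S_gate (mat 1), kron (mat 1) S_gate, CZ_gate}"

definition clifford_CS :: "op4 set" where
  "clifford_CS = generate unitary_group (clifford \<union> {CS_gate})"

text \<open>A circuit is a list of gates, read as a product from left to right.\<close>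

definition circuit_product :: "op4 list \<Rightarrow> op4" where
  "circuit_product gs = foldr (**) gs (mat 1)"

definition is_circuit_for :: "op4 \<Rightarrow> op4 list \<Rightarrow> bool" where
  "is_circuit_for U gs \<longleftrightarrow> set gs \<subseteq> clifford \<union> {CS_gate} \<and> circuit_product gs = U"

definition CS_count :: "op4 list \<Rightarrow> nat" where
  "CS_count gs = count_list gs CS_gate"


section \<open>The SO(6) representation\<close>

text \<open>
  The exterior square of \<open>\<complex>\<^sup>4\<close> is modelled by the alternating \<open>4 \<times> 4\<close> matrices, where \<open>v \<and> w\<close> is
  \<open>v w\<^sup>T - w v\<^sup>T\<close>. The linear map with \<open>v \<and> w \<mapsto> (U v) \<and> (U w)\<close> is then \<open>X \<mapsto> U X U\<^sup>T\<close>, and the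
  inner product for which the \<open>e\<^sub>i \<and> e\<^sub>j\<close> with \<open>i < j\<close> are orthonormal is half the entrywise one.
\<close>

definition wedge :: "complex^4 \<Rightarrow> complex^4 \<Rightarrow> op4" where
  "wedge v w = (\<chi> i j. v $ i * w $ j - w $ i * v $ j)"

definition wedge_map :: "op4 \<Rightarrow> op4 \<Rightarrow> op4" where
  "wedge_map U X = U ** X ** transpose U"

definition wedge_inner :: "op4 \<Rightarrow> op4 \<Rightarrow> complex" where
  "wedge_inner X Y = (\<Sum>i\<in>UNIV. \<Sum>j\<in>UNIV. cnj (X $ i $ j) * Y $ i $ j) / 2"

abbreviation e_wedge :: "4 \<Rightarrow> 4 \<Rightarrow> op4" where
  "e_wedge i j \<equiv> wedge (axis i 1) (axis j 1)"

definition basisB :: "op4^6" where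
  "basisB = vector
     [cscale (\<i> / complex_of_real (sqrt 2)) (e_wedge 1 2 - e_wedge 3 4),
      cscale (1 / complex_of_real (sqrt 2)) (e_wedge 1 2 + e_wedge 3 4),
      cscale (\<i> / complex_of_real (sqrt 2)) (e_wedge 2 3 - e_wedge 1 4),
      cscale (1 / complex_of_real (sqrt 2)) (e_wedge 2 4 + e_wedge 3 1),
      cscale (\<i> / complex_of_real (sqrt 2)) (e_wedge 2 4 - e_wedge 3 1),
      cscale (1 / complex_of_real (sqrt 2)) (e_wedge 2 3 + e_wedge 1 4)]"

text \<open>
  The entries of \<open>so6 U\<close> are real if \<open>det U = 1\<close> and \<open>U\<close> is unitary; they are kept as complex
  numbers so that nothing is discarded by the definition.
\<close>

definition so6 :: "op4 \<Rightarrow> complex^6^6" where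
  "so6 U = (\<chi> i j. wedge_inner (basisB $ i) (wedge_map U (basisB $ j)))"

text \<open>The matrices denoted by \<open>U\<close> with a bar, for all choices of the phase.\<close>

definition so6_images :: "op4 \<Rightarrow> (complex^6^6) set" where
  "so6_images U = {so6 (cscale l U) | l. cmod l = 1 \<and> det (cscale l U) = 1}"

definition lde :: "complex^6^6 \<Rightarrow> nat" where
  "lde V = (LEAST l. \<forall>i j. complex_of_real (sqrt 2 ^ l) * V $ i $ j \<in> \<int>)"

lemma wedge_map_wedge: "wedge_map U (wedge v w) = wedge (U *v v) (U *v w)"
proof -
  have "wedge_map U (wedge v w) $ i $ j = wedge (U *v v) (U *v w) $ i $ j" for i j
    by (simp add: wedge_map_def wedge_def matrix_matrix_mult_def matrix_vector_mult_def
        transpose_def sum_4 algebra_simps)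
  then show ?thesis by (simp add: vec_eq_iff)
qed

lemma exhaust_6: "x = 1 \<or> x = 2 \<or> x = 3 \<or> x = 4 \<or> x = 5 \<or> x = 6" for x :: 6
proof (induct x)
  case (of_int z)
  then have "0 \<le> z" "z < 6" by simp_all
  then have "z = 0 \<or> z = 1 \<or> z = 2 \<or> z = 3 \<or> z = 4 \<or> z = 5" by arith
  then show ?case by auto
qed

lemma forall_6: "(\<forall>i::6. P i) \<longleftrightarrow> P 1 \<and> P 2 \<and> P 3 \<and> P 4 \<and> P 5 \<and> P 6"
  by (metis exhaust_6)

lemma UNIV_6: "(UNIV :: 6 set) = {1, 2, 3, 4, 5, 6}"
  using exhaust_6 by auto

lemma sum_6: "sum f (UNIV :: 6 set) = f 1 + f 2 + f 3 + f 4 + f 5 + f 6"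
  unfolding UNIV_6 by (simp add: ac_simps)

lemma basisB_simps:
  "basisB $ 1 = cscale (\<i> / complex_of_real (sqrt 2)) (e_wedge 1 2 - e_wedge 3 4)"
  "basisB $ 2 = cscale (1 / complex_of_real (sqrt 2)) (e_wedge 1 2 + e_wedge 3 4)"
  "basisB $ 3 = cscale (\<i> / complex_of_real (sqrt 2)) (e_wedge 2 3 - e_wedge 1 4)"
  "basisB $ 4 = cscale (1 / complex_of_real (sqrt 2)) (e_wedge 2 4 + e_wedge 3 1)"
  "basisB $ 5 = cscale (\<i> / complex_of_real (sqrt 2)) (e_wedge 2 4 - e_wedge 3 1)"
  "basisB $ 6 = cscale (1 / complex_of_real (sqrt 2)) (e_wedge 2 3 + e_wedge 1 4)"
  unfolding basisB_def vector_def by simp_all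

lemma csqrt2: "complex_of_real (sqrt 2) * complex_of_real (sqrt 2) = 2"
  by (simp flip: of_real_mult)

lemma basisB_orthonormal:
  "wedge_inner (basisB $ i) (basisB $ j) = (if i = j then 1 else 0)"
proof -
  have "\<forall>i j. wedge_inner (basisB $ i) (basisB $ j) = (if i = j then 1 else 0)"
    unfolding forall_6
    by (simp add: basisB_simps wedge_inner_def wedge_def cscale_def axis_def sum_4 csqrt2)
  then show ?thesis by blast
qed

lemma basisB_expansion:
  assumes "transpose X = - X"
  shows "X = (\<Sum>i\<in>UNIV. cscale (wedge_inner (basisB $ i) X) (basisB $ i))"
proof -
  have alt: "X $ b $ a = - X $ a $ b" for a b
  proof -
    have "transpose X $ a $ b = (- X) $ a $ b"
      by (simp only: assms)
    then show ?thesis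
      by (simp add: transpose_def)
  qed
  have diag: "X $ a $ a = 0" for a
    using alt[of a a] by simp
  note alts = alt[of 1 2] alt[of 1 3] alt[of 1 4] alt[of 2 3] alt[of 2 4] alt[of 3 4]
  define r where "r = 1 / complex_of_real (sqrt 2)"
  have rr: "r * (r * z) = z / 2" for z
    by (simp add: r_def csqrt2)
  have ir: "\<i> / complex_of_real (sqrt 2) = \<i> * r" and cnj_r: "cnj r = r"
    by (simp_all add: r_def)
  have inner:
    "wedge_inner (basisB $ 1) X = - \<i> * r * (X$1$2 - X$3$4)"
    "wedge_inner (basisB $ 2) X = r * (X$1$2 + X$3$4)"
    "wedge_inner (basisB $ 3) X = - \<i> * r * (X$2$3 - X$1$4)"
    "wedge_inner (basisB $ 4) X = r * (X$2$4 - X$1$3)"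
    "wedge_inner (basisB $ 5) X = - \<i> * r * (X$2$4 + X$1$3)"
    "wedge_inner (basisB $ 6) X = r * (X$2$3 + X$1$4)"
    unfolding basisB_simps ir r_def[symmetric]
    by (simp_all add: wedge_inner_def wedge_def cscale_def axis_def sum_4 alts diag cnj_r field_simps)
  have "(\<Sum>i\<in>UNIV. cscale (wedge_inner (basisB $ i) X) (basisB $ i)) $ a $ b = X $ a $ b" for a b
  proof -
    have "\<forall>a b. (\<Sum>i\<in>UNIV. cscale (wedge_inner (basisB $ i) X) (basisB $ i)) $ a $ b = X $ a $ b"
      unfolding sum_6 inner unfolding basisB_simps ir r_def[symmetric] forall_4
      by (simp add: wedge_def cscale_def axis_def alts diag rr field_simps)
    then show ?thesis by blast
  qed
  then show ?thesis by (simp add: vec_eq_iff)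
qed

text \<open>\<open>so6 U\<close> is the matrix of \<open>wedge_map U\<close> in the basis \<open>basisB\<close>.\<close>

lemma so6_is_matrix:
  "wedge_map U (basisB $ j) = (\<Sum>i\<in>UNIV. cscale (so6 U $ i $ j) (basisB $ i))"
proof -
  have B: "transpose (basisB $ j) = - basisB $ j"
  proof -
    have "\<forall>j. transpose (basisB $ j) = - basisB $ j"
      unfolding forall_6
      by (simp add: basisB_simps vec_eq_iff transpose_def wedge_def cscale_def algebra_simps)
    then show ?thesis by blast
  qed
  have "transpose (wedge_map U (basisB $ j)) = wedge_map U (transpose (basisB $ j))"
    by (simp add: wedge_map_def matrix_transpose_mul matrix_mul_assoc)
  also have "\<dots> = - wedge_map U (basisB $ j)"
    unfolding B
    by (simp add: wedge_map_def matrix_matrix_mult_def vec_eq_iff sum_negf)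
  finally have "wedge_map U (basisB $ j) =
      (\<Sum>i\<in>UNIV. cscale (wedge_inner (basisB $ i) (wedge_map U (basisB $ j))) (basisB $ i))"
    by (rule basisB_expansion)
  then show ?thesis
    by (simp only: so6_def vec_lambda_beta)
qed


section \<open>Counting arithmetic operations\<close>

text \<open>
  Algorithms are programs over integer variables with unit-cost arithmetic. A program has a write-only
  output to which it appends gates. The cost counts every arithmetic operation, and in addition
  every comparison, connective, assignment, output and branching.
\<close>

type_synonym store = "nat \<Rightarrow> int"

datatype aexp =
    Const int
  | Var nat
  | Add aexp aexp
  | Sub aexp aexp
  | Mul aexp aexp
  | Div aexp aexp
  | Rem aexp aexp

primrec aval :: "aexp \<Rightarrow> store \<Rightarrow> int" where
  "aval (Const n) s = n"
| "aval (Var x) s = s x"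
| "aval (Add a b) s = aval a s + aval b s"
| "aval (Sub a b) s = aval a s - aval b s"
| "aval (Mul a b) s = aval a s * aval b s"
| "aval (Div a b) s = aval a s div aval b s"
| "aval (Rem a b) s = aval a s mod aval b s"

primrec acost :: "aexp \<Rightarrow> nat" where
  "acost (Const n) = 0"
| "acost (Var x) = 0"
| "acost (Add a b) = acost a + acost b + 1"
| "acost (Sub a b) = acost a + acost b + 1"
| "acost (Mul a b) = acost a + acost b + 1"
| "acost (Div a b) = acost a + acost b + 1"
| "acost (Rem a b) = acost a + acost b + 1"

datatype bexp =
    Eq aexp aexp
  | Less aexp aexp
  | Neg bexp
  | Conj bexp bexp

primrec bval :: "bexp \<Rightarrow> store \<Rightarrow> bool" where
  "bval (Eq a b) s \<longleftrightarrow> aval a s = aval b s"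
| "bval (Less a b) s \<longleftrightarrow> aval a s < aval b s"
| "bval (Neg b) s \<longleftrightarrow> \<not> bval b s"
| "bval (Conj b c) s \<longleftrightarrow> bval b s \<and> bval c s"

primrec bcost :: "bexp \<Rightarrow> nat" where
  "bcost (Eq a b) = acost a + acost b + 1"
| "bcost (Less a b) = acost a + acost b + 1"
| "bcost (Neg b) = bcost b + 1"
| "bcost (Conj b c) = bcost b + bcost c + 1"

datatype prog =
    Skip
  | Assign nat aexp
  | Emit op4
  | Seq prog prog
  | Ite bexp prog prog
  | While bexp prog

text \<open>
  \<open>exec p s gs t s'\<close>: started in \<open>s\<close>, the program \<open>p\<close> terminates in \<open>s'\<close> after outputting the
  gates \<open>gs\<close>, at cost \<open>t\<close>.
\<close>

inductive exec :: "prog \<Rightarrow> store \<Rightarrow> op4 list \<Rightarrow> nat \<Rightarrow> store \<Rightarrow> bool" where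
  Skip: "exec Skip s [] 0 s"
| Assign: "exec (Assign x a) s [] (acost a + 1) (s(x := aval a s))"
| Emit: "exec (Emit g) s [g] 1 s"
| Seq: "exec p s gs t s' \<Longrightarrow> exec q s' hs u s'' \<Longrightarrow> exec (Seq p q) s (gs @ hs) (t + u) s''"
| IteTrue: "bval b s \<Longrightarrow> exec p s gs t s' \<Longrightarrow> exec (Ite b p q) s gs (bcost b + 1 + t) s'"
| IteFalse: "\<not> bval b s \<Longrightarrow> exec q s gs t s' \<Longrightarrow> exec (Ite b p q) s gs (bcost b + 1 + t) s'"
| WhileFalse: "\<not> bval b s \<Longrightarrow> exec (While b p) s [] (bcost b + 1) s"
| WhileTrue: "bval b s \<Longrightarrow> exec p s gs t s' \<Longrightarrow> exec (While b p) s' hs u s'' \<Longrightarrow>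
    exec (While b p) s (gs @ hs) (bcost b + 1 + t + u) s''"

inductive_cases exec_SkipE: "exec Skip s gs t s'"
inductive_cases exec_AssignE: "exec (Assign x a) s gs t s'"
inductive_cases exec_EmitE: "exec (Emit g) s gs t s'"
inductive_cases exec_SeqE: "exec (Seq p q) s gs t s'"
inductive_cases exec_IteE: "exec (Ite b p q) s gs t s'"
inductive_cases exec_WhileE: "exec (While b p) s gs t s'"

lemma exec_deterministic:
  "exec p s gs t s' \<Longrightarrow> exec p s hsa ua s''a \<Longrightarrow> gs = hsa \<and> t = ua \<and> s' = s''a"
proof (induction arbitrary: hsa ua s''a rule: exec.induct)
  case Skip
  then show ?case by (auto elim: exec_SkipE)
next
  case Assign
  then show ?case by (auto elim: exec_AssignE)
next
  case Emit
  then show ?case by (auto elim: exec_EmitE)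
next
  case (Seq p s gs t s' q hs u s'')
  from Seq.prems obtain gs1 t1 s1 hs1 u1 where
    "exec p s gs1 t1 s1" "exec q s1 hs1 u1 s''a" "hsa = gs1 @ hs1" "ua = t1 + u1"
    by (rule exec_SeqE)
  with Seq.IH show ?case by metis
next
  case (IteTrue b s p gs t s' q)
  from IteTrue.prems IteTrue.hyps obtain t1 where
    "exec p s hsa t1 s''a" "ua = bcost b + 1 + t1"
    by (auto elim: exec_IteE)
  with IteTrue.IH show ?case by metis
next
  case (IteFalse b s q gs t s' p)
  from IteFalse.prems IteFalse.hyps obtain t1 where
    "exec q s hsa t1 s''a" "ua = bcost b + 1 + t1"
    by (auto elim: exec_IteE)
  with IteFalse.IH show ?case by metis
next
  case (WhileFalse b s p)
  then show ?case by (auto elim: exec_WhileE)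
next
  case (WhileTrue b s p gs t s' hs u s'')
  from WhileTrue.prems WhileTrue.hyps obtain gs1 t1 s1 hs1 u1 where
    "exec p s gs1 t1 s1" "exec (While b p) s1 hs1 u1 s''a" "hsa = gs1 @ hs1"
    "ua = bcost b + 1 + t1 + u1"
    by (auto elim: exec_WhileE)
  with WhileTrue.IH show ?case by metis
qed

text \<open>
  The input of the program. All generators, hence all elements \<open>U\<close> of \<open>clifford_CS\<close>, are of the
  form \<open>M / sqrt 2 ^ m\<close> with a matrix \<open>M\<close> of Gaussian integers. An operator \<open>U\<close> is given to the
  program in lowest terms: variable \<open>0\<close> holds the least such \<open>m\<close>, variables \<open>1\<close> to \<open>16\<close> hold the
  real parts of the entries of \<open>M\<close> (row by row), variables \<open>17\<close> to \<open>32\<close> the imaginary parts. All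
  other variables are \<open>0\<close>. The floor only converts integral reals to integers.
\<close>

definition gaussian_lde :: "op4 \<Rightarrow> nat" where
  "gaussian_lde U = (LEAST m. \<forall>i j. Re (complex_of_real (sqrt 2 ^ m) * U $ i $ j) \<in> \<int> \<and>
                                    Im (complex_of_real (sqrt 2 ^ m) * U $ i $ j) \<in> \<int>)"

definition entries :: "op4 \<Rightarrow> complex list" where
  "entries A = concat (map (\<lambda>i. map (\<lambda>j. A $ i $ j) [1, 2, 3, 4]) [1, 2, 3, 4])"

definition input_list :: "op4 \<Rightarrow> int list" where
  "input_list U = (let m = gaussian_lde U; zs = entries (cscale (complex_of_real (sqrt 2 ^ m)) U)
     in int m # map (\<lambda>z. \<lfloor>Re z\<rfloor>) zs @ map (\<lambda>z. \<lfloor>Im z\<rfloor>) zs)"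

definition input_store :: "op4 \<Rightarrow> store" where
  "input_store U = (\<lambda>x. if x < length (input_list U) then input_list U ! x else 0)"

end

(*
  Let V be the SO(6) matrix of U with exponent k >= 1, and reduce the integer matrix sqrt 2 ^ k V
  modulo two. Orthogonality of its rows and columns forces every row to occur an even number of
  times, so the six rows split into three pairs of congruent rows. The image of CS
  rotates three disjoint coordinate planes by 45 degrees, and the Clifford group realises all permutations of the axes up to signs;
  conjugating CS by a suitable Clifford operator therefore adds and subtracts congruent rows and
  lowers the exponent by exactly one. At exponent 0 the image is a signed permutation matrix, hence
  that of a Clifford operator, and the remaining phase is a power of the eighth root of unity, which
  is itself a Clifford operator. Since Clifford operators have exponent 0 and CS has exponent 1, no
  circuit can use fewer CS gates.

  The program never computes the phase of the SO(6) matrix: it works with a Gaussian matrix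
  proportional to U and with the squared moduli of the entries, for which "exponent at most n" is a
  divisibility test. It finds 2 ^ k by doubling, tries the finitely many conjugates of CS in each
  round, and looks up the remaining Clifford operator in a finite table.
*)

theory Submission
  imports Defs
begin

section \<open>Unitary operators and generated groups\<close>

text \<open>The image of \<open>U\<close> is determined only up to sign, and integrality of the
  scaled image is not monotone in the exponent: an integer matrix times sqrt 2 is usually not
  integral. The proof therefore works with \<open>level\<close>, which quantifies over all images of
  \<open>U\<close>, and with the subadditivity of exponents under products. Subadditivity is used
  twice: for the lower bound on the count, and to show that every conjugate of CS that passes the
  program's test lowers the level by exactly one, so the program may take the first one that it
  meets. Determinants in dimension six are never computed. Signed permutations are realised with the
  sign of one column left free, and the description of the kernel asks only about the other five
  columns. The linear cost rests on the finiteness of the Clifford group, phases included, which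
  makes every round a case distinction of fixed length. Expressions for the tests and assignments
  are not written out; closure properties show that they exist, independently of the store, and this
  alone gives the constant bounds.\<close>

definition unitary :: "op4 \<Rightarrow> bool" where
  "unitary A \<longleftrightarrow> A ** adjoint_mat A = mat 1 \<and> adjoint_mat A ** A = mat 1"

lemma adjoint_mat_mult: "adjoint_mat (A ** B) = adjoint_mat B ** adjoint_mat A"
  by (simp add: adjoint_mat_def matrix_matrix_mult_def vec_eq_iff mult.commute)

lemma adjoint_mat_adjoint_mat [simp]: "adjoint_mat (adjoint_mat A) = A"
  by (simp add: adjoint_mat_def vec_eq_iff)

lemma adjoint_mat_mat_1 [simp]: "adjoint_mat (mat 1) = mat 1"
  by (simp add: adjoint_mat_def vec_eq_iff mat_def)

lemma unitary_mat_1 [simp]: "unitary (mat 1)"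
  by (simp add: unitary_def)

lemma unitary_adjoint_mat: "unitary A \<Longrightarrow> unitary (adjoint_mat A)"
  by (simp add: unitary_def)

lemma unitary_mult:
  assumes "unitary A" "unitary B"
  shows "unitary (A ** B)"
proof -
  have "(A ** B) ** (adjoint_mat B ** adjoint_mat A) = A ** (B ** adjoint_mat B) ** adjoint_mat A"
    "(adjoint_mat B ** adjoint_mat A) ** (A ** B) = adjoint_mat B ** (adjoint_mat A ** A) ** B"
    by (simp_all only: matrix_mul_assoc)
  then show ?thesis
    using assms by (simp add: unitary_def adjoint_mat_mult)
qed

lemma cscale_cscale [simp]: "cscale a (cscale b A) = cscale (a * b) A"
  by (simp add: cscale_def vec_eq_iff)

lemma cscale_1 [simp]: "cscale 1 A = A"
  by (simp add: cscale_def vec_eq_iff)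

lemma cscale_mult_left [simp]: "cscale a A ** B = cscale a (A ** B)"
  by (simp add: cscale_def matrix_matrix_mult_def vec_eq_iff sum_distrib_left mult.assoc)

lemma cscale_mult_right [simp]:
  fixes A :: "complex^'n^'m" and B :: "complex^'k^'n"
  shows "A ** cscale a B = cscale a (A ** B)"
  by (simp add: cscale_def matrix_matrix_mult_def vec_eq_iff sum_distrib_left mult.left_commute)

lemma adjoint_mat_cscale: "adjoint_mat (cscale a A) = cscale (cnj a) (adjoint_mat A)"
  by (simp add: cscale_def adjoint_mat_def vec_eq_iff)

lemma cnj_mult_self_eq_1: "cmod z = 1 \<Longrightarrow> cnj z * z = 1"
  by (metis complex_norm_square mult.commute of_real_1 power_one)

lemma unitary_cscale:
  assumes "cmod a = 1" "unitary A"
  shows "unitary (cscale a A)"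
proof -
  have "a * cnj a = 1" "cnj a * a = 1"
    using cnj_mult_self_eq_1[OF assms(1)] by (simp_all add: mult.commute)
  then show ?thesis
    using assms by (simp add: unitary_def adjoint_mat_cscale)
qed

lemma group_unitary_group: "group unitary_group"
proof (rule groupI)
  fix x assume "x \<in> carrier unitary_group"
  then show "\<exists>y\<in>carrier unitary_group. y \<otimes>\<^bsub>unitary_group\<^esub> x = \<one>\<^bsub>unitary_group\<^esub>"
    by (intro bexI[of _ "adjoint_mat x"]) (auto simp: unitary_group_def)
qed (use unitary_mult in \<open>auto simp: unitary_group_def unitary_def matrix_mul_assoc\<close>)

lemma inv_unitary_group:
  assumes "unitary x"
  shows "inv\<^bsub>unitary_group\<^esub> x = adjoint_mat x"
  by (rule group.inv_equality[OF group_unitary_group])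
    (use assms in \<open>auto simp: unitary_group_def unitary_def\<close>)

text \<open>For unitary generators the group inverse is the adjoint, so later inductions see only
  products and adjoints. The membership facts kept in the product case supply unitarity of both
  factors.\<close>

lemma generate_unitary_induct [consumes 1, case_names unitary one gen adj mult]:
  assumes "x \<in> generate unitary_group S" "\<And>s. s \<in> S \<Longrightarrow> unitary s"
    and "P (mat 1)" "\<And>s. s \<in> S \<Longrightarrow> P s" "\<And>s. s \<in> S \<Longrightarrow> P (adjoint_mat s)"
    and "\<And>a b. a \<in> generate unitary_group S \<Longrightarrow> P a \<Longrightarrow> b \<in> generate unitary_group S \<Longrightarrow> P b \<Longrightarrow> P (a ** b)"
  shows "P x"
  using assms(1)
proof (induction rule: generate.induct)
  case one
  then show ?case using assms(3) by (simp add: unitary_group_def)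
next
  case (incl h)
  then show ?case using assms(4) by simp
next
  case (inv h)
  then show ?case using assms(2,5) by (simp add: inv_unitary_group)
next
  case (eng a b)
  then show ?case using assms(6)[of a b] by (simp add: unitary_group_def)
qed

lemma generate_unitary_mult:
  "a \<in> generate unitary_group S \<Longrightarrow> b \<in> generate unitary_group S \<Longrightarrow> a ** b \<in> generate unitary_group S"
  using generate.eng[of a unitary_group S b] by (simp add: unitary_group_def)

lemma generate_unitary_one: "mat 1 \<in> generate unitary_group S"
  using generate.one[of unitary_group S] by (simp add: unitary_group_def)

lemma generate_unitary_unitary:
  assumes "x \<in> generate unitary_group S" "\<And>s. s \<in> S \<Longrightarrow> unitary s"
  shows "unitary x"
  using assms(1) by (induction rule: generate_unitary_induct) (auto intro: unitary_mult unitary_adjoint_mat assms(2))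

lemma generate_unitary_adjoint_mat:
  assumes "x \<in> generate unitary_group S" "\<And>s. s \<in> S \<Longrightarrow> unitary s"
  shows "adjoint_mat x \<in> generate unitary_group S"
  using assms(1)
proof (induction rule: generate_unitary_induct)
  case (adj s)
  then show ?case by (simp add: generate.incl)
next
  case (gen s)
  then show ?case using generate.inv[of s S unitary_group] assms(2) by (simp add: inv_unitary_group)
qed (auto simp: adjoint_mat_mult intro: generate_unitary_one generate_unitary_mult assms(2))

section \<open>Algebraic properties of the representation\<close>

lemma wedge_inner_sum:
  "wedge_inner X (\<Sum>i\<in>A. cscale (c i) (Y i)) = (\<Sum>i\<in>A. c i * wedge_inner X (Y i))"
proof (cases "finite A")
  case True
  have add: "wedge_inner X (Y + Z) = wedge_inner X Y + wedge_inner X Z" for Y Z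
    by (simp add: wedge_inner_def distrib_left sum.distrib add_divide_distrib)
  have zero: "wedge_inner X 0 = 0"
    by (simp add: wedge_inner_def)
  have scale: "wedge_inner X (cscale c Y) = c * wedge_inner X Y" for c Y
    by (simp add: wedge_inner_def cscale_def sum_distrib_left mult.left_commute)
  show ?thesis
    using True by induction (simp_all add: zero add scale)
qed (simp add: wedge_inner_def)

lemma wedge_map_sum:
  "wedge_map U (\<Sum>i\<in>A. cscale (c i) (Y i)) = (\<Sum>i\<in>A. cscale (c i) (wedge_map U (Y i)))"
proof (cases "finite A")
  case True
  have add: "wedge_map U (Y + Z) = wedge_map U Y + wedge_map U Z" for Y Z
    by (simp add: wedge_map_def matrix_matrix_mult_def vec_eq_iff distrib_left distrib_right sum.distrib)
  have zero: "wedge_map U 0 = 0"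
    by (simp add: wedge_map_def)
  have scale: "wedge_map U (cscale c Y) = cscale c (wedge_map U Y)" for c Y
    by (simp add: wedge_map_def)
  show ?thesis
    using True by induction (simp_all add: zero add scale)
qed (simp add: wedge_map_def)

lemma wedge_map_mult: "wedge_map (A ** B) X = wedge_map A (wedge_map B X)"
  by (simp add: wedge_map_def matrix_transpose_mul matrix_mul_assoc)

lemma so6_mult: "so6 (A ** B) = so6 A ** so6 B"
proof -
  have "so6 (A ** B) $ h $ j = (so6 A ** so6 B) $ h $ j" for h j
  proof -
    have "so6 (A ** B) $ h $ j = wedge_inner (basisB $ h) (wedge_map A (wedge_map B (basisB $ j)))"
      by (simp add: so6_def wedge_map_mult)
    also have "\<dots> = (\<Sum>i\<in>UNIV. so6 B $ i $ j * wedge_inner (basisB $ h) (wedge_map A (basisB $ i)))"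
      by (subst so6_is_matrix) (simp add: wedge_map_sum wedge_inner_sum)
    finally show ?thesis
      by (simp add: so6_def matrix_matrix_mult_def mult.commute)
  qed
  then show ?thesis by (simp add: vec_eq_iff)
qed

lemma so6_mat_1: "so6 (mat 1) = mat 1"
  by (simp add: so6_def wedge_map_def basisB_orthonormal vec_eq_iff transpose_mat) (simp add: mat_def)

lemma so6_cscale: "so6 (cscale l U) = cscale (l\<^sup>2) (so6 U)"
proof -
  have "transpose (cscale l U) = cscale l (transpose U)"
    by (simp add: cscale_def transpose_def vec_eq_iff)
  then have "wedge_map (cscale l U) X = cscale (l\<^sup>2) (wedge_map U X)" for X
    by (simp add: wedge_map_def power2_eq_square)
  then show ?thesis
    by (simp add: so6_def vec_eq_iff wedge_inner_def cscale_def sum_distrib_left mult_ac)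
qed

text \<open>Entries of the image are quadratic forms in the entries of \<open>U\<close>. This form
  serves the adjoint rule and, later, the evaluation of the image by a program.\<close>

lemma so6_expand:
  "so6 U $ i $ j = (\<Sum>p\<in>UNIV. \<Sum>q\<in>UNIV. \<Sum>a\<in>UNIV. \<Sum>b\<in>UNIV.
     cnj (basisB $ i $ p $ q) * basisB $ j $ a $ b * (U $ p $ a * U $ q $ b)) / 2"
proof -
  have "(U ** X ** transpose U) $ p $ q = (\<Sum>a\<in>UNIV. \<Sum>b\<in>UNIV. X $ a $ b * (U $ p $ a * U $ q $ b))" for X p q
    unfolding matrix_matrix_mult_def transpose_def
    by (subst sum.swap) (simp add: sum_distrib_left sum_distrib_right mult_ac)
  then show ?thesis
    by (simp add: so6_def wedge_inner_def wedge_map_def sum_distrib_left mult_ac)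
qed

lemma sum_rotate:
  "(\<Sum>q\<in>Q. \<Sum>a\<in>A. \<Sum>b\<in>B. f q a b) = (\<Sum>a\<in>A. \<Sum>b\<in>B. \<Sum>q\<in>Q. f q a b)"
  by (subst sum.swap) (intro sum.cong refl sum.swap)

text \<open>Exchanging the index pairs (p, q) and (a, b) in the fourfold sum, together with
  \<open>i\<close> and \<open>j\<close>, amounts to complex conjugation; \<open>sum_rotate\<close>
  does the reordering.\<close>

lemma so6_adjoint_mat: "so6 (adjoint_mat U) $ i $ j = cnj (so6 U $ j $ i)"
proof -
  let ?t = "\<lambda>p q a b. cnj (basisB $ i $ p $ q) * basisB $ j $ a $ b * (cnj (U $ a $ p) * cnj (U $ b $ q))"
  have "so6 (adjoint_mat U) $ i $ j = (\<Sum>p\<in>UNIV. \<Sum>q\<in>UNIV. \<Sum>a\<in>UNIV. \<Sum>b\<in>UNIV. ?t p q a b) / 2"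
    by (simp add: so6_expand adjoint_mat_def)
  also have "(\<Sum>p\<in>UNIV. \<Sum>q\<in>UNIV. \<Sum>a\<in>UNIV. \<Sum>b\<in>UNIV. ?t p q a b) =
      (\<Sum>p\<in>UNIV. \<Sum>a\<in>UNIV. \<Sum>b\<in>UNIV. \<Sum>q\<in>UNIV. ?t p q a b)"
    by (intro sum.cong refl sum_rotate)
  also have "\<dots> = (\<Sum>a\<in>UNIV. \<Sum>b\<in>UNIV. \<Sum>p\<in>UNIV. \<Sum>q\<in>UNIV. ?t p q a b)"
    by (rule sum_rotate)
  finally show ?thesis
    by (simp add: so6_expand mult_ac)
qed

section \<open>Phases, determinants and the sign ambiguity of the image\<close>

lemma det_cscale: "det (cscale l U) = l ^ CARD('n) * det U" for U :: "complex^'n^'n"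
proof -
  have "cscale l U = (\<chi> i. l *s U $ i)"
    by (simp add: cscale_def vec_eq_iff)
  then show ?thesis
    using det_rows_mul[of "\<lambda>_. l" "\<lambda>i. U $ i"] by simp
qed

lemma det_adjoint_mat: "det (adjoint_mat U) = cnj (det U)"
proof -
  have "adjoint_mat U = transpose (\<chi> i j. cnj (U $ i $ j))"
    by (simp add: adjoint_mat_def transpose_def vec_eq_iff)
  moreover have "det (\<chi> i j. cnj (U $ i $ j)) = cnj (det U)"
    unfolding det_def by simp
  ultimately show ?thesis by simp
qed

text \<open>A phase l acts on the image by l^2 and on the determinant by l^4. With m = l^2 what
  remains is a square root of the inverse determinant, which explains the ambiguity by a sign;
  conversely each such m is the square of a phase.\<close>

lemma so6_images_iff:
  "V \<in> so6_images U \<longleftrightarrow> (\<exists>m. cmod m = 1 \<and> m\<^sup>2 * det U = 1 \<and> V = cscale m (so6 U))"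
proof
  assume "V \<in> so6_images U"
  then obtain l where l: "V = so6 (cscale l U)" "cmod l = 1" "det (cscale l U) = 1"
    by (auto simp: so6_images_def)
  then have "l ^ 4 * det U = 1"
    by (simp add: det_cscale)
  moreover have "(l\<^sup>2)\<^sup>2 = l ^ 4"
    by simp
  ultimately show "\<exists>m. cmod m = 1 \<and> m\<^sup>2 * det U = 1 \<and> V = cscale m (so6 U)"
    using l by (intro exI[of _ "l\<^sup>2"]) (simp add: so6_cscale norm_power)
next
  assume "\<exists>m. cmod m = 1 \<and> m\<^sup>2 * det U = 1 \<and> V = cscale m (so6 U)"
  then obtain m where m: "cmod m = 1" "m\<^sup>2 * det U = 1" "V = cscale m (so6 U)"
    by blast
  have "cmod (csqrt m) = 1" "(csqrt m) ^ 4 = m\<^sup>2"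
    using m(1) power_mult[of "csqrt m" 2 2] by (simp_all add: norm_csqrt)
  then show "V \<in> so6_images U"
    using m by (auto simp: so6_images_def so6_cscale det_cscale intro!: exI[of _ "csqrt m"])
qed

lemma so6_images_mult:
  assumes "V \<in> so6_images U" "V' \<in> so6_images U'"
  shows "V ** V' \<in> so6_images (U ** U')"
proof -
  from assms obtain m m' where "cmod m = 1" "m\<^sup>2 * det U = 1" "V = cscale m (so6 U)"
    "cmod m' = 1" "m'\<^sup>2 * det U' = 1" "V' = cscale m' (so6 U')"
    unfolding so6_images_iff by blast
  moreover from this have "(m * m')\<^sup>2 * (det U * det U') = 1"
    by (metis (no_types, lifting) mult.assoc mult.left_commute mult_1 power_mult_distrib)
  ultimately show ?thesis
    unfolding so6_images_iff
    by (intro exI[of _ "m * m'"]) (simp add: norm_mult det_mul so6_mult mult.commute)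
qed

definition adjoint6 :: "complex^6^6 \<Rightarrow> complex^6^6" where
  "adjoint6 V = (\<chi> i j. cnj (V $ j $ i))"

lemma so6_images_adjoint:
  assumes "V \<in> so6_images U"
  shows "adjoint6 V \<in> so6_images (adjoint_mat U)"
proof -
  from assms obtain m where m: "cmod m = 1" "m\<^sup>2 * det U = 1" "V = cscale m (so6 U)"
    unfolding so6_images_iff by blast
  have "(cnj m)\<^sup>2 * det (adjoint_mat U) = 1"
    using arg_cong[OF m(2), of cnj] by (simp add: det_adjoint_mat)
  moreover have "adjoint6 V = cscale (cnj m) (so6 (adjoint_mat U))"
    by (simp add: adjoint6_def m(3) cscale_def vec_eq_iff so6_adjoint_mat)
  ultimately show ?thesis
    using m(1) unfolding so6_images_iff by (intro exI[of _ "cnj m"]) simp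
qed

lemma so6_images_unitary:
  assumes "V \<in> so6_images U" "unitary U"
  shows "V ** adjoint6 V = mat 1" "adjoint6 V ** V = mat 1"
proof -
  from assms obtain m where m: "cmod m = 1" "V = cscale m (so6 U)"
    unfolding so6_images_iff by blast
  have *: "adjoint6 V = cscale (cnj m) (so6 (adjoint_mat U))"
    by (simp add: adjoint6_def m(2) cscale_def vec_eq_iff so6_adjoint_mat)
  have "so6 U ** so6 (adjoint_mat U) = mat 1" "so6 (adjoint_mat U) ** so6 U = mat 1"
    using assms(2) by (simp_all flip: so6_mult add: unitary_def so6_mat_1)
  with * m cnj_mult_self_eq_1[OF m(1)]
  show "V ** adjoint6 V = mat 1" "adjoint6 V ** V = mat 1"
    by (simp_all add: mult.commute)
qed

lemma so6_images_nonempty: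
  assumes "unitary U"
  shows "so6_images U \<noteq> {}"
proof -
  have "cmod (det U) = 1"
  proof -
    have "det U * cnj (det U) = 1"
      using assms det_mul[of U "adjoint_mat U"] by (simp add: unitary_def det_adjoint_mat)
    then show ?thesis
      by (metis abs_norm_cancel abs_square_eq_1 complex_norm_square of_real_eq_1_iff)
  qed
  then have "cnj (det U) * det U = 1" "cmod (csqrt (cnj (det U))) = 1"
    by (simp_all add: cnj_mult_self_eq_1 norm_csqrt)
  then show ?thesis
    using so6_images_iff[of _ U] by (metis power2_csqrt empty_iff)
qed

lemma so6_images_sign:
  assumes "V \<in> so6_images U" "V' \<in> so6_images U"
  shows "V' = V \<or> V' = cscale (-1) V"
proof -
  from assms obtain m m' where m: "cmod m = 1" "m\<^sup>2 * det U = 1" "V = cscale m (so6 U)"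
    "m'\<^sup>2 * det U = 1" "V' = cscale m' (so6 U)"
    unfolding so6_images_iff by blast
  then have "m\<^sup>2 = m'\<^sup>2"
    by (metis mult_cancel_right mult_eq_0_iff zero_neq_one)
  then have "m' = m \<or> m' = - m"
    by (metis power2_eq_iff)
  then show ?thesis
    using m by auto
qed

section \<open>The images of the generators\<close>

lemma det_4:
  fixes A :: "'a::comm_ring_1^4^4"
  shows "det A =
    A$1$1 * (A$2$2 * (A$3$3 * A$4$4 - A$3$4 * A$4$3) - A$2$3 * (A$3$2 * A$4$4 - A$3$4 * A$4$2)
      + A$2$4 * (A$3$2 * A$4$3 - A$3$3 * A$4$2))
    - A$1$2 * (A$2$1 * (A$3$3 * A$4$4 - A$3$4 * A$4$3) - A$2$3 * (A$3$1 * A$4$4 - A$3$4 * A$4$1)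
      + A$2$4 * (A$3$1 * A$4$3 - A$3$3 * A$4$1))
    + A$1$3 * (A$2$1 * (A$3$2 * A$4$4 - A$3$4 * A$4$2) - A$2$2 * (A$3$1 * A$4$4 - A$3$4 * A$4$1)
      + A$2$4 * (A$3$1 * A$4$2 - A$3$2 * A$4$1))
    - A$1$4 * (A$2$1 * (A$3$2 * A$4$3 - A$3$3 * A$4$2) - A$2$2 * (A$3$1 * A$4$3 - A$3$3 * A$4$1)
      + A$2$3 * (A$3$1 * A$4$2 - A$3$2 * A$4$1))"
proof -
  have *: "finite {2::4, 3, 4}" "(1::4) \<notin> {2, 3, 4}" "finite {3::4, 4}" "(2::4) \<notin> {3, 4}"
    "finite {4::4}" "(3::4) \<notin> {4}"
    by auto
  show ?thesis
    unfolding det_def UNIV_4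
    unfolding sum_over_permutations_insert[OF *(1,2)] sum_over_permutations_insert[OF *(3,4)]
      sum_over_permutations_insert[OF *(5,6)] permutes_sing
    by (simp add: sign_swap_id permutation_swap_id sign_compose sign_id swap_id_eq
        permutation_compose algebra_simps)
qed

lemma vector_4 [simp]:
  "(vector [a, b, c, d] :: 'a::zero^4) $ 1 = a"
  "(vector [a, b, c, d] :: 'a::zero^4) $ 2 = b"
  "(vector [a, b, c, d] :: 'a::zero^4) $ 3 = c"
  "(vector [a, b, c, d] :: 'a::zero^4) $ 4 = d"
  unfolding vector_def by simp_all

text \<open>The second compound matrix: the matrix of \<open>wedge_map U\<close> on the wedges of
  standard basis vectors. The images of the gates are computed from these entries.\<close>

definition minor :: "op4 \<Rightarrow> 4 \<Rightarrow> 4 \<Rightarrow> 4 \<Rightarrow> 4 \<Rightarrow> complex" where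
  "minor U p q a b = U $ p $ a * U $ q $ b - U $ p $ b * U $ q $ a"

lemma wedge_map_e_wedge: "wedge_map U (e_wedge a b) $ p $ q = minor U p q a b"
proof -
  have "(U *v axis k 1) $ p = U $ p $ k" for k p
    by (simp add: matrix_vector_mult_def axis_def if_distrib[of "\<lambda>x. _ * x"] cong: if_cong)
  then show ?thesis
    unfolding wedge_map_wedge by (simp add: wedge_def minor_def)
qed


lemma wedge_map_linear:
  "wedge_map U (cscale c (X + Y)) = cscale c (wedge_map U X + wedge_map U Y)"
  "wedge_map U (cscale c (X - Y)) = cscale c (wedge_map U X - wedge_map U Y)"
  by (simp_all add: wedge_map_def cscale_def matrix_matrix_mult_def vec_eq_iff algebra_simps
      sum.distrib sum_distrib_left sum_subtractf)

lemma wedge_map_basisB: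
  "wedge_map U (basisB $ 1) $ p $ q = \<i> / complex_of_real (sqrt 2) * (minor U p q 1 2 - minor U p q 3 4)"
  "wedge_map U (basisB $ 2) $ p $ q = 1 / complex_of_real (sqrt 2) * (minor U p q 1 2 + minor U p q 3 4)"
  "wedge_map U (basisB $ 3) $ p $ q = \<i> / complex_of_real (sqrt 2) * (minor U p q 2 3 - minor U p q 1 4)"
  "wedge_map U (basisB $ 4) $ p $ q = 1 / complex_of_real (sqrt 2) * (minor U p q 2 4 + minor U p q 3 1)"
  "wedge_map U (basisB $ 5) $ p $ q = \<i> / complex_of_real (sqrt 2) * (minor U p q 2 4 - minor U p q 3 1)"
  "wedge_map U (basisB $ 6) $ p $ q = 1 / complex_of_real (sqrt 2) * (minor U p q 2 3 + minor U p q 1 4)"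
  unfolding basisB_simps wedge_map_linear
  by (simp_all only: cscale_def vec_lambda_beta vector_add_component vector_minus_component wedge_map_e_wedge)

lemma wedge_inner_basisB:
  "2 * wedge_inner (basisB $ 1) X = - \<i> / complex_of_real (sqrt 2) * (X$1$2 - X$2$1 - X$3$4 + X$4$3)"
  "2 * wedge_inner (basisB $ 2) X = 1 / complex_of_real (sqrt 2) * (X$1$2 - X$2$1 + X$3$4 - X$4$3)"
  "2 * wedge_inner (basisB $ 3) X = - \<i> / complex_of_real (sqrt 2) * (X$2$3 - X$3$2 - X$1$4 + X$4$1)"
  "2 * wedge_inner (basisB $ 4) X = 1 / complex_of_real (sqrt 2) * (X$2$4 - X$4$2 - X$1$3 + X$3$1)"
  "2 * wedge_inner (basisB $ 5) X = - \<i> / complex_of_real (sqrt 2) * (X$2$4 - X$4$2 + X$1$3 - X$3$1)"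
  "2 * wedge_inner (basisB $ 6) X = 1 / complex_of_real (sqrt 2) * (X$2$3 - X$3$2 + X$1$4 - X$4$1)"
  unfolding basisB_simps
  by (simp_all add: wedge_inner_def wedge_def cscale_def axis_def sum_4 field_simps)


lemma minor_swap: "minor U p q a b = - minor U q p a b"
  by (simp add: minor_def)

text \<open>The image of a basis vector is alternating, so transposed entries contribute equally to
  the inner product and its factor 1/2 disappears. These are the formulas by which the simplifier
  evaluates the gates.\<close>

lemma so6_rows:
  fixes U :: op4 and j :: 6
  defines "W \<equiv> wedge_map U (basisB $ j)"
  shows
    "so6 U $ 1 $ j = - \<i> / complex_of_real (sqrt 2) * (W $ 1 $ 2 - W $ 3 $ 4)"
    "so6 U $ 2 $ j = 1 / complex_of_real (sqrt 2) * (W $ 1 $ 2 + W $ 3 $ 4)"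
    "so6 U $ 3 $ j = - \<i> / complex_of_real (sqrt 2) * (W $ 2 $ 3 - W $ 1 $ 4)"
    "so6 U $ 4 $ j = 1 / complex_of_real (sqrt 2) * (W $ 2 $ 4 + W $ 3 $ 1)"
    "so6 U $ 5 $ j = - \<i> / complex_of_real (sqrt 2) * (W $ 2 $ 4 - W $ 3 $ 1)"
    "so6 U $ 6 $ j = 1 / complex_of_real (sqrt 2) * (W $ 2 $ 3 + W $ 1 $ 4)"
proof -
  have "\<forall>j. wedge_map U (basisB $ j) $ p $ q = - wedge_map U (basisB $ j) $ q $ p" for p q
    unfolding forall_6 wedge_map_basisB minor_swap[of U p q] by (simp add: algebra_simps)
  then have *: "W $ p $ q = - W $ q $ p" for p q
    unfolding W_def by blast
  \<comment> \<open>These are the sign patterns of \<open>wedge_inner_basisB\<close> after one entry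
    of each transposed pair has been replaced by the negative of the other.\<close>
  have halve: "2 * w = k * (a - - a - b + - b) \<Longrightarrow> w = k * (a - b)"
    "2 * w = k * (a - - a + b - - b) \<Longrightarrow> w = k * (a + b)"
    "2 * w = k * (a - - a + - b - b) \<Longrightarrow> w = k * (a - b)"
    "2 * w = k * (a - - a - - b + b) \<Longrightarrow> w = k * (a + b)" for w k a b :: complex
    by (rule iffD1[OF mult_left_cancel[of 2 w]], simp, simp add: algebra_simps)+
  show
    "so6 U $ 1 $ j = - \<i> / complex_of_real (sqrt 2) * (W $ 1 $ 2 - W $ 3 $ 4)"
    "so6 U $ 2 $ j = 1 / complex_of_real (sqrt 2) * (W $ 1 $ 2 + W $ 3 $ 4)"
    "so6 U $ 3 $ j = - \<i> / complex_of_real (sqrt 2) * (W $ 2 $ 3 - W $ 1 $ 4)"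
    "so6 U $ 4 $ j = 1 / complex_of_real (sqrt 2) * (W $ 2 $ 4 + W $ 3 $ 1)"
    "so6 U $ 5 $ j = - \<i> / complex_of_real (sqrt 2) * (W $ 2 $ 4 - W $ 3 $ 1)"
    "so6 U $ 6 $ j = 1 / complex_of_real (sqrt 2) * (W $ 2 $ 3 + W $ 1 $ 4)"
    unfolding so6_def vec_lambda_beta W_def[symmetric]
    using wedge_inner_basisB[of W, unfolded *[of 2 1] *[of 4 3] *[of 3 2] *[of 4 1] *[of 4 2] *[of 1 3]]
    by - (erule halve)+
qed

section \<open>Signed permutation matrices, quarter turns and the gates\<close>

definition signed_perm :: "(6 \<Rightarrow> 6) \<Rightarrow> (6 \<Rightarrow> complex) \<Rightarrow> complex^6^6" where
  "signed_perm p e = (\<chi> i j. if i = p j then e j else 0)"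

lemma signed_perm_mult:
  "signed_perm p e ** signed_perm q d = signed_perm (p \<circ> q) (\<lambda>j. e (q j) * d j)"
  by (simp add: signed_perm_def matrix_matrix_mult_def vec_eq_iff if_distrib[of "\<lambda>x. x * _"]
      if_distrib[of "\<lambda>x. _ * x"] cong: if_cong)

definition swp :: "6 \<Rightarrow> 6 \<Rightarrow> 6 \<Rightarrow> 6" where
  "swp a b j = (if j = a then b else if j = b then a else j)"

text \<open>For distinct axes, the quarter turn that carries axis \<open>a\<close> to axis
  \<open>b\<close> and axis \<open>b\<close> to minus axis \<open>a\<close>.\<close>

definition rot :: "6 \<Rightarrow> 6 \<Rightarrow> complex^6^6" where
  "rot a b = signed_perm (swp a b) (\<lambda>j. if j = b then -1 else 1)"

lemma kron_S_left: "kron S_gate (mat 1) = diag4 1 1 \<i> \<i>"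
  and kron_S_right: "kron (mat 1) S_gate = diag4 1 \<i> 1 \<i>"
  by (simp_all add: kron_def S_gate_def diag4_def mat_def vector_2)

lemma kron_H_left: "kron H_gate (mat 1) = cscale (1 / complex_of_real (sqrt 2))
    (vector [vector [1, 0, 1, 0], vector [0, 1, 0, 1], vector [1, 0, -1, 0], vector [0, 1, 0, -1]])"
  and kron_H_right: "kron (mat 1) H_gate = cscale (1 / complex_of_real (sqrt 2))
    (vector [vector [1, 1, 0, 0], vector [1, -1, 0, 0], vector [0, 0, 1, 1], vector [0, 0, 1, -1]])"
  by (simp_all add: kron_def H_gate_def cscale_def mat_def vector_2 vec_eq_iff forall_4)

lemma diag4_nth: "diag4 a b c d $ p $ q = (if p = q then vector [a, b, c, d] $ p else 0)"
proof -
  have "\<forall>p q. diag4 a b c d $ p $ q = (if p = q then vector [a, b, c, d] $ p else 0)"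
    by (simp add: diag4_def forall_4)
  then show ?thesis by simp
qed

lemma so6_H_left: "so6 (kron H_gate (mat 1)) = signed_perm (swp 1 3) (\<lambda>j. if j = 2 then 1 else -1)"
  and det_H_left: "det (kron H_gate (mat 1)) = 1"
  and unitary_H_left: "unitary (kron H_gate (mat 1))"
proof -
  define M :: op4 where "M = vector [vector [1, 0, 1, 0], vector [0, 1, 0, 1], vector [1, 0, -1, 0], vector [0, 1, 0, -1]]"
  have M:
    "M $ 1 $ 1 = 1" "M $ 1 $ 2 = 0" "M $ 1 $ 3 = 1" "M $ 1 $ 4 = 0"
    "M $ 2 $ 1 = 0" "M $ 2 $ 2 = 1" "M $ 2 $ 3 = 0" "M $ 2 $ 4 = 1"
    "M $ 3 $ 1 = 1" "M $ 3 $ 2 = 0" "M $ 3 $ 3 = -1" "M $ 3 $ 4 = 0"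
    "M $ 4 $ 1 = 0" "M $ 4 $ 2 = 1" "M $ 4 $ 3 = 0" "M $ 4 $ 4 = -1"
    by (simp_all add: M_def)
  have r2: "(1 / complex_of_real (sqrt 2))\<^sup>2 = 1 / 2"
    by (simp add: power2_eq_square csqrt2)
  then have r4: "(1 / complex_of_real (sqrt 2)) ^ 4 = 1 / 4"
    using power_mult[of "1 / complex_of_real (sqrt 2)" 2 2] by (simp add: power2_eq_square)
  show "so6 (kron H_gate (mat 1)) = signed_perm (swp 1 3) (\<lambda>j. if j = 2 then 1 else -1)"
    unfolding kron_H_left M_def[symmetric] so6_cscale r2 vec_eq_iff forall_6 cscale_def so6_rows
      wedge_map_basisB minor_def M vec_lambda_beta
    by (simp add: signed_perm_def swp_def csqrt2)
  have "det M = 4"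
    unfolding det_4 M by simp
  then show "det (kron H_gate (mat 1)) = 1"
    unfolding kron_H_left M_def[symmetric] det_cscale by (simp add: r4)
  have "adjoint_mat M = M"
    unfolding vec_eq_iff forall_4 adjoint_mat_def vec_lambda_beta M by simp
  moreover have "M ** M = cscale 2 (mat 1)"
    unfolding vec_eq_iff forall_4 matrix_matrix_mult_def sum_4 cscale_def mat_def vec_lambda_beta M by simp
  ultimately show "unitary (kron H_gate (mat 1))"
    unfolding kron_H_left M_def[symmetric] by (simp add: unitary_def adjoint_mat_cscale csqrt2)
qed

lemma so6_H_right: "so6 (kron (mat 1) H_gate) = signed_perm (swp 4 6) (\<lambda>j. if j = 5 then 1 else -1)"
  and det_H_right: "det (kron (mat 1) H_gate) = 1"
  and unitary_H_right: "unitary (kron (mat 1) H_gate)"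
proof -
  define M :: op4 where "M = vector [vector [1, 1, 0, 0], vector [1, -1, 0, 0], vector [0, 0, 1, 1], vector [0, 0, 1, -1]]"
  have M:
    "M $ 1 $ 1 = 1" "M $ 1 $ 2 = 1" "M $ 1 $ 3 = 0" "M $ 1 $ 4 = 0"
    "M $ 2 $ 1 = 1" "M $ 2 $ 2 = -1" "M $ 2 $ 3 = 0" "M $ 2 $ 4 = 0"
    "M $ 3 $ 1 = 0" "M $ 3 $ 2 = 0" "M $ 3 $ 3 = 1" "M $ 3 $ 4 = 1"
    "M $ 4 $ 1 = 0" "M $ 4 $ 2 = 0" "M $ 4 $ 3 = 1" "M $ 4 $ 4 = -1"
    by (simp_all add: M_def)
  have r2: "(1 / complex_of_real (sqrt 2))\<^sup>2 = 1 / 2"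
    by (simp add: power2_eq_square csqrt2)
  then have r4: "(1 / complex_of_real (sqrt 2)) ^ 4 = 1 / 4"
    using power_mult[of "1 / complex_of_real (sqrt 2)" 2 2] by (simp add: power2_eq_square)
  show "so6 (kron (mat 1) H_gate) = signed_perm (swp 4 6) (\<lambda>j. if j = 5 then 1 else -1)"
    unfolding kron_H_right M_def[symmetric] so6_cscale r2 vec_eq_iff forall_6 cscale_def so6_rows
      wedge_map_basisB minor_def M vec_lambda_beta
    by (simp add: signed_perm_def swp_def csqrt2)
  have "det M = 4"
    unfolding det_4 M by simp
  then show "det (kron (mat 1) H_gate) = 1"
    unfolding kron_H_right M_def[symmetric] det_cscale by (simp add: r4)
  have "adjoint_mat M = M"
    unfolding vec_eq_iff forall_4 adjoint_mat_def vec_lambda_beta M by simp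
  moreover have "M ** M = cscale 2 (mat 1)"
    unfolding vec_eq_iff forall_4 matrix_matrix_mult_def sum_4 cscale_def mat_def vec_lambda_beta M by simp
  ultimately show "unitary (kron (mat 1) H_gate)"
    unfolding kron_H_right M_def[symmetric] by (simp add: unitary_def adjoint_mat_cscale csqrt2)
qed


lemma det_diag4: "det (diag4 a b c d) = a * b * c * d"
  by (simp add: det_4 diag4_nth)

lemma unitary_diag4:
  assumes "cmod a = 1" "cmod b = 1" "cmod c = 1" "cmod d = 1"
  shows "unitary (diag4 a b c d)"
proof -
  have mult: "diag4 x y z w ** diag4 x' y' z' w' = diag4 (x * x') (y * y') (z * z') (w * w')" for x y z w x' y' z' w'
    by (simp add: vec_eq_iff forall_4 matrix_matrix_mult_def sum_4 diag4_nth)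
  have "adjoint_mat (diag4 a b c d) = diag4 (cnj a) (cnj b) (cnj c) (cnj d)"
    by (simp add: vec_eq_iff forall_4 adjoint_mat_def diag4_nth)
  moreover have "cnj a * a = 1" "cnj b * b = 1" "cnj c * c = 1" "cnj d * d = 1"
    using assms by (simp_all add: cnj_mult_self_eq_1)
  moreover have "diag4 1 1 1 1 = mat 1"
    by (simp add: vec_eq_iff forall_4 mat_def diag4_nth)
  ultimately show ?thesis
    by (simp add: unitary_def mult mult.commute)
qed

text \<open>The gate has determinant -1, so the admissible scalars are i and -i; the choice -i
  leaves the other four axes fixed instead of negated.\<close>

lemma so6_S_left: "cscale (-\<i>) (so6 (kron S_gate (mat 1))) = rot 1 2"
  unfolding kron_S_left vec_eq_iff forall_6 cscale_def vec_lambda_beta so6_rows wedge_map_basisB minor_def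
    diag4_nth
  by (simp add: rot_def signed_perm_def swp_def csqrt2)

lemma so6_S_right: "cscale (-\<i>) (so6 (kron (mat 1) S_gate)) = rot 4 5"
  unfolding kron_S_right vec_eq_iff forall_6 cscale_def vec_lambda_beta so6_rows wedge_map_basisB minor_def
    diag4_nth
  by (simp add: rot_def signed_perm_def swp_def csqrt2)

abbreviation CZ_perm :: "6 \<Rightarrow> 6" where
  "CZ_perm \<equiv> swp 1 2 \<circ> swp 3 6 \<circ> swp 4 5"

abbreviation CZ_sign :: "6 \<Rightarrow> complex" where
  "CZ_sign \<equiv> \<lambda>j. if j = 2 \<or> j = 5 \<or> j = 6 then -1 else 1"

lemma so6_CZ: "cscale (-\<i>) (so6 CZ_gate) = signed_perm CZ_perm CZ_sign"
  unfolding CZ_gate_def vec_eq_iff forall_6 cscale_def vec_lambda_beta so6_rows wedge_map_basisB minor_def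
    diag4_nth
  by (simp add: rot_def signed_perm_def swp_def csqrt2)

text \<open>A rotation by 45 degrees is (I + R) / sqrt 2 with R the quarter turn in the same plane.
  Here R is the image of CZ, the square of CS, and turns the planes 1-2, 3-6 and 4-5. The scalar in
  front is a square root of -i, the inverse of the determinant of CS.\<close>

lemma so6_CS:
  "cscale ((1 - \<i>) / complex_of_real (sqrt 2)) (so6 CS_gate) =
    cscale (1 / complex_of_real (sqrt 2)) (mat 1 + signed_perm CZ_perm CZ_sign)"
proof -
  have 1: "(1 + \<i>) / 2 * (1 - \<i>) = 1"
    by (simp add: algebra_simps)
  have "so6 CS_gate = cscale ((1 + \<i>) / 2) (mat 1 + signed_perm CZ_perm CZ_sign)"
    unfolding CS_gate_def vec_eq_iff forall_6 cscale_def vec_lambda_beta so6_rows wedge_map_basisB minor_def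
      diag4_nth
    by (simp add: signed_perm_def swp_def csqrt2 mat_def right_diff_distrib distrib_left add_divide_distrib)
  then show ?thesis
    using 1 by (simp add: mult.commute)
qed

lemma rot_adjoint: "adjoint6 (rot a b) = rot b a"
proof -
  have "adjoint6 (rot a b) $ i $ j = rot b a $ i $ j" for i j
    by (cases "i = a"; cases "i = b"; cases "j = a"; cases "j = b"; simp add: adjoint6_def rot_def signed_perm_def swp_def)
  then show ?thesis
    by (simp add: vec_eq_iff)
qed

text \<open>Conjugation by the quarter turn from \<open>b\<close> to \<open>c\<close> carries the
  plane of \<open>a\<close> and \<open>b\<close> to that of \<open>a\<close> and \<open>c\<close>.
  It makes the relation "joined by a realizable quarter turn" transitive.\<close>

lemma rot_conj:
  assumes "a \<noteq> b" "b \<noteq> c" "a \<noteq> c"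
  shows "rot b c ** rot a b ** rot c b = rot a c"
proof -
  have "swp b c \<circ> swp a b \<circ> swp c b = swp a c"
  proof
    fix j
    show "(swp b c \<circ> swp a b \<circ> swp c b) j = swp a c j"
      using assms by (cases "j = a"; cases "j = b"; cases "j = c"; simp add: swp_def)
  qed
  moreover have "(if (swp a b \<circ> swp c b) j = c then -1 else 1) * ((if swp c b j = b then -1 else 1) * (if j = b then -1 else 1))
      = (if j = c then -1 else 1 :: complex)" for j
    using assms by (cases "j = a"; cases "j = b"; cases "j = c"; simp add: swp_def)
  ultimately show ?thesis
    unfolding rot_def signed_perm_mult by (simp add: mult.assoc)
qed

lemma signed_perm_eqI: "p = q \<Longrightarrow> e = d \<Longrightarrow> signed_perm p e = signed_perm q d"
  by simp

lemma rot_2_3: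
  defines "h \<equiv> signed_perm (swp 1 3) (\<lambda>j. if j = 2 then 1 else -1)"
  shows "h ** rot 1 2 ** h = rot 2 3"
  unfolding h_def rot_def signed_perm_mult
  by (rule signed_perm_eqI; unfold fun_eq_iff forall_6; simp add: swp_def)

lemma rot_5_6:
  defines "h \<equiv> signed_perm (swp 4 6) (\<lambda>j. if j = 5 then 1 else -1)"
  shows "h ** rot 4 5 ** h = rot 5 6"
  unfolding h_def rot_def signed_perm_mult
  by (rule signed_perm_eqI; unfold fun_eq_iff forall_6; simp add: swp_def)

text \<open>CZ acts as three quarter turns in disjoint planes; the inverse phase gates cancel those
  in the planes 1-2 and 4-5.\<close>

lemma rot_3_6: "signed_perm CZ_perm CZ_sign ** rot 2 1 ** rot 5 4 = rot 3 6"
  unfolding rot_def signed_perm_mult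
  by (rule signed_perm_eqI; unfold fun_eq_iff forall_6; simp add: swp_def)

section \<open>The Clifford group acts by all signed permutations\<close>

abbreviation clifford_gates :: "op4 set" where
  "clifford_gates \<equiv>
     {kron H_gate (mat 1), kron (mat 1) H_gate, kron S_gate (mat 1), kron (mat 1) S_gate, CZ_gate}"

lemma unitary_clifford_gates: "g \<in> clifford_gates \<Longrightarrow> unitary g"
  by (auto simp: unitary_H_left unitary_H_right kron_S_left kron_S_right CZ_gate_def unitary_diag4)

lemma unitary_CS: "unitary CS_gate"
  by (simp add: CS_gate_def unitary_diag4)

lemma clifford_unitary: "C \<in> clifford \<Longrightarrow> unitary C"
  unfolding clifford_def by (erule generate_unitary_unitary) (rule unitary_clifford_gates)

lemma clifford_mult: "A \<in> clifford \<Longrightarrow> B \<in> clifford \<Longrightarrow> A ** B \<in> clifford"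
  unfolding clifford_def by (rule generate_unitary_mult)

lemma clifford_one: "mat 1 \<in> clifford"
  unfolding clifford_def by (rule generate_unitary_one)

lemma clifford_adjoint: "C \<in> clifford \<Longrightarrow> adjoint_mat C \<in> clifford"
  unfolding clifford_def by (erule generate_unitary_adjoint_mat) (rule unitary_clifford_gates)

lemma clifford_gate: "g \<in> clifford_gates \<Longrightarrow> g \<in> clifford"
  unfolding clifford_def by (rule generate.incl)

lemma clifford_CS_gates_unitary: "g \<in> clifford \<union> {CS_gate} \<Longrightarrow> unitary g"
  using clifford_unitary unitary_CS by blast

lemma clifford_CS_unitary: "U \<in> clifford_CS \<Longrightarrow> unitary U"
  unfolding clifford_CS_def by (erule generate_unitary_unitary) (rule clifford_CS_gates_unitary)

lemma clifford_CS_mult: "A \<in> clifford_CS \<Longrightarrow> B \<in> clifford_CS \<Longrightarrow> A ** B \<in> clifford_CS"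
  unfolding clifford_CS_def by (rule generate_unitary_mult)

lemma clifford_CS_adjoint: "U \<in> clifford_CS \<Longrightarrow> adjoint_mat U \<in> clifford_CS"
  unfolding clifford_CS_def by (erule generate_unitary_adjoint_mat) (rule clifford_CS_gates_unitary)

lemma clifford_subset: "C \<in> clifford \<Longrightarrow> C \<in> clifford_CS"
  unfolding clifford_CS_def by (simp add: generate.incl)

lemma CS_in_clifford_CS: "CS_gate \<in> clifford_CS"
  unfolding clifford_CS_def by (simp add: generate.incl)

definition realizable :: "complex^6^6 \<Rightarrow> bool" where
  "realizable V \<longleftrightarrow> (\<exists>C\<in>clifford. V \<in> so6_images C)"

lemma realizable_mult: "realizable V \<Longrightarrow> realizable W \<Longrightarrow> realizable (V ** W)"
  unfolding realizable_def using clifford_mult so6_images_mult by blast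

lemma realizable_adjoint: "realizable V \<Longrightarrow> realizable (adjoint6 V)"
  unfolding realizable_def using clifford_adjoint so6_images_adjoint by blast

lemma so6_images_mat_1: "mat 1 \<in> so6_images (mat 1)"
  unfolding so6_images_iff by (intro exI[of _ 1]) (simp add: so6_mat_1)

lemma realizable_one: "realizable (mat 1)"
  unfolding realizable_def using clifford_one so6_images_mat_1 by blast

lemma so6_images_H_left:
  "signed_perm (swp 1 3) (\<lambda>j. if j = 2 then 1 else -1) \<in> so6_images (kron H_gate (mat 1))"
  unfolding so6_images_iff by (intro exI[of _ 1]) (simp add: det_H_left so6_H_left)

lemma so6_images_H_right:
  "signed_perm (swp 4 6) (\<lambda>j. if j = 5 then 1 else -1) \<in> so6_images (kron (mat 1) H_gate)"
  unfolding so6_images_iff by (intro exI[of _ 1]) (simp add: det_H_right so6_H_right)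

lemma so6_images_S_left: "rot 1 2 \<in> so6_images (kron S_gate (mat 1))"
  unfolding so6_images_iff so6_S_left[symmetric]
  by (intro exI[of _ "-\<i>"]) (simp add: kron_S_left det_diag4)

lemma so6_images_S_right: "rot 4 5 \<in> so6_images (kron (mat 1) S_gate)"
  unfolding so6_images_iff so6_S_right[symmetric]
  by (intro exI[of _ "-\<i>"]) (simp add: kron_S_right det_diag4)

lemma so6_images_CZ: "signed_perm CZ_perm CZ_sign \<in> so6_images CZ_gate"
  unfolding so6_images_iff so6_CZ[symmetric]
  by (intro exI[of _ "-\<i>"]) (simp add: CZ_gate_def det_diag4)

lemma so6_images_CS:
  "cscale (1 / complex_of_real (sqrt 2)) (mat 1 + signed_perm CZ_perm CZ_sign) \<in> so6_images CS_gate"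
proof -
  have "(1 - \<i>)\<^sup>2 = - 2 * \<i>"
    by (simp add: power2_eq_square algebra_simps)
  then show ?thesis
    unfolding so6_images_iff so6_CS[symmetric]
    by (intro exI[of _ "(1 - \<i>) / complex_of_real (sqrt 2)"])
      (simp add: CS_gate_def det_diag4 norm_divide cmod_def power_divide power2_eq_square csqrt2)
qed

lemma realizable_rot:
  assumes "a \<noteq> b"
  shows "realizable (rot a b)"
proof -
  \<comment> \<open>Admitting equal axes makes \<open>r\<close> an equivalence relation, so it is
    enough to join the axes along the path 1-2-3-6-5-4. The Hadamard gates give 2-3 and 5-6 by
    conjugation, and CZ gives 3-6.\<close>
  define r where "r a b \<longleftrightarrow> a = b \<or> realizable (rot a b)" for a b
  have sym: "r a b \<Longrightarrow> r b a" for a b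
    unfolding r_def using realizable_adjoint[of "rot a b"] by (auto simp: rot_adjoint)
  have trans: "r a c" if "r a b" "r b c" for a b c
    using that rot_conj[of a b c] sym[of b c]
    unfolding r_def by (metis realizable_mult)
  have gate: "realizable V" if "V \<in> so6_images g" "g \<in> clifford_gates" for V g
    using that clifford_gate unfolding realizable_def by blast
  have H: "realizable (signed_perm (swp 1 3) (\<lambda>j. if j = 2 then 1 else -1))"
    "realizable (signed_perm (swp 4 6) (\<lambda>j. if j = 5 then 1 else -1))"
    and CZ: "realizable (signed_perm CZ_perm CZ_sign)"
    by (rule gate, (rule so6_images_H_left so6_images_H_right so6_images_CZ), simp)+
  have S: "realizable (rot 1 2)" "realizable (rot 4 5)"
    by (rule gate, (rule so6_images_S_left so6_images_S_right), simp)+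
  have "r 1 2" "r 4 5"
    using S by (simp_all add: r_def)
  moreover have "r 2 3"
    unfolding r_def using realizable_mult[OF realizable_mult[OF H(1) S(1)] H(1)]
    by (simp only: rot_2_3 simp_thms)
  moreover have "r 5 6"
    unfolding r_def using realizable_mult[OF realizable_mult[OF H(2) S(2)] H(2)]
    by (simp only: rot_5_6 simp_thms)
  moreover have "r 3 6"
    unfolding r_def
    using realizable_mult[OF realizable_mult[OF CZ realizable_adjoint[OF S(1)]] realizable_adjoint[OF S(2)]]
    by (simp only: rot_adjoint rot_3_6 simp_thms)
  ultimately have "r 1 1" "r 1 2" "r 1 3" "r 1 6" "r 1 5" "r 1 4"
    by (auto simp: r_def[of 1 1] intro: trans[of 1 2 3] trans[of 1 3 6, OF trans[of 1 2 3]]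
        trans[of 1 6 5, OF trans[of 1 3 6, OF trans[of 1 2 3]] sym]
        trans[of 1 5 4, OF trans[of 1 6 5, OF trans[of 1 3 6, OF trans[of 1 2 3]] sym] sym])
  then have "\<forall>a. r 1 a"
    unfolding forall_6 by blast
  then have "r a b"
    using trans sym by blast
  with assms show ?thesis
    by (simp add: r_def)
qed

lemma rot_square:
  assumes "a \<noteq> b"
  shows "rot a b ** rot a b = signed_perm id (\<lambda>j. if j = a \<or> j = b then -1 else 1)"
  unfolding rot_def signed_perm_mult
proof (rule arg_cong2[where f = signed_perm]; rule ext)
  fix j
  show "(swp a b \<circ> swp a b) j = id j"
    by (cases "j = a"; cases "j = b"; simp add: swp_def)
  show "(if swp a b j = b then - 1 else 1) * (if j = b then - 1 else 1) =
      (if j = a \<or> j = b then - 1 else (1 :: complex))"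
    using assms by (cases "j = a"; cases "j = b"; simp add: swp_def)
qed

lemma swp_inj: "inj (swp a b)"
  by (rule injI) (auto simp: swp_def split: if_splits)

text \<open>Columns are put in place one after another by quarter turns, and wrong signs are
  repaired by half turns. A half turn flips two signs, so the sign of column 1 is kept as a reserve
  and left free in the conclusion; this takes the place of a determinant condition.\<close>

lemma realizable_signed_perm:
  fixes p :: "6 \<Rightarrow> 6" and e :: "6 \<Rightarrow> complex"
  assumes "inj p" and e: "\<And>j. e j \<in> {1, -1}"
  obtains q d where "realizable (signed_perm q d)" "inj q" "\<And>j. d j \<in> {1, -1}"
    "\<And>j. q j = p j" "\<And>j. j \<noteq> 1 \<Longrightarrow> d j = e j"
proof -
  have "\<exists>q d. realizable (signed_perm q d) \<and> inj q \<and> (\<forall>j. d j \<in> {1, -1}) \<and> (\<forall>j\<in>J. q j = p j \<and> d j = e j)"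
    if "finite J" "1 \<notin> J" for J :: "6 set"
    using that
  proof (induction J)
    case empty
    have "mat 1 = signed_perm id (\<lambda>_. 1)"
      by (simp add: signed_perm_def mat_def vec_eq_iff)
    then show ?case
      using realizable_one by (intro exI[of _ id] exI[of _ "\<lambda>_. 1"]) (simp del: id_apply)
  next
    case (insert j J)
    then obtain q d where IH: "realizable (signed_perm q d)" "inj q" "\<And>j. d j \<in> {1, -1}"
      "\<And>j. j \<in> J \<Longrightarrow> q j = p j \<and> d j = e j"
      by auto
    have qj: "p i \<noteq> q j" and pj: "p i \<noteq> p j" if "i \<in> J" for i
      using that insert.hyps(2) IH(4)[of i] injD[OF IH(2), of j i] injD[OF assms(1), of j i] by metis+
    \<comment> \<open>A correction on the left has to send row \<open>q j\<close> to row
      \<open>p j\<close> with the right sign and fix the rows of the columns already placed.\<close>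
    have step: ?case if "realizable (signed_perm r s)" "inj r" "\<And>i. s i \<in> {1, -1}" "r (q j) = p j"
      "s (q j) * d j = e j" "\<And>i. i \<in> J \<Longrightarrow> r (p i) = p i \<and> s (p i) = 1" for r s
    proof (intro exI conjI allI ballI)
      show "realizable (signed_perm (r \<circ> q) (\<lambda>i. s (q i) * d i))"
        using realizable_mult[OF that(1) IH(1)] by (simp only: signed_perm_mult)
      show "inj (r \<circ> q)"
        using that(2) IH(2) by (rule inj_compose)
      show "s (q i) * d i \<in> {1, -1}" for i
        using that(3)[of "q i"] IH(3)[of i] by auto
      show "(r \<circ> q) i = p i" "s (q i) * d i = e i" if "i \<in> insert j J" for i
        using that \<open>r (q j) = p j\<close> \<open>s (q j) * d j = e j\<close> IH(4)[of i]
          \<open>\<And>i. i \<in> J \<Longrightarrow> r (p i) = p i \<and> s (p i) = 1\<close>[of i] by auto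
    qed
    \<comment> \<open>The direction of the quarter turn between \<open>q j\<close> and
      \<open>p j\<close> decides the sign with which row \<open>q j\<close> arrives. A wrong sign in
      the right place is repaired by a half turn that also negates row \<open>p 1\<close>, which no
      column of \<open>J\<close> occupies.\<close>
    consider "q j \<noteq> p j" "d j = e j" | "q j \<noteq> p j" "d j = - e j" | "q j = p j" "d j = e j"
      | "q j = p j" "d j = - e j"
    proof -
      have "d j = e j \<or> d j = - e j"
        using e[of j] IH(3)[of j] by auto
      then show thesis
        using that by blast
    qed
    then show ?case
    proof cases
      case 1
      show ?thesis
        by (rule step[OF realizable_rot[OF 1(1), unfolded rot_def] swp_inj])
          (use 1 qj pj in \<open>auto simp: swp_def\<close>)
    next
      case 2
      show ?thesis
        by (rule step[OF realizable_rot[OF 2(1)[symmetric], unfolded rot_def] swp_inj])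
          (use 2 qj pj in \<open>auto simp: swp_def\<close>)
    next
      case 3
      then show ?thesis
        using IH by (intro exI[of _ q] exI[of _ d]) auto
    next
      case 4
      have "p j \<noteq> p 1"
        using insert.prems injD[OF assms(1), of j 1] by auto
      moreover have "p i \<noteq> p 1" if "i \<in> J" for i
        using insert.prems that injD[OF assms(1), of 1 i] by auto
      moreover have "realizable (signed_perm id (\<lambda>i. if i = p j \<or> i = p 1 then -1 else 1))"
        using realizable_mult[OF realizable_rot[OF calculation(1)] realizable_rot[OF calculation(1)]]
        by (simp only: rot_square[OF calculation(1)])
      ultimately show ?thesis
        by (intro step[of id "\<lambda>i. if i = p j \<or> i = p 1 then -1 else 1"]) (use 4 pj in auto)
    qed
  qed
  from this[of "UNIV - {1}"] obtain q d where qd: "realizable (signed_perm q d)" "inj q"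
    "\<And>j. d j \<in> {1, -1}" "\<And>j. j \<noteq> 1 \<Longrightarrow> q j = p j \<and> d j = e j"
    by auto
  \<comment> \<open>Injectivity leaves a single row for the remaining column.\<close>
  have "q 1 = p 1"
  proof -
    obtain i where i: "p i = q 1"
      using assms(1) by (metis finite_UNIV_inj_surj finite_class.finite_UNIV surjD)
    then show ?thesis
      using qd(4)[of i] injD[OF qd(2), of i 1] by metis
  qed
  then have qp: "q j = p j" for j
    using qd(4)[of j] by (cases "j = 1") simp_all
  have de: "d j = e j" if "j \<noteq> 1" for j
    using qd(4)[OF that] by (rule conjunct2)
  show ?thesis
    by (rule that[OF qd(1-3) qp de])
qed

section \<open>The kernel of the representation\<close>

lemma e_wedge_nth: "e_wedge a b $ p $ q = (if p = a \<and> q = b then 1 else 0) - (if p = b \<and> q = a then 1 else 0)"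
  by (cases "p = a"; cases "q = b"; cases "p = b"; cases "q = a"; simp add: wedge_def axis_def)

text \<open>Five of the six basis vectors suffice, so no determinant is needed to recognise the identity.\<close>

lemma so6_kernel:
  assumes "unitary W" and fixed: "\<And>i j. j \<noteq> 1 \<Longrightarrow> so6 W $ i $ j = (if i = j then 1 else 0)"
  obtains c where "W = cscale c (mat 1)"
proof -
  define D where "D = transpose (adjoint_mat W)"
  have D: "transpose W ** D = mat 1"
    using assms(1) unfolding D_def unitary_def by (metis matrix_transpose_mul transpose_mat)
  have B: "wedge_map W (basisB $ j) = basisB $ j" if "j \<noteq> 1" for j
  proof -
    have "(\<Sum>i\<in>UNIV. cscale (if i = j then 1 else 0) (basisB $ i)) = (\<Sum>i\<in>UNIV. if i = j then basisB $ i else 0)"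
      by (intro sum.cong) (auto simp: cscale_def vec_eq_iff)
    then show ?thesis
      using fixed[OF that] so6_is_matrix[of W j] by simp
  qed
  define stab where "stab X \<longleftrightarrow> wedge_map W X = X" for X
  have lin: "stab (cscale c (X + Y))" "stab (cscale c (X - Y))" if "stab X" "stab Y" for c X Y
    using that by (simp_all add: stab_def wedge_map_linear)
  have eq: "X = cscale (1 / 2) (Y + Z)" if "\<And>p q. 2 * X $ p $ q = Y $ p $ q + Z $ p $ q" for X Y Z :: op4
    using that by (simp add: vec_eq_iff cscale_def field_simps)
  have scaled: "stab X" if "stab (cscale c X)" "c \<noteq> 0" for c X
    using lin(1)[OF that(1) that(1), of "1 / (2 * c)"] that(2)
    by (simp add: cscale_def vec_eq_iff stab_def)
  \<comment> \<open>Basis vectors 4, 5 and 3, 6 will isolate four single wedges.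
    \<open>e_wedge 1 2\<close> and \<open>e_wedge 3 4\<close> are available only through their sum,
    since their difference belongs to basis vector 1.\<close>
  have plus: "stab (e_wedge 1 2 + e_wedge 3 4)" "stab (e_wedge 2 4 + e_wedge 3 1)" "stab (e_wedge 2 3 + e_wedge 1 4)"
    and minus: "stab (e_wedge 2 4 - e_wedge 3 1)" "stab (e_wedge 2 3 - e_wedge 1 4)"
    using B[of 2] B[of 3] B[of 4] B[of 5] B[of 6] unfolding basisB_simps stab_def[symmetric]
    by (auto intro: scaled)
  have half: "stab X" "stab Y" if "stab (X + Y)" "stab (X - Y)" for X Y
  proof -
    have "cscale (1 / 2) (X + Y + (X - Y)) = X" "cscale (1 / 2) (X + Y - (X - Y)) = Y"
      by (simp_all add: cscale_def vec_eq_iff)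
    then show "stab X" "stab Y"
      using lin[OF that, of "1 / 2"] by simp_all
  qed
  \<comment> \<open>For a fixed form \<open>X\<close>, the quadratic relation W X W^T = X becomes
    the linear relation W X = X D, with \<open>D\<close> the inverse of W^T, and its entries can be
    compared directly.\<close>
  have comm: "(W ** X) $ p $ q = (X ** D) $ p $ q" if "stab X" for X p q
  proof -
    have "W ** X = W ** X ** (transpose W ** D)"
      by (simp add: D)
    also have "\<dots> = X ** D"
      using that by (simp add: stab_def wedge_map_def matrix_mul_assoc)
    finally show ?thesis by simp
  qed
  note comms = comm[OF half(1)[OF plus(2) minus(1)]] comm[OF half(2)[OF plus(2) minus(1)]]
    comm[OF half(1)[OF plus(3) minus(2)]] comm[OF half(2)[OF plus(3) minus(2)]]
  have ent: "(W ** e_wedge a b) $ p $ q = (if q = b then W $ p $ a else 0) - (if q = a then W $ p $ b else 0)"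
    "(e_wedge a b ** D) $ p $ q = (if p = a then D $ b $ q else 0) - (if p = b then D $ a $ q else 0)" for a b p q
    by (simp_all add: matrix_matrix_mult_def e_wedge_nth right_diff_distrib left_diff_distrib sum_subtractf
        if_distrib[of "\<lambda>x. _ * x"] if_distrib[of "\<lambda>x. x * _"] conj_commute cong: if_cong conj_cong)
  note c24 = comms(1)[unfolded ent] and c31 = comms(2)[unfolded ent]
    and c23 = comms(3)[unfolded ent] and c14 = comms(4)[unfolded ent]
  have off: "W $ 1 $ 2 = 0" "W $ 1 $ 3 = 0" "W $ 1 $ 4 = 0" "W $ 2 $ 1 = 0" "W $ 2 $ 3 = 0" "W $ 2 $ 4 = 0"
    "W $ 3 $ 1 = 0" "W $ 3 $ 2 = 0" "W $ 3 $ 4 = 0" "W $ 4 $ 1 = 0" "W $ 4 $ 2 = 0" "W $ 4 $ 3 = 0"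
    using c24[of 4 1] c23[of 2 1] c24[of 2 1] c31[of 3 2] c31[of 1 2] c14[of 1 2]
      c14[of 4 3] c24[of 4 3] c24[of 2 3] c31[of 3 4] c23[of 3 4] c31[of 1 4] by simp_all
  \<comment> \<open>The single wedges identify diagonal entry 1 with 2 and entry 3 with 4; the sum
    of the other two wedges links these halves.\<close>
  have "(W ** (e_wedge 1 2 + e_wedge 3 4)) $ 1 $ 2 = ((e_wedge 1 2 + e_wedge 3 4) ** D) $ 1 $ 2"
    by (rule comm[OF plus(1)])
  then have "W $ 1 $ 1 = D $ 2 $ 2"
    by (simp add: matrix_add_ldistrib matrix_matrix_mult_def sum_4 e_wedge_nth)
  then have "W $ 2 $ 2 = W $ 1 $ 1" "W $ 3 $ 3 = W $ 1 $ 1" "W $ 4 $ 4 = W $ 1 $ 1"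
    using c24[of 4 2] c14[of 4 1] c24[of 2 4] c23[of 2 3] by simp_all
  then have "W = cscale (W $ 1 $ 1) (mat 1)"
    unfolding vec_eq_iff forall_4 cscale_def mat_def using off by simp
  then show ?thesis
    by (rule that)
qed

section \<open>Denominator exponents\<close>

definition integral_at :: "nat \<Rightarrow> complex^6^6 \<Rightarrow> bool" where
  "integral_at n V \<longleftrightarrow> (\<forall>i j. complex_of_real (sqrt 2 ^ n) * V $ i $ j \<in> \<int>)"

lemma integral_at_mult:
  assumes "integral_at m V" "integral_at n W"
  shows "integral_at (m + n) (V ** W)"
proof -
  have "complex_of_real (sqrt 2 ^ (m + n)) * (V ** W) $ i $ j =
    (\<Sum>k\<in>UNIV. (complex_of_real (sqrt 2 ^ m) * V $ i $ k) * (complex_of_real (sqrt 2 ^ n) * W $ k $ j))" for i j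
    by (simp add: matrix_matrix_mult_def sum_distrib_left power_add mult_ac)
  then show ?thesis
    using assms unfolding integral_at_def by (simp only: Ints_sum Ints_mult simp_thms)
qed

lemma cnj_in_Ints: "z \<in> \<int> \<Longrightarrow> cnj z \<in> \<int>"
  by (auto elim!: Ints_cases)

lemma integral_at_adjoint:
  assumes "integral_at n V"
  shows "integral_at n (adjoint6 V)"
proof -
  have "complex_of_real (sqrt 2 ^ n) * adjoint6 V $ i $ j = cnj (complex_of_real (sqrt 2 ^ n) * V $ j $ i)" for i j
    by (simp add: adjoint6_def)
  then show ?thesis
    using assms cnj_in_Ints unfolding integral_at_def by metis
qed

lemma integral_at_uminus:
  assumes "integral_at n V"
  shows "integral_at n (cscale (-1) V)"
  using assms unfolding integral_at_def cscale_def by simp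

text \<open>Quantifying over all images avoids choosing a phase. By \<open>integral_iff\<close> any
  one image decides, and a unitary operator has one.\<close>

definition so6_integral :: "nat \<Rightarrow> op4 \<Rightarrow> bool" where
  "so6_integral n U \<longleftrightarrow> (\<forall>V\<in>so6_images U. integral_at n V)"

lemma integral_iff:
  assumes "V \<in> so6_images U"
  shows "so6_integral n U \<longleftrightarrow> integral_at n V"
  using so6_images_sign[OF assms] assms integral_at_uminus unfolding so6_integral_def by metis

text \<open>Subadditivity of the exponent, the source of the lower bound on the count and of the
  exactness of each reduction.\<close>

lemma integral_mult:
  assumes "so6_integral m A" "so6_integral n B" "unitary A" "unitary B"
  shows "so6_integral (m + n) (A ** B)"
proof -
  obtain V W where VW: "V \<in> so6_images A" "W \<in> so6_images B"
    using assms(3,4) so6_images_nonempty by blast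
  then have "integral_at (m + n) (V ** W)"
    using assms(1,2) by (intro integral_at_mult) (auto simp: so6_integral_def)
  then show ?thesis
    using integral_iff[OF so6_images_mult[OF VW]] by simp
qed

lemma integral_adjoint:
  assumes "so6_integral n A" "unitary A"
  shows "so6_integral n (adjoint_mat A)"
proof -
  obtain V where V: "V \<in> so6_images A"
    using assms(2) so6_images_nonempty by blast
  then have "integral_at n (adjoint6 V)"
    using assms(1) by (intro integral_at_adjoint) (auto simp: so6_integral_def)
  then show ?thesis
    using integral_iff[OF so6_images_adjoint[OF V]] by simp
qed

lemma integral_at_signed_perm:
  assumes "\<And>j. e j \<in> {1, -1}"
  shows "integral_at 0 (signed_perm p e)"
proof -
  have "e j \<in> \<int>" for j
    using assms[of j] by auto
  then show ?thesis
    by (simp add: integral_at_def signed_perm_def)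
qed

lemma integral_mat_1: "so6_integral 0 (mat 1)"
proof -
  have "integral_at 0 (mat 1)"
    by (simp add: integral_at_def mat_def)
  then show ?thesis
    using integral_iff[OF so6_images_mat_1] by simp
qed

lemma integral_clifford:
  assumes "C \<in> clifford"
  shows "so6_integral 0 C"
proof -
  have *: "so6_integral 0 g" if "signed_perm p e \<in> so6_images g" "\<And>j. e j \<in> {1, -1}" for p e g
    using integral_iff[OF that(1)] integral_at_signed_perm[OF that(2)] by simp
  have gates: "so6_integral 0 g" if "g \<in> clifford_gates" for g
    using that *[OF so6_images_H_left] *[OF so6_images_H_right] *[OF so6_images_S_left[unfolded rot_def]]
      *[OF so6_images_S_right[unfolded rot_def]] *[OF so6_images_CZ]
    by auto
  from assms show ?thesis
    unfolding clifford_def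
  proof (induction rule: generate_unitary_induct)
    case (mult a b)
    then have "unitary a" "unitary b"
      using clifford_unitary by (simp_all add: clifford_def)
    then show ?case
      using integral_mult[OF mult.IH] by simp
  qed (auto intro: integral_mat_1 gates integral_adjoint unitary_clifford_gates)
qed

lemma integral_CS: "so6_integral 1 CS_gate"
proof -
  have "integral_at 1 (cscale (1 / complex_of_real (sqrt 2)) (mat 1 + signed_perm CZ_perm CZ_sign))"
    by (simp add: integral_at_def cscale_def mat_def signed_perm_def)
  then show ?thesis
    using integral_iff[OF so6_images_CS] by simp
qed

lemma not_integral_CS: "\<not> so6_integral 0 CS_gate"
proof
  assume "so6_integral 0 CS_gate"
  then have "integral_at 0 (cscale (1 / complex_of_real (sqrt 2)) (mat 1 + signed_perm CZ_perm CZ_sign))"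
    using integral_iff[OF so6_images_CS] by simp
  then have "1 / complex_of_real (sqrt 2) * (mat 1 + signed_perm CZ_perm CZ_sign) $ 1 $ 1 \<in> \<int>"
    unfolding integral_at_def by (simp add: cscale_def)
  moreover have "(mat 1 + signed_perm CZ_perm CZ_sign) $ 1 $ 1 = 1"
    by (simp add: mat_def signed_perm_def swp_def)
  ultimately have "1 / complex_of_real (sqrt 2) \<in> \<int>"
    by simp
  then obtain n :: int where "1 / complex_of_real (sqrt 2) = of_int n"
    by (auto elim: Ints_cases)
  then have "complex_of_real (1 / sqrt 2) = complex_of_real (of_int n)"
    by simp
  then have n: "1 / sqrt 2 = of_int n"
    unfolding of_real_eq_iff .
  have "0 < 1 / sqrt 2" "1 / sqrt 2 < 1"
    by simp_all
  with n show False
    by simp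
qed

text \<open>\<open>CS_count\<close> compares matrices; this keeps the Clifford gates of a circuit
  from being counted.\<close>

lemma CS_notin_clifford: "CS_gate \<notin> clifford"
  using integral_clifford not_integral_CS by blast

lemma clifford_CS_integral:
  assumes "U \<in> clifford_CS"
  shows "\<exists>n. so6_integral n U"
  using assms unfolding clifford_CS_def
proof (induction rule: generate_unitary_induct)
  case (mult a b)
  then have "unitary a" "unitary b"
    using clifford_CS_unitary by (simp_all add: clifford_CS_def)
  then show ?case
    using integral_mult mult.IH by blast
qed (use integral_mat_1 integral_clifford integral_CS integral_adjoint clifford_CS_gates_unitary in blast)+

section \<open>The exponent of an operator and the lower bound on the count\<close>

definition level :: "op4 \<Rightarrow> nat" where
  "level U = (LEAST n. so6_integral n U)"

lemma lde_eq_level: "V \<in> so6_images U \<Longrightarrow> lde V = level U"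
  using integral_iff[of V U] unfolding lde_def level_def integral_at_def by simp

lemma integral_level: "U \<in> clifford_CS \<Longrightarrow> so6_integral (level U) U"
  unfolding level_def using clifford_CS_integral LeastI_ex by metis

lemma level_le: "so6_integral n U \<Longrightarrow> level U \<le> n"
  unfolding level_def by (rule Least_le)

lemma circuit_product_Cons: "circuit_product (g # gs) = g ** circuit_product gs"
  by (simp add: circuit_product_def)

lemma circuit_product_append: "circuit_product (gs @ hs) = circuit_product gs ** circuit_product hs"
  by (induction gs) (simp_all add: circuit_product_def matrix_mul_assoc)

lemma level_le_CS_count:
  assumes "is_circuit_for U gs"
  shows "level U \<le> CS_count gs"
proof -
  have "unitary (circuit_product gs) \<and> so6_integral (CS_count gs) (circuit_product gs)"
    if "set gs \<subseteq> clifford \<union> {CS_gate}" for gs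
    using that
  proof (induction gs)
    case Nil
    then show ?case
      by (simp add: circuit_product_def CS_count_def integral_mat_1)
  next
    case (Cons g gs)
    then have IH: "unitary (circuit_product gs)" "so6_integral (CS_count gs) (circuit_product gs)"
      by auto
    have g: "unitary g" "so6_integral (if g = CS_gate then 1 else 0) g"
      using Cons.prems clifford_CS_gates_unitary integral_clifford integral_CS by auto
    show ?case
      using integral_mult[OF g(2) IH(2) g(1) IH(1)] unitary_mult[OF g(1) IH(1)]
      by (simp add: circuit_product_Cons CS_count_def split: if_splits)
  qed
  then show ?thesis
    using assms level_le unfolding is_circuit_for_def by blast
qed

text \<open>Unitarity of the image, with both factors scaled by sqrt 2 ^ k, turns into integer
  orthogonality relations for rows and columns. Integers are real, so the conjugation drops
  out.\<close>

lemma integer_matrix: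
  assumes "V \<in> so6_images U" "unitary U" "integral_at k V"
  obtains N :: "6 \<Rightarrow> 6 \<Rightarrow> int" where
    "\<And>i j. complex_of_real (sqrt 2 ^ k) * V $ i $ j = of_int (N i j)"
    "\<And>a b. (\<Sum>j\<in>UNIV. N a j * N b j) = (if a = b then 2 ^ k else 0)"
    "\<And>a b. (\<Sum>i\<in>UNIV. N i a * N i b) = (if a = b then 2 ^ k else 0)"
proof -
  define s where "s = complex_of_real (sqrt 2 ^ k)"
  have ss: "s * s = 2 ^ k" "cnj s = s"
    by (simp_all add: s_def csqrt2 flip: power_mult_distrib)
  have "\<forall>i j. \<exists>n. s * V $ i $ j = of_int n"
    using assms(3) unfolding integral_at_def s_def[symmetric] by (meson Ints_cases)
  then obtain N where N: "\<And>i j. s * V $ i $ j = of_int (N i j)"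
    by metis
  have cN: "s * cnj (V $ i $ j) = of_int (N i j)" for i j
    using arg_cong[OF N[of i j], of cnj] ss(2) by simp
  have "of_int (\<Sum>j\<in>UNIV. N a j * N b j) = (of_int (if a = b then 2 ^ k else 0) :: complex)" for a b
  proof -
    have "of_int (\<Sum>j\<in>UNIV. N a j * N b j) = (\<Sum>j\<in>UNIV. (s * V $ a $ j) * (s * cnj (V $ b $ j)))"
      by (simp add: N cN)
    also have "\<dots> = (s * s) * (V ** adjoint6 V) $ a $ b"
      by (simp add: matrix_matrix_mult_def adjoint6_def sum_distrib_left mult_ac)
    finally show ?thesis
      using so6_images_unitary(1)[OF assms(1,2)] ss by (simp add: mat_def)
  qed
  moreover have "of_int (\<Sum>i\<in>UNIV. N i a * N i b) = (of_int (if a = b then 2 ^ k else 0) :: complex)" for a b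
  proof -
    have "of_int (\<Sum>i\<in>UNIV. N i a * N i b) = (\<Sum>i\<in>UNIV. (s * cnj (V $ i $ a)) * (s * V $ i $ b))"
      by (simp add: N cN)
    also have "\<dots> = (s * s) * (adjoint6 V ** V) $ a $ b"
      by (simp add: matrix_matrix_mult_def adjoint6_def sum_distrib_left mult_ac)
    finally show ?thesis
      using so6_images_unitary(2)[OF assms(1,2)] ss by (simp add: mat_def)
  qed
  ultimately show ?thesis
    using that[of N] N unfolding s_def of_int_eq_iff by blast
qed

text \<open>
  Unlike \<open>integral_at\<close>, integrality of the scaled squared moduli is monotone in the exponent, and it
  does not depend on the phase.
\<close>

lemma level_le_iff:
  assumes "U \<in> clifford_CS"
  shows "level U \<le> n \<longleftrightarrow> (\<forall>i j. 2 ^ n * (cmod (so6 U $ i $ j))\<^sup>2 \<in> \<int>)"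
proof -
  define k where "k = level U"
  have U: "unitary U"
    using assms by (rule clifford_CS_unitary)
  then obtain V where V: "V \<in> so6_images U"
    using so6_images_nonempty by blast
  then have iat: "integral_at k V"
    using integral_level[OF assms] by (simp add: so6_integral_def k_def)
  obtain N :: "6 \<Rightarrow> 6 \<Rightarrow> int" where N: "\<And>i j. complex_of_real (sqrt 2 ^ k) * V $ i $ j = of_int (N i j)"
    "\<And>a b. (\<Sum>j\<in>UNIV. N a j * N b j) = (if a = b then 2 ^ k else 0)"
    by (rule integer_matrix[OF V U iat]) (rule that)
  obtain m where m: "cmod m = 1" "V = cscale m (so6 U)"
    using V unfolding so6_images_iff by blast
  have sq: "2 ^ k * (cmod (so6 U $ i $ j))\<^sup>2 = of_int ((N i j)\<^sup>2)" for i j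
  proof -
    have "cmod (so6 U $ i $ j) = cmod (V $ i $ j)"
      using m by (simp add: cscale_def norm_mult)
    moreover have "(cmod (complex_of_real (sqrt 2 ^ k) * V $ i $ j))\<^sup>2 = 2 ^ k * (cmod (V $ i $ j))\<^sup>2"
      by (simp add: norm_mult power_mult_distrib norm_power flip: power_mult) (simp add: power_mult mult.commute[of k])
    ultimately show ?thesis
      unfolding N(1) by simp
  qed
  show ?thesis
    unfolding k_def[symmetric]
  proof
    assume "k \<le> n"
    then have "(2::real) ^ n = 2 ^ (n - k) * 2 ^ k"
      by (simp flip: power_add)
    then have "2 ^ n * (cmod (so6 U $ i $ j))\<^sup>2 = of_int (2 ^ (n - k) * (N i j)\<^sup>2)" for i j
      using sq[of i j] by (simp add: mult.assoc)
    then show "\<forall>i j. 2 ^ n * (cmod (so6 U $ i $ j))\<^sup>2 \<in> \<int>"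
      by (metis Ints_of_int)
  next
    assume int: "\<forall>i j. 2 ^ n * (cmod (so6 U $ i $ j))\<^sup>2 \<in> \<int>"
    show "k \<le> n"
    proof (rule ccontr)
      assume "\<not> k \<le> n"
      \<comment> \<open>If n < k, each squared integer entry is divisible by 2 ^ (k - n).\<close>
      have ev: "even (N i j)" for i j
      proof -
        obtain z where z: "2 ^ n * (cmod (so6 U $ i $ j))\<^sup>2 = of_int z"
          using int by (meson Ints_cases)
        have "(2::real) ^ k = 2 * 2 ^ (k - n - 1) * 2 ^ n"
          using \<open>\<not> k \<le> n\<close> by (simp flip: power_Suc power_add)
        then have "of_int ((N i j)\<^sup>2) = (of_int (2 * 2 ^ (k - n - 1) * z) :: real)"
          using sq[of i j] z by (simp add: mult.assoc)
        then have "(N i j)\<^sup>2 = 2 * 2 ^ (k - n - 1) * z"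
          unfolding of_int_eq_iff .
        then have "even ((N i j)\<^sup>2)"
          by simp
        then show ?thesis
          by simp
      qed
      show False
      \<comment> \<open>Halving an even matrix lowers the exponent by two and contradicts
        minimality. At k = 1 there is no room for this; there the row norm 2 would have to be
        divisible by 4.\<close>
      proof (cases "k = 1")
        case True
        have "4 dvd (\<Sum>j\<in>UNIV. N 1 j * N 1 j)"
          using ev mult_dvd_mono[of 2 _ 2] by (intro dvd_sum) fastforce
        then show False
          unfolding N(2) using True by simp
      next
        case False
        then obtain l where l: "k = Suc (Suc l)"
          using \<open>\<not> k \<le> n\<close> by (metis One_nat_def Suc_pred bot_nat_0.extremum gr0I)
        have "complex_of_real (sqrt 2 ^ l) * V $ i $ j \<in> \<int>" for i j
        proof -
          obtain x where x: "N i j = 2 * x"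
            using ev[of i j] by (elim evenE)
          have "2 * (complex_of_real (sqrt 2 ^ l) * V $ i $ j) = complex_of_real (sqrt 2 ^ k) * V $ i $ j"
            unfolding l by (simp add: csqrt2 mult.assoc[symmetric])
          also have "\<dots> = 2 * of_int x"
            unfolding N(1) x by simp
          finally show ?thesis
            by simp
        qed
        then have "so6_integral l U"
          using integral_iff[OF V] by (simp add: integral_at_def)
        then show False
          using level_le[of l U] l by (simp add: k_def)
      qed
    qed
  qed
qed

section \<open>Pairing the rows modulo two\<close>

lemma sum_of_odd_squares:
  fixes f :: "6 \<Rightarrow> int"
  shows "(\<Sum>j\<in>UNIV. f j * f j) mod 4 = int (card {j. odd (f j)}) mod 4"
proof -
  have "(x * x) mod 4 = (if odd x then 1 else 0)" for x :: int
  proof (cases "even x")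
    case True
    then show ?thesis by (auto elim!: evenE)
  next
    case False
    then obtain y where "x = 2 * y + 1"
      by (auto elim: oddE)
    then have "x * x = 1 + 4 * (y * y + y)"
      by (simp add: algebra_simps)
    moreover have "(1 + 4 * z) mod 4 = 1" for z :: int
      by presburger
    ultimately show ?thesis
      using False by (simp only: if_True simp_thms)
  qed
  then have "(\<Sum>j\<in>UNIV. f j * f j mod 4) = (\<Sum>j\<in>UNIV. if odd (f j) then 1 else 0)"
    by simp
  also have "\<dots> = int (card {j. odd (f j)})"
    by (simp add: sum.If_cases)
  finally show ?thesis
    by (metis mod_sum_eq)
qed

lemma even_sum_products:
  fixes f g :: "6 \<Rightarrow> int"
  shows "even (\<Sum>j\<in>UNIV. f j * g j) \<longleftrightarrow> even (card ({j. odd (f j)} \<inter> {j. odd (g j)}))"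
proof -
  have "even (\<Sum>j\<in>UNIV. f j * g j) \<longleftrightarrow> even (card {j \<in> UNIV. odd (f j * g j)})"
    by (rule even_sum_iff) simp
  moreover have "{j \<in> UNIV. odd (f j * g j)} = {j. odd (f j)} \<inter> {j. odd (g j)}"
    by auto
  ultimately show ?thesis by simp
qed

lemma card_le_6: "card (A :: 6 set) \<le> 6"
  using card_mono[of UNIV A] by simp

text \<open>
  Counting the odd entries in the rows that meet the support of row \<open>a\<close> in two ways determines the
  number of rows equal to row \<open>a\<close> modulo two.
\<close>

lemma even_card_equal_rows:
  fixes N :: "6 \<Rightarrow> 6 \<Rightarrow> int"
  assumes rows: "\<And>a b. (\<Sum>j\<in>UNIV. N a j * N b j) = (if a = b then 2 ^ k else 0)"
    and cols: "\<And>a b. (\<Sum>i\<in>UNIV. N i a * N i b) = (if a = b then 2 ^ k else 0)"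
    and "0 < k"
  defines "S \<equiv> \<lambda>a. {j. odd (N a j)}"
  shows "even (card {b. S b = X})"
proof -
  define T where "T = (\<lambda>j. {a. odd (N a j)})"
  have inter: "even (card (S a \<inter> S b))" for a b
    using even_sum_products[of "N a" "N b"] rows[of a b] \<open>0 < k\<close> by (simp add: S_def split: if_splits)
  have S4: "int (card (S a)) mod 4 = 2 ^ k mod 4" for a
    using sum_of_odd_squares[of "N a"] rows[of a a] by (simp add: S_def)
  have T4: "int (card (T j)) mod 4 = 2 ^ k mod 4" for j
    using sum_of_odd_squares[of "\<lambda>i. N i j"] cols[of j j] by (simp add: T_def)
  \<comment> \<open>Both sides count the pairs of a row \<open>b\<close> and a column
    \<open>j\<close> such that rows \<open>a\<close> and \<open>b\<close> are both odd at
    \<open>j\<close>.\<close>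
  have double: "(\<Sum>b\<in>UNIV. card (S a \<inter> S b)) = (\<Sum>j\<in>S a. card (T j))" for a
  proof -
    have "(\<Sum>b\<in>UNIV. card (S a \<inter> S b)) = (\<Sum>b\<in>UNIV. \<Sum>j\<in>S a. if j \<in> S b then 1 else 0)"
      by (simp add: sum.If_cases)
    also have "\<dots> = (\<Sum>j\<in>S a. \<Sum>b\<in>UNIV. if j \<in> S b then 1 else 0)"
      by (rule sum.swap)
    also have "\<dots> = (\<Sum>j\<in>S a. card (T j))"
      by (simp add: sum.If_cases T_def S_def)
    finally show ?thesis .
  qed
  have eqI: "S b = S a" if "card (S b) = card (S a)" "card (S a \<inter> S b) = card (S a)" for a b
  proof -
    have "S a \<inter> S b = S a" "S a \<inter> S b = S b"
      by (rule card_subset_eq; use that in simp)+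
    then show ?thesis by simp
  qed
  show ?thesis
  \<comment> \<open>The norm 2 ^ k modulo 4 separates the cases: for k = 1 every support has two
    elements, for larger k it has none or four.\<close>
  proof (cases "k = 1")
    case True
    have le: "int (card {j. odd (f j)}) \<le> (\<Sum>j\<in>UNIV. f j * f j)" for f :: "6 \<Rightarrow> int"
    proof -
      have "int (card {j. odd (f j)}) = (\<Sum>j\<in>UNIV. if odd (f j) then 1 else 0)"
        by (simp add: sum.If_cases)
      also have "\<dots> \<le> (\<Sum>j\<in>UNIV. f j * f j)"
      proof (rule sum_mono)
        fix j
        show "(if odd (f j) then 1 else 0) \<le> f j * f j"
        proof (cases "f j = 0")
          case False
          then have "0 < f j * f j"
            by (metis not_real_square_gt_zero zero_less_mult_iff linorder_neqE)
          then show ?thesis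
            by simp
        qed simp
      qed
      finally show ?thesis .
    qed
    have S2: "card (S a) = 2" for a
    proof -
      have "card (S a) \<le> 2"
        using le[of "N a"] rows[of a a] True by (simp add: S_def)
      moreover have "int (card (S a)) mod 4 = 2"
        using S4[of a] True by simp
      ultimately show ?thesis
        by presburger
    qed
    have T2: "card (T j) = 2" for j
    proof -
      have "card (T j) \<le> 2"
        using le[of "\<lambda>i. N i j"] cols[of j j] True by (simp add: T_def)
      moreover have "int (card (T j)) mod 4 = 2"
        using T4[of j] True by simp
      ultimately show ?thesis
        by presburger
    qed
    have ne: "card (S a \<inter> S b) = (if S b = S a then 2 else 0)" for a b
    proof (cases "S b = S a")
      case False
      have "card (S a \<inter> S b) \<le> 2"
        using card_mono[of "S a" "S a \<inter> S b"] S2[of a] by simp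
      moreover have "card (S a \<inter> S b) \<noteq> 2"
        using False eqI[of b a] S2[of a] S2[of b] by auto
      ultimately have "card (S a \<inter> S b) = 0"
        using inter[of a b] by presburger
      then show ?thesis
        using False by simp
    qed (simp add: S2)
    show ?thesis
    proof (cases "\<exists>a. S a = X")
      case True
      then obtain a where a: "S a = X" by blast
      have "(\<Sum>b\<in>UNIV. card (S a \<inter> S b)) = 2 * card {b. S b = S a}"
        by (simp add: ne sum.If_cases)
      moreover have "(\<Sum>j\<in>S a. card (T j)) = 4"
        by (simp add: T2 S2)
      ultimately show ?thesis
        using double[of a] a by simp
    qed auto
  next
    case False
    then obtain l where "k = l + 2"
      using \<open>0 < k\<close> by (metis One_nat_def add_2_eq_Suc' gr0_implies_Suc not0_implies_Suc)
    then have k4: "(2::int) ^ k mod 4 = 0"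
      by simp
    have S04: "card (S a) = 0 \<or> card (S a) = 4" for a
      using S4[of a] card_le_6[of "S a"] unfolding k4 by presburger
    have T04: "card (T j) = 0 \<or> card (T j) = 4" for j
      using T4[of j] card_le_6[of "T j"] unfolding k4 by presburger
    have nonempty: "even (card {b. S b = S a})" if "S a \<noteq> {}" for a
    proof -
      define m where "m = card {b. S b \<noteq> {} \<and> S b \<noteq> S a}"
      have Sa: "card (S a) = 4"
        using that S04[of a] by (simp add: card_eq_0_iff)
      \<comment> \<open>The intersection is even and smaller than four; it cannot be empty, since
        two sets of size four overlap among six columns.\<close>
      have two: "card (S a \<inter> S b) = 2" if "S b \<noteq> {}" "S b \<noteq> S a" for b
      proof -
        have Sb: "card (S b) = 4"
          using that S04[of b] by (simp add: card_eq_0_iff)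
        have "card (S a \<inter> S b) \<le> 4"
          using card_mono[of "S a" "S a \<inter> S b"] Sa by simp
        moreover have "card (S a \<inter> S b) \<noteq> 4"
          using that(2) eqI[of b a] Sa Sb by auto
        moreover have "card (S a \<inter> S b) + card (S a \<union> S b) = 8"
          using card_Un_Int[of "S a" "S b"] Sa Sb by simp
        ultimately show ?thesis
          using inter[of a b] card_le_6[of "S a \<union> S b"] by presburger
      qed
      have val: "card (S a \<inter> S b) = (if S b = S a then 4 else 0) + (if S b \<noteq> {} \<and> S b \<noteq> S a then 2 else 0)" for b
        using two[of b] Sa that by auto
      have "(\<Sum>b\<in>UNIV. card (S a \<inter> S b)) = 4 * card {b. S b = S a} + 2 * m"
        unfolding val sum.distrib by (simp add: sum.If_cases m_def)
      moreover have "card (T j) = 4" if "j \<in> S a" for j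
      proof -
        have "a \<in> T j"
          using that by (simp add: S_def T_def)
        then show ?thesis
          using T04[of j] by (auto simp: card_eq_0_iff)
      qed
      then have "(\<Sum>j\<in>S a. card (T j)) = 16"
        using Sa by simp
      \<comment> \<open>Two different supports of size four meet in two columns and hence cover all
        six. A column \<open>p\<close> outside the support of row \<open>a\<close> is thus odd
        exactly in the other nonzero rows, so \<open>m\<close> is a column count. The double count 4
        x + 2 m = 16 then gives x = 4 or x = 2.\<close>
      moreover have "m = 0 \<or> m = 4"
      proof -
        have "S a \<noteq> UNIV"
          using Sa by auto
        then obtain p where p: "p \<notin> S a" by blast
        have "p \<in> S b" if "S b \<noteq> {}" "S b \<noteq> S a" for b
        proof (rule ccontr)
          assume "p \<notin> S b"
          have "card (S a \<union> S b) = 6"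
            using card_Un_Int[of "S a" "S b"] Sa two[OF that] S04[of b] that(1) by (simp add: card_eq_0_iff)
          then have "S a \<union> S b = UNIV"
            by (intro card_subset_eq) simp_all
          with p \<open>p \<notin> S b\<close> show False
            by blast
        qed
        then have "T p = {b. S b \<noteq> {} \<and> S b \<noteq> S a}"
          using p by (auto simp: T_def S_def)
        then show ?thesis
          using T04[of p] by (simp add: m_def)
      qed
      ultimately show ?thesis
        using double[of a] by presburger
    qed
    show ?thesis
    proof (cases "X = {}")
      case True
      \<comment> \<open>The zero rows are what remains of the six after the nonzero classes, each
        already known to be even.\<close>
      have "even (card {b. S b \<noteq> {}})"
      proof -
        have "card {b. S b \<noteq> {}} = (\<Sum>Y\<in>S ` {b. S b \<noteq> {}}. card {b \<in> {b. S b \<noteq> {}}. S b = Y})"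
          unfolding card_eq_sum by (rule sum.image_gen) simp
        also have "even \<dots>"
        proof (rule dvd_sum)
          fix Y assume "Y \<in> S ` {b. S b \<noteq> {}}"
          then obtain a where a: "Y = S a" "S a \<noteq> {}" by blast
          then have "{b \<in> {b. S b \<noteq> {}}. S b = Y} = {b. S b = S a}"
            by auto
          then show "even (card {b \<in> {b. S b \<noteq> {}}. S b = Y})"
            using nonempty[OF a(2)] by simp
        qed
        finally show ?thesis .
      qed
      moreover have "card {b. S b = {}} + card {b. S b \<noteq> {}} = 6"
      proof -
        have "card {b. S b = {}} + card {b. S b \<noteq> {}} = card ({b. S b = {}} \<union> {b. S b \<noteq> {}})"
          by (rule card_Un_disjoint[symmetric]) auto
        moreover have "{b. S b = {}} \<union> {b. S b \<noteq> {}} = (UNIV :: 6 set)"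
          by blast
        ultimately show ?thesis by simp
      qed
      ultimately show ?thesis
        using True by presburger
    next
      case False
      show ?thesis
      proof (cases "\<exists>a. S a = X")
        case True
        then show ?thesis
          using nonempty False by blast
      qed auto
    qed
  qed
qed

text \<open>A nonempty fibre of even size has a second element, and removing two elements of one
  fibre keeps all fibres even, so the extraction can be repeated.\<close>

lemma pair_from_even_fibres:
  assumes "finite A" "A \<noteq> {}" "\<And>y. even (card {b \<in> A. f b = y})"
  obtains a b where "a \<in> A" "b \<in> A" "a \<noteq> b" "f a = f b" "\<And>y. even (card {c \<in> A - {a, b}. f c = y})"
proof -
  obtain a where a: "a \<in> A"
    using assms(2) by blast
  have "card {b \<in> A. f b = f a} \<noteq> 1"
    using assms(3)[of "f a"] by auto
  then have "{b \<in> A. f b = f a} \<noteq> {a}"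
    by auto
  then obtain b where b: "b \<in> A" "b \<noteq> a" "f b = f a"
    using a by blast
  have "even (card {c \<in> A - {a, b}. f c = y})" for y
  proof (cases "y = f a")
    case True
    have "{c \<in> A - {a, b}. f c = y} = {c \<in> A. f c = y} - {a, b}"
      by auto
    moreover have "card ({c \<in> A. f c = y} - {a, b}) = card {c \<in> A. f c = y} - card {a, b}"
      using a b True by (intro card_Diff_subset) auto
    ultimately show ?thesis
      using assms(3)[of y] b(2) by simp
  next
    case False
    then have "{c \<in> A - {a, b}. f c = y} = {c \<in> A. f c = y}"
      using b by auto
    then show ?thesis
      using assms(3)[of y] by simp
  qed
  then show ?thesis
    using that[of a b] a b by simp
qed

text \<open>The three pairs are indexed by the two-cycles 1-2, 3-6 and 4-5 of
  \<open>CZ_perm\<close>, the planes in which CS rotates; this accounts for the order of the values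
  of \<open>p\<close>.\<close>

lemma matching_exists:
  fixes f :: "6 \<Rightarrow> 'a"
  assumes "\<And>y. even (card {b. f b = y})"
  obtains p :: "6 \<Rightarrow> 6" where "inj p" "\<And>i. f (p (CZ_perm i)) = f (p i)"
proof -
  obtain a1 b1 where 1: "a1 \<noteq> b1" "f a1 = f b1" "\<And>y. even (card {c \<in> UNIV - {a1, b1}. f c = y})"
    using pair_from_even_fibres[of UNIV f] assms by auto
  have c1: "card (UNIV - {a1, b1}) = 4"
    using 1(1) by (simp add: card_Diff_subset)
  then have ne1: "UNIV - {a1, b1} \<noteq> {}"
    by fastforce
  obtain a2 b2 where 2: "a2 \<in> UNIV - {a1, b1}" "b2 \<in> UNIV - {a1, b1}" "a2 \<noteq> b2" "f a2 = f b2"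
    "\<And>y. even (card {c \<in> UNIV - {a1, b1} - {a2, b2}. f c = y})"
    by (rule pair_from_even_fibres[OF finite ne1 1(3)]) (use that in blast)
  have "card (UNIV - {a1, b1} - {a2, b2}) = card (UNIV - {a1, b1}) - card {a2, b2}"
    using 2(1,2) by (intro card_Diff_subset) auto
  then have ne2: "UNIV - {a1, b1} - {a2, b2} \<noteq> {}"
    using c1 2(3) by fastforce
  obtain a3 b3 where 3: "a3 \<in> UNIV - {a1, b1} - {a2, b2}" "b3 \<in> UNIV - {a1, b1} - {a2, b2}" "a3 \<noteq> b3"
    "f a3 = f b3"
    by (rule pair_from_even_fibres[OF finite ne2 2(5)]) (use that in blast)
  define p :: "6 \<Rightarrow> 6" where "p i = (if i = 1 then a1 else if i = 2 then b1 else if i = 3 then a2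
    else if i = 6 then b2 else if i = 4 then a3 else b3)" for i
  have p: "p 1 = a1" "p 2 = b1" "p 3 = a2" "p 4 = a3" "p 5 = b3" "p 6 = b2"
    by (simp_all add: p_def)
  have "\<forall>i j. p i = p j \<longrightarrow> i = j"
    unfolding forall_6 p using 1(1) 2(1-3) 3(1-3) by auto
  then have "inj p"
    by (simp add: inj_def)
  moreover have "\<forall>i. f (p (CZ_perm i)) = f (p i)"
    unfolding forall_6 using 1(2) 2(4) 3(4) by (simp add: swp_def p)
  ultimately show ?thesis
    using that by blast
qed

section \<open>Reducing the denominator exponent\<close>

text \<open>The building block of the synthesis; each one costs a single CS gate.\<close>

definition syllable :: "op4 \<Rightarrow> op4" where
  "syllable C = C ** CS_gate ** adjoint_mat C"

lemma unitary_syllable: "C \<in> clifford \<Longrightarrow> unitary (syllable C)"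
  unfolding syllable_def by (intro unitary_mult unitary_adjoint_mat clifford_unitary unitary_CS)

lemma syllable_in_clifford_CS: "C \<in> clifford \<Longrightarrow> syllable C \<in> clifford_CS"
  unfolding syllable_def
  by (intro clifford_CS_mult clifford_CS_adjoint clifford_subset CS_in_clifford_CS)

lemma integral_syllable:
  assumes "C \<in> clifford"
  shows "so6_integral 1 (syllable C)"
proof -
  have "so6_integral (0 + 1 + 0) (C ** CS_gate ** adjoint_mat C)"
    using assms
    by (intro integral_mult integral_CS integral_clifford clifford_adjoint unitary_mult clifford_unitary unitary_CS)
  then show ?thesis
    by (simp add: syllable_def)
qed

lemma adjoint6_signed_perm_mult:
  assumes "inj p" "\<And>j. cnj (d j) = d j"
  shows "(adjoint6 (signed_perm p d) ** V) $ i $ j = d i * V $ p i $ j"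
proof -
  have "(adjoint6 (signed_perm p d) ** V) $ i $ j = (\<Sum>k\<in>UNIV. if k = p i then d i * V $ k $ j else 0)"
    unfolding matrix_matrix_mult_def adjoint6_def signed_perm_def vec_lambda_beta
    by (intro sum.cong) (auto simp: assms(2))
  then show ?thesis
    by simp
qed

lemma level_reduction:
  assumes U: "U \<in> clifford_CS" and k: "level U = Suc l"
  obtains C where "C \<in> clifford" "so6_integral l (adjoint_mat (syllable C) ** U)"
proof -
  have uU: "unitary U"
    using U by (rule clifford_CS_unitary)
  then obtain V where V: "V \<in> so6_images U"
    using so6_images_nonempty by blast
  have iat: "integral_at (Suc l) V"
    using integral_level[OF U] integral_iff[OF V] k by simp
  obtain N :: "6 \<Rightarrow> 6 \<Rightarrow> int" where N: "\<And>i j. complex_of_real (sqrt 2 ^ Suc l) * V $ i $ j = of_int (N i j)"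
    "\<And>a b. (\<Sum>j\<in>UNIV. N a j * N b j) = (if a = b then 2 ^ Suc l else 0)"
    "\<And>a b. (\<Sum>i\<in>UNIV. N i a * N i b) = (if a = b then 2 ^ Suc l else 0)"
    by (rule integer_matrix[OF V uU iat]) (rule that)
  have "even (card {b. {j. odd (N b j)} = X})" for X
    by (rule even_card_equal_rows[OF N(2,3)]) simp
  then obtain p :: "6 \<Rightarrow> 6" where p: "inj p" "\<And>i. {j. odd (N (p (CZ_perm i)) j)} = {j. odd (N (p i) j)}"
    using matching_exists[of "\<lambda>b. {j. odd (N b j)}"] by metis
  have parity: "odd (N (p (CZ_perm i)) j) \<longleftrightarrow> odd (N (p i) j)" for i j
    using p(2)[of i] by blast
  \<comment> \<open>The matching is realised with whatever signs come out: signs are odd and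
    preserve parities.\<close>
  obtain q d where q: "realizable (signed_perm q d)" "inj q" "\<And>j. d j \<in> {1, -1}" "\<And>j. q j = p j"
    by (rule realizable_signed_perm[OF p(1), of "\<lambda>_. 1"]) (simp, rule that)
  then have "q = p"
    by blast
  with q(1) obtain C where C: "C \<in> clifford" "signed_perm p d \<in> so6_images C"
    unfolding realizable_def by blast
  define P where "P = signed_perm p d"
  define X where "X = cscale (1 / complex_of_real (sqrt 2)) (mat 1 + signed_perm CZ_perm CZ_sign)"
  have "P ** X ** adjoint6 P \<in> so6_images (syllable C)"
    unfolding syllable_def P_def X_def
    by (intro so6_images_mult so6_images_adjoint so6_images_CS C)
  then have "adjoint6 (P ** X ** adjoint6 P) ** V \<in> so6_images (adjoint_mat (syllable C) ** U)"
    by (intro so6_images_mult so6_images_adjoint V)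
  moreover have "adjoint6 (P ** X ** adjoint6 P) = P ** (adjoint6 X ** adjoint6 P)"
    by (simp add: adjoint6_def matrix_matrix_mult_def vec_eq_iff mult.commute sum_distrib_left sum_distrib_right)
  ultimately have img: "P ** (adjoint6 X ** (adjoint6 P ** V)) \<in> so6_images (adjoint_mat (syllable C) ** U)"
    by (simp add: matrix_mul_assoc)
  have d: "cnj (d j) = d j" "\<exists>e. odd e \<and> d j = of_int e" for j
  proof -
    have "d j = of_int 1 \<or> d j = of_int (-1)"
      using q(3)[of j] by auto
    moreover have "odd (1 :: int)" "odd (-1 :: int)"
      by simp_all
    ultimately show "\<exists>e. odd e \<and> d j = of_int e"
      by blast
    then show "cnj (d j) = d j"
      by auto
  qed
  have "integral_at l (adjoint6 X ** (adjoint6 P ** V))"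
    unfolding integral_at_def
  proof (intro allI)
    fix i j
    define Y where "Y = adjoint6 P ** V"
    define s where "s = complex_of_real (sqrt 2)"
    have s: "s * s = 2" "s \<noteq> 0"
      by (simp_all add: s_def csqrt2)
    have Y: "s ^ Suc l * Y $ i $ j = d i * of_int (N (p i) j)" for i
      using N(1)[of "p i" j] unfolding Y_def P_def
      by (simp only: adjoint6_signed_perm_mult[OF p(1) d(1)] s_def of_real_power mult.left_commute)
    obtain e1 e2 where e: "odd e1" "d i = of_int e1" "odd e2" "d (CZ_perm i) = of_int e2"
      using d(2) by metis
    define e3 :: int where "e3 = (if i = 2 \<or> i = 5 \<or> i = 6 then -1 else 1)"
    have e3: "odd e3" "CZ_sign i = of_int e3"
      by (simp_all add: e3_def)
    \<comment> \<open>Multiplying by the inverse of \<open>X\<close> adds or subtracts matched rows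
      and divides by sqrt 2. Matched rows have equal parity, so at scale sqrt 2 ^ (l + 2) the result
      is even, and cancelling the 2 leaves an integer at scale sqrt 2 ^ l.\<close>
    have "even (e1 * N (p i) j + e3 * (e2 * N (p (CZ_perm i)) j))"
      using e e3(1) parity[of i j] by simp
    then obtain z where z: "e1 * N (p i) j + e3 * (e2 * N (p (CZ_perm i)) j) = 2 * z"
      by (elim evenE)
    have "(adjoint6 X ** Y) $ i $ j =
        (\<Sum>k\<in>UNIV. (if k = i then Y $ k $ j / s else 0) + (if k = CZ_perm i then CZ_sign i * Y $ k $ j / s else 0))"
      unfolding matrix_matrix_mult_def adjoint6_def X_def cscale_def mat_def signed_perm_def vec_lambda_beta
        vector_add_component s_def[symmetric]
      by (intro sum.cong) (simp_all add: s_def)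
    then have "(adjoint6 X ** Y) $ i $ j = (Y $ i $ j + CZ_sign i * Y $ CZ_perm i $ j) / s"
      by (simp only: sum.distrib sum.delta' finite UNIV_I if_True add_divide_distrib sum.delta)
    then have sZ: "s * (adjoint6 X ** Y) $ i $ j = Y $ i $ j + CZ_sign i * Y $ CZ_perm i $ j"
      using s(2) by simp
    have "2 * (s ^ l * (adjoint6 X ** Y) $ i $ j) = s ^ Suc l * (s * (adjoint6 X ** Y) $ i $ j)"
      unfolding s(1)[symmetric] by (simp only: power_Suc mult_ac)
    also have "\<dots> = s ^ Suc l * Y $ i $ j + CZ_sign i * (s ^ Suc l * Y $ CZ_perm i $ j)"
      unfolding sZ by (simp only: distrib_left mult.left_commute)
    also have "\<dots> = of_int (e1 * N (p i) j + e3 * (e2 * N (p (CZ_perm i)) j))"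
      unfolding Y e e3(2) by simp
    also have "\<dots> = 2 * of_int z"
      unfolding z by simp
    finally have "s ^ l * (adjoint6 X ** Y) $ i $ j = of_int z"
      by simp
    then show "complex_of_real (sqrt 2 ^ l) * (adjoint6 X ** (adjoint6 P ** V)) $ i $ j \<in> \<int>"
      by (simp add: s_def Y_def)
  qed
  then have "integral_at (0 + l) (P ** (adjoint6 X ** (adjoint6 P ** V)))"
    unfolding P_def by (intro integral_at_mult integral_at_signed_perm q(3))
  then show ?thesis
    using that[OF C(1)] integral_iff[OF img] by simp
qed

section \<open>Gaussian entries and phases\<close>

definition gauss :: "complex set" where
  "gauss = {z. Re z \<in> \<int> \<and> Im z \<in> \<int>}"

lemma gauss_closed:
  "z \<in> gauss \<Longrightarrow> w \<in> gauss \<Longrightarrow> z + w \<in> gauss"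
  "z \<in> gauss \<Longrightarrow> w \<in> gauss \<Longrightarrow> z * w \<in> gauss"
  "z \<in> gauss \<Longrightarrow> cnj z \<in> gauss"
  by (auto simp: gauss_def)

lemma gauss_const [simp]: "0 \<in> gauss" "1 \<in> gauss" "-1 \<in> gauss" "\<i> \<in> gauss"
  by (auto simp: gauss_def)

lemma gauss_sum: "(\<And>x. x \<in> A \<Longrightarrow> f x \<in> gauss) \<Longrightarrow> sum f A \<in> gauss"
  by (induction A rule: infinite_finite_induct) (auto intro: gauss_closed)

definition gaussian_at :: "nat \<Rightarrow> op4 \<Rightarrow> bool" where
  "gaussian_at m U \<longleftrightarrow> (\<forall>i j. complex_of_real (sqrt 2 ^ m) * U $ i $ j \<in> gauss)"

lemma gaussian_at_mult:
  assumes "gaussian_at m A" "gaussian_at n B"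
  shows "gaussian_at (m + n) (A ** B)"
proof -
  have "complex_of_real (sqrt 2 ^ (m + n)) * (A ** B) $ i $ j =
    (\<Sum>k\<in>UNIV. (complex_of_real (sqrt 2 ^ m) * A $ i $ k) * (complex_of_real (sqrt 2 ^ n) * B $ k $ j))" for i j
    by (simp add: matrix_matrix_mult_def sum_distrib_left power_add mult_ac)
  then show ?thesis
    using assms unfolding gaussian_at_def by (simp only: gauss_sum gauss_closed simp_thms)
qed

lemma gaussian_at_adjoint:
  assumes "gaussian_at m A"
  shows "gaussian_at m (adjoint_mat A)"
proof -
  have "complex_of_real (sqrt 2 ^ m) * adjoint_mat A $ i $ j = cnj (complex_of_real (sqrt 2 ^ m) * A $ j $ i)" for i j
    by (simp add: adjoint_mat_def)
  then show ?thesis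
    using assms gauss_closed(3) unfolding gaussian_at_def by metis
qed

lemma gaussian_at_diag4:
  assumes "a \<in> gauss" "b \<in> gauss" "c \<in> gauss" "d \<in> gauss"
  shows "gaussian_at 0 (diag4 a b c d)"
  using assms by (simp add: gaussian_at_def forall_4 diag4_nth)

lemma gaussian_at_H: "gaussian_at 1 (kron H_gate (mat 1))" "gaussian_at 1 (kron (mat 1) H_gate)"
  by (simp_all add: gaussian_at_def forall_4 kron_H_left kron_H_right cscale_def)

text \<open>This makes the least exponent in \<open>gaussian_lde\<close> meaningful and restricts
  the phases that scalar operators can have.\<close>

lemma gaussian_exists:
  assumes "U \<in> clifford_CS"
  shows "\<exists>m. gaussian_at m U"
proof -
  have gates: "\<exists>m. gaussian_at m g" if "g \<in> clifford_gates" for g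
    using that gaussian_at_H gaussian_at_diag4[of 1 1 \<i> \<i>] gaussian_at_diag4[of 1 \<i> 1 \<i>]
      gaussian_at_diag4[of 1 1 1 "-1"]
    by (auto simp: kron_S_left kron_S_right CZ_gate_def)
  have id: "gaussian_at 0 (mat 1)"
    by (simp add: gaussian_at_def mat_def)
  have clifford: "\<exists>m. gaussian_at m C" if "C \<in> clifford" for C
    using that unfolding clifford_def
  proof (induction rule: generate_unitary_induct)
    case (unitary s)
    then show ?case by (rule unitary_clifford_gates)
  next
    case one
    show ?case using id by (rule exI)
  next
    case (gen s)
    then show ?case by (rule gates)
  next
    case (adj s)
    then show ?case using gates gaussian_at_adjoint by metis
  next
    case (mult a b)
    then show ?case using gaussian_at_mult by metis
  qed
  have "gaussian_at 0 CS_gate"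
    unfolding CS_gate_def by (rule gaussian_at_diag4) simp_all
  with clifford have CS_gates: "\<exists>m. gaussian_at m g" if "g \<in> clifford \<union> {CS_gate}" for g
    using that by blast
  from assms show ?thesis
    unfolding clifford_CS_def
  proof (induction rule: generate_unitary_induct)
    case (unitary s)
    then show ?case by (rule clifford_CS_gates_unitary)
  next
    case one
    show ?case using id by (rule exI)
  next
    case (gen s)
    then show ?case by (rule CS_gates)
  next
    case (adj s)
    then show ?case using CS_gates gaussian_at_adjoint by metis
  next
    case (mult a b)
    then show ?case using gaussian_at_mult by metis
  qed
qed

section \<open>Scalar operators and eighth roots of unity\<close>

definition omega :: complex where
  "omega = (1 + \<i>) / complex_of_real (sqrt 2)"

lemma omega_square: "omega\<^sup>2 = \<i>"
proof -
  have "(1 + \<i>)\<^sup>2 = 2 * \<i>"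
    by (simp add: power2_eq_square algebra_simps)
  then show ?thesis
    by (simp add: omega_def power_divide power2_eq_square csqrt2)
qed

lemma omega_power_8: "omega ^ 8 = 1"
proof -
  have "omega ^ 8 = (omega\<^sup>2) ^ 4"
    by (simp flip: power_mult)
  then show ?thesis
    by (simp add: omega_square)
qed

lemma cmod_omega: "cmod omega = 1"
  by (simp add: omega_def norm_divide cmod_def power_divide)

text \<open>The cube of S H is the scalar \<open>omega\<close>. \<open>M\<close> is sqrt 2 times
  that product and has Gaussian entries, so its cube is computed without square roots.\<close>

lemma omega_clifford: "cscale omega (mat 1) \<in> clifford"
proof -
  define M :: op4 where "M = diag4 1 1 \<i> \<i> **
    vector [vector [1, 0, 1, 0], vector [0, 1, 0, 1], vector [1, 0, -1, 0], vector [0, 1, 0, -1]]"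
  define s where "s = complex_of_real (sqrt 2)"
  have M: "M $ 1 $ 1 = 1" "M $ 1 $ 2 = 0" "M $ 1 $ 3 = 1" "M $ 1 $ 4 = 0"
    "M $ 2 $ 1 = 0" "M $ 2 $ 2 = 1" "M $ 2 $ 3 = 0" "M $ 2 $ 4 = 1"
    "M $ 3 $ 1 = \<i>" "M $ 3 $ 2 = 0" "M $ 3 $ 3 = - \<i>" "M $ 3 $ 4 = 0"
    "M $ 4 $ 1 = 0" "M $ 4 $ 2 = \<i>" "M $ 4 $ 3 = 0" "M $ 4 $ 4 = - \<i>"
    by (simp_all add: M_def matrix_matrix_mult_def sum_4 diag4_nth)
  have MM: "(M ** M) $ p $ q = (\<Sum>r\<in>UNIV. M $ p $ r * M $ r $ q)" for p q
    by (simp add: matrix_matrix_mult_def)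
  have "M ** M ** M = cscale (2 * (1 + \<i>)) (mat 1)"
    unfolding vec_eq_iff forall_4 matrix_matrix_mult_def[of "M ** M" M] vec_lambda_beta sum_4 MM M cscale_def mat_def
    by (simp add: algebra_simps)
  moreover have g: "kron S_gate (mat 1) ** kron H_gate (mat 1) = cscale (1 / s) M"
    unfolding kron_S_left kron_H_left M_def s_def by (rule cscale_mult_right)
  moreover have "1 / s * (1 / s) * (1 / s) * (2 * (1 + \<i>)) = omega"
  proof -
    have "1 / s * (1 / s) = 1 / 2"
      by (simp add: s_def csqrt2)
    then show ?thesis
      unfolding omega_def s_def[symmetric] by (simp only:) (simp add: field_simps)
  qed
  ultimately have "cscale (1 / s) M ** cscale (1 / s) M ** cscale (1 / s) M = cscale omega (mat 1)"
    by (simp add: mult.assoc)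
  moreover have "cscale (1 / s) M \<in> clifford"
    unfolding g[symmetric] by (intro clifford_mult clifford_gate) simp_all
  ultimately show ?thesis
    by (metis clifford_mult)
qed

text \<open>A Gaussian integer whose norm is a power of two is a unit times a power of \<open>1 + \<i>\<close>.\<close>

lemma phase_clifford:
  assumes "cmod a = 1" "complex_of_real (sqrt 2 ^ m) * a \<in> gauss"
  shows "cscale a (mat 1) \<in> clifford \<and> a ^ 8 = 1"
  using assms
proof (induction m arbitrary: a)
  case 0
  then obtain x y :: int where xy: "Re a = of_int x" "Im a = of_int y"
    by (auto simp: gauss_def elim!: Ints_cases)
  then have "(of_int (x\<^sup>2 + y\<^sup>2) :: real) = of_int 1"
    using 0(1) cmod_power2[of a] by simp
  then have "x\<^sup>2 + y\<^sup>2 = 1"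
    unfolding of_int_eq_iff .
  moreover from this have "\<bar>x\<bar> \<le> 1" "\<bar>y\<bar> \<le> 1"
    using power_le_one_iff[of "\<bar>x\<bar>" 2] power_le_one_iff[of "\<bar>y\<bar>" 2] zero_le_power2[of x] zero_le_power2[of y]
    by (simp_all add: power2_abs)
  moreover from this have "x = -1 \<or> x = 0 \<or> x = 1" "y = -1 \<or> y = 0 \<or> y = 1"
    by linarith+
  ultimately have "(x, y) \<in> {(1, 0), (-1, 0), (0, 1), (0, -1)}"
    by auto
  then have "a \<in> {1, -1, \<i>, -\<i>}"
    using xy by (auto simp: complex_eq_iff)
  moreover have "omega ^ (2 * 2) = -1" "omega ^ (2 * 3) = -\<i>"
    unfolding power_mult omega_square by (simp_all add: power3_eq_cube)
  moreover have "omega ^ 0 = 1"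
    by simp
  ultimately obtain n where n: "a = omega ^ n"
    using omega_square by (metis (no_types) empty_iff insert_iff)
  have "cscale (omega ^ n) (mat 1) \<in> clifford"
  proof (induction n)
    case (Suc n)
    have "cscale (omega ^ Suc n) (mat 1 :: op4) = cscale omega (mat 1) ** cscale (omega ^ n) (mat 1)"
      by (simp add: mult.commute)
    then show ?case
      using clifford_mult[OF omega_clifford Suc] by (simp only:)
  qed (simp add: clifford_one)
  moreover have "(omega ^ n) ^ 8 = 1"
    using omega_power_8 by (metis mult.commute power_mult power_one)
  ultimately show ?case
    by (simp add: n)
next
  case (Suc m)
  \<comment> \<open>Since omega * sqrt 2 = 1 + i, removing one \<open>omega\<close> and one sqrt 2
    divides \<open>z\<close> by 1 + i. The quotient is u + i v, integral because the even norm makes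
    x + y even.\<close>
  define b where "b = a / omega"
  have "omega \<noteq> 0"
    using cmod_omega by auto
  then have ab: "a = omega * b" "cmod b = 1"
    using Suc.prems(1) cmod_omega by (simp_all add: b_def norm_divide)
  define z where "z = complex_of_real (sqrt 2 ^ Suc m) * a"
  obtain x y :: int where xy: "Re z = of_int x" "Im z = of_int y"
    using Suc.prems(2) by (auto simp: gauss_def z_def elim!: Ints_cases)
  have "of_int (x\<^sup>2 + y\<^sup>2) = (of_int (2 ^ Suc m) :: real)"
  proof -
    have "(cmod z)\<^sup>2 = (sqrt 2 ^ Suc m)\<^sup>2"
      using Suc.prems(1) by (simp add: z_def norm_mult norm_power)
    also have "\<dots> = 2 ^ Suc m"
      by (metis abs_numeral power2_eq_square power_mult_distrib real_sqrt_mult_self)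
    finally show ?thesis
      using cmod_power2[of z] xy by simp
  qed
  then have "x\<^sup>2 + y\<^sup>2 = 2 ^ Suc m"
    unfolding of_int_eq_iff .
  then have "even (x\<^sup>2 + y\<^sup>2)"
    by simp
  then have "even (x + y)" "even (y - x)"
    by simp_all
  then obtain u v where uv: "x + y = 2 * u" "y - x = 2 * v"
    by (metis evenE)
  have "2 * (complex_of_real (sqrt 2 ^ m) * b) = z * (1 - \<i>)"
  proof -
    have "omega * complex_of_real (sqrt 2) = 1 + \<i>"
      by (simp add: omega_def)
    then have "z = (1 + \<i>) * (complex_of_real (sqrt 2 ^ m) * b)"
      by (simp add: z_def ab(1) mult_ac)
    then show ?thesis
      by (simp add: algebra_simps)
  qed
  also have "\<dots> = 2 * Complex (of_int u) (of_int v)"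
  proof -
    have "of_int x + of_int y = (2 * of_int u :: real)" "of_int y - of_int x = (2 * of_int v :: real)"
      using uv by (metis of_int_add of_int_diff of_int_mult of_int_numeral)+
    then show ?thesis
      using xy by (simp add: complex_eq_iff)
  qed
  finally have "complex_of_real (sqrt 2 ^ m) * b \<in> gauss"
    by (simp add: gauss_def)
  then have IH: "cscale b (mat 1) \<in> clifford" "b ^ 8 = 1"
    using Suc.IH ab(2) by blast+
  have "cscale a (mat 1 :: op4) = cscale omega (mat 1) ** cscale b (mat 1)"
    by (simp add: ab(1) mult.commute)
  then show ?case
    using clifford_mult[OF omega_clifford IH(1)] IH(2) omega_power_8
    by (simp only: ab(1) power_mult_distrib mult_1 simp_thms)
qed

section \<open>Operators of level zero\<close>

text \<open>The kernel lemma yields a scalar, and its Gaussian entry forces an eighth root of unity.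
  The hypothesis speaks of five columns to fit the free sign in
  \<open>realizable_signed_perm\<close>.\<close>

lemma scalar_of_kernel:
  assumes W: "W \<in> clifford_CS" and V: "V \<in> so6_images W"
    and V1: "\<And>i j. j \<noteq> 1 \<Longrightarrow> V $ i $ j = (if i = j then 1 else 0)"
  obtains a where "W = cscale a (mat 1)" "cscale a (mat 1) \<in> clifford" "a ^ 8 = 1"
proof -
  have uW: "unitary W"
    using W by (rule clifford_CS_unitary)
  obtain l where l: "V = so6 (cscale l W)" "cmod l = 1"
    using V by (auto simp: so6_images_def)
  obtain c where c: "cscale l W = cscale c (mat 1)"
    by (rule so6_kernel[of "cscale l W"]) (use unitary_cscale[OF l(2) uW] V1 in \<open>simp_all add: l(1)[symmetric]\<close>)
  define a where "a = cnj l * c"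
  have "W = cscale (cnj l * l) W"
    using cnj_mult_self_eq_1[OF l(2)] by simp
  also have "\<dots> = cscale a (mat 1)"
    using arg_cong[OF c, of "cscale (cnj l)"] by (simp add: a_def)
  finally have a: "W = cscale a (mat 1)" .
  have "W ** adjoint_mat W = cscale (a * cnj a) (mat 1)"
    unfolding a by (simp add: adjoint_mat_cscale mult.commute)
  then have "cscale (a * cnj a) (mat 1 :: op4) $ 1 $ 1 = (mat 1 :: op4) $ 1 $ 1"
    using uW by (simp add: unitary_def)
  then have "a * cnj a = 1"
    by (simp add: cscale_def mat_def)
  then have "cmod a = 1"
    by (metis abs_norm_cancel abs_square_eq_1 complex_norm_square of_real_eq_1_iff)
  obtain m where "gaussian_at m W"
    using gaussian_exists[OF W] by blast
  then have "complex_of_real (sqrt 2 ^ m) * W $ 1 $ 1 \<in> gauss"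
    unfolding gaussian_at_def by blast
  moreover have "W $ 1 $ 1 = a"
    unfolding a by (simp add: cscale_def mat_def)
  ultimately show ?thesis
    using phase_clifford[OF \<open>cmod a = 1\<close>, of m] that[OF a] by simp
qed

text \<open>An integer column of norm one has a single nonzero entry, which is a sign; orthogonality
  puts the entries of different columns into different rows.\<close>

lemma integral_imp_signed_perm:
  assumes "V \<in> so6_images U" "unitary U" "integral_at 0 V"
  obtains p d where "V = signed_perm p d" "inj p" "\<And>j. d j \<in> {1, -1}"
proof -
  obtain N :: "6 \<Rightarrow> 6 \<Rightarrow> int" where N: "\<And>i j. complex_of_real (sqrt 2 ^ 0) * V $ i $ j = of_int (N i j)"
    "\<And>a b. (\<Sum>j\<in>UNIV. N a j * N b j) = (if a = b then 2 ^ 0 else 0)"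
    "\<And>a b. (\<Sum>i\<in>UNIV. N i a * N i b) = (if a = b then 2 ^ 0 else 0)"
    by (rule integer_matrix[OF assms]) (rule that)
  have "\<exists>i. N i j \<noteq> 0" for j
  proof (rule ccontr)
    assume "\<nexists>i. N i j \<noteq> 0"
    then have "(\<Sum>i\<in>UNIV. N i j * N i j) = 0"
      by simp
    then show False
      using N(3)[of j j] by simp
  qed
  then obtain p where p: "\<And>j. N (p j) j \<noteq> 0"
    by metis
  have pos: "0 < N (p j) j * N (p j) j" for j
    using p[of j] by (metis not_real_square_gt_zero zero_less_mult_iff linorder_neqE)
  have split: "N (p j) j * N (p j) j + (\<Sum>i\<in>UNIV - {p j}. N i j * N i j) = 1" for j
    using N(3)[of j j] sum.remove[of UNIV "p j" "\<lambda>i. N i j * N i j"] by simp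
  have nonneg: "0 \<le> (\<Sum>i\<in>UNIV - {p j}. N i j * N i j)" for j
    by (rule sum_nonneg) simp
  have one: "N (p j) j * N (p j) j = 1" and rest: "(\<Sum>i\<in>UNIV - {p j}. N i j * N i j) = 0" for j
    using split[of j] pos[of j] nonneg[of j] by linarith+
  have zero: "N i j = 0" if "i \<noteq> p j" for i j
    using rest[of j] that sum_nonneg_eq_0_iff[of "UNIV - {p j}" "\<lambda>i. N i j * N i j"] by simp
  have "V $ i $ j = of_int (N i j)" for i j
    using N(1)[of i j] by simp
  then have "V = signed_perm p (\<lambda>j. of_int (N (p j) j))"
    unfolding vec_eq_iff signed_perm_def using zero by simp
  moreover have "inj p"
  proof (rule injI, rule ccontr)
    fix a b assume ab: "p a = p b" "a \<noteq> b"
    have "(\<Sum>i\<in>UNIV. N i a * N i b) = N (p a) a * N (p a) b + (\<Sum>i\<in>UNIV - {p a}. N i a * N i b)"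
      by (rule sum.remove) simp_all
    also have "(\<Sum>i\<in>UNIV - {p a}. N i a * N i b) = 0"
      using zero by (intro sum.neutral) simp
    finally show False
      using N(3)[of a b] ab p[of a] p[of b] by simp
  qed
  moreover have "(of_int (N (p j) j) :: complex) \<in> {1, -1}" for j
  proof -
    have "N (p j) j = 1 \<or> N (p j) j = -1"
      using one[of j] by (metis zmult_eq_1_iff)
    then show ?thesis
      by auto
  qed
  ultimately show ?thesis
    by (rule that)
qed

lemma level_0_imp_clifford:
  assumes "U \<in> clifford_CS" "level U = 0"
  shows "U \<in> clifford"
proof -
  have uU: "unitary U"
    using assms(1) by (rule clifford_CS_unitary)
  then obtain V where V: "V \<in> so6_images U"
    using so6_images_nonempty by blast
  have "integral_at 0 V"
    using integral_level[OF assms(1)] integral_iff[OF V] assms(2) by simp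
  from integral_imp_signed_perm[OF V uU this] obtain p e where
    pe: "V = signed_perm p e" "inj p" "\<And>j. e j \<in> {1, -1}"
    by metis
  \<comment> \<open>The realised matrix may differ from \<open>V\<close> in the sign of column 1,
    which is the column that \<open>scalar_of_kernel\<close> leaves open.\<close>
  obtain q d where q: "realizable (signed_perm q d)" "inj q" "\<And>j. d j \<in> {1, -1}" "\<And>j. q j = p j"
    "\<And>j. j \<noteq> 1 \<Longrightarrow> d j = e j"
    by (rule realizable_signed_perm[OF pe(2,3)]) (rule that)
  have "q = p"
    using q(4) by blast
  with q(1) obtain C where C: "C \<in> clifford" "signed_perm p d \<in> so6_images C"
    unfolding realizable_def by blast
  have d: "cnj (d j) = d j" "d j * d j = 1" for j
    using q(3)[of j] by auto
  have "adjoint6 (signed_perm p d) ** V \<in> so6_images (adjoint_mat C ** U)"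
    by (intro so6_images_mult so6_images_adjoint C V)
  moreover have "(adjoint6 (signed_perm p d) ** V) $ i $ j = (if i = j then 1 else 0)" if "j \<noteq> 1" for i j
  proof -
    have "(adjoint6 (signed_perm p d) ** V) $ i $ j = d i * (if p i = p j then e j else 0)"
      unfolding adjoint6_signed_perm_mult[OF pe(2) d(1)] pe(1) by (simp add: signed_perm_def)
    then show ?thesis
      using q(5)[OF that] d(2)[of j] inj_eq[OF pe(2)] by auto
  qed
  moreover have "adjoint_mat C ** U \<in> clifford_CS"
    by (rule clifford_CS_mult[OF clifford_subset[OF clifford_adjoint[OF C(1)]] assms(1)])
  ultimately obtain a where a: "adjoint_mat C ** U = cscale a (mat 1)" "cscale a (mat 1) \<in> clifford"
    using scalar_of_kernel by metis
  have "U = (C ** adjoint_mat C) ** U"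
    using clifford_unitary[OF C(1)] by (simp add: unitary_def)
  also have "\<dots> = C ** cscale a (mat 1)"
    using a(1) by (simp only: matrix_mul_assoc[symmetric])
  finally show ?thesis
    using clifford_mult[OF C(1) a(2)] by simp
qed

text \<open>Only finitely many signed permutations can be images, and Clifford operators with a
  common image differ by an eighth root of unity.\<close>

lemma finite_clifford: "finite clifford"
proof -
  define F where "F = (\<lambda>(p, d). signed_perm p d) ` (UNIV \<times> (UNIV \<rightarrow>\<^sub>E {1, -1}))"
  have "finite F"
    unfolding F_def by (intro finite_imageI finite_cartesian_product finite_PiE) simp_all
  have "finite {C \<in> clifford. V \<in> so6_images C}" for V
  proof (cases "\<exists>C. C \<in> clifford \<and> V \<in> so6_images C")
    case True
    then obtain C where C: "C \<in> clifford" "V \<in> so6_images C"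
      by blast
    have "{C \<in> clifford. V \<in> so6_images C} \<subseteq> (\<lambda>a. cscale a C) ` {a. a ^ 8 = 1}"
    proof
      fix D assume "D \<in> {C \<in> clifford. V \<in> so6_images C}"
      then have D: "D \<in> clifford" "V \<in> so6_images D"
        by simp_all
      have "adjoint6 V ** V \<in> so6_images (adjoint_mat C ** D)"
        by (intro so6_images_mult so6_images_adjoint C D)
      then have "mat 1 \<in> so6_images (adjoint_mat C ** D)"
        using so6_images_unitary(2)[OF C(2) clifford_unitary[OF C(1)]] by simp
      moreover have "adjoint_mat C ** D \<in> clifford_CS"
        using C(1) D(1) by (intro clifford_CS_mult clifford_subset clifford_adjoint)
      ultimately obtain a where a: "adjoint_mat C ** D = cscale a (mat 1)" "a ^ 8 = 1"
        using scalar_of_kernel[of "adjoint_mat C ** D" "mat 1"] by (auto simp: mat_def)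
      have "D = (C ** adjoint_mat C) ** D"
        using clifford_unitary[OF C(1)] by (simp add: unitary_def)
      also have "\<dots> = cscale a C"
        using a(1) by (simp add: matrix_mul_assoc[symmetric])
      finally show "D \<in> (\<lambda>a. cscale a C) ` {a. a ^ 8 = 1}"
        using a(2) by blast
    qed
    moreover have "finite {a :: complex. a ^ 8 = 1}"
      by (rule finite_roots_unity) simp
    ultimately show ?thesis
      by (meson finite_imageI finite_subset)
  next
    case False
    then have empty: "{C \<in> clifford. V \<in> so6_images C} = {}"
      by blast
    show ?thesis
      unfolding empty by simp
  qed
  moreover have "clifford \<subseteq> (\<Union>V\<in>F. {C \<in> clifford. V \<in> so6_images C})"
  proof
    fix C assume C: "C \<in> clifford"
    then obtain V where V: "V \<in> so6_images C"
      using so6_images_nonempty clifford_unitary by blast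
    have "integral_at 0 V"
      using integral_clifford[OF C] integral_iff[OF V] by simp
    from integral_imp_signed_perm[OF V clifford_unitary[OF C] this]
    obtain p d where pd: "V = signed_perm p d" "inj p" "\<And>j. d j \<in> {1, -1}"
      by metis
    have "d \<in> UNIV \<rightarrow>\<^sub>E {1, -1}"
      using pd(3) by (simp add: PiE_UNIV_domain)
    then have "V \<in> F"
      unfolding F_def pd(1) by (intro image_eqI[of _ _ "(p, d)"]) simp_all
    then show "C \<in> (\<Union>V\<in>F. {C \<in> clifford. V \<in> so6_images C})"
      using C V by blast
  qed
  ultimately show ?thesis
    using \<open>finite F\<close> by (meson finite_UN_I finite_subset)
qed

section \<open>Expressible functions and predicates\<close>

text \<open>The expression is chosen before the store, so its cost is a constant. Values are real so
  that the closure rules apply directly to real and imaginary parts and to squared moduli.\<close>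

definition rexpr :: "(store \<Rightarrow> real) \<Rightarrow> bool" where
  "rexpr f \<longleftrightarrow> (\<exists>a. \<forall>s. f s = of_int (aval a s))"

definition cexpr :: "(store \<Rightarrow> complex) \<Rightarrow> bool" where
  "cexpr f \<longleftrightarrow> rexpr (\<lambda>s. Re (f s)) \<and> rexpr (\<lambda>s. Im (f s))"

definition bexpr :: "(store \<Rightarrow> bool) \<Rightarrow> bool" where
  "bexpr P \<longleftrightarrow> (\<exists>b. \<forall>s. bval b s \<longleftrightarrow> P s)"

lemma rexpr_const: "c \<in> \<int> \<Longrightarrow> rexpr (\<lambda>_. c)"
proof -
  assume "c \<in> \<int>"
  then obtain n where "c = of_int n"
    by (auto elim: Ints_cases)
  then show ?thesis
    unfolding rexpr_def by (intro exI[of _ "Const n"]) simp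
qed

lemma rexpr_var: "rexpr (\<lambda>s. of_int (s x))"
  unfolding rexpr_def by (intro exI[of _ "Var x"]) simp

lemma rexpr_add:
  assumes "rexpr f" "rexpr g"
  shows "rexpr (\<lambda>s. f s + g s)"
proof -
  obtain a b where "\<forall>s. f s = of_int (aval a s)" "\<forall>s. g s = of_int (aval b s)"
    using assms unfolding rexpr_def by blast
  then show ?thesis
    unfolding rexpr_def by (intro exI[of _ "Add a b"]) simp
qed

lemma rexpr_diff:
  assumes "rexpr f" "rexpr g"
  shows "rexpr (\<lambda>s. f s - g s)"
proof -
  obtain a b where "\<forall>s. f s = of_int (aval a s)" "\<forall>s. g s = of_int (aval b s)"
    using assms unfolding rexpr_def by blast
  then show ?thesis
    unfolding rexpr_def by (intro exI[of _ "Sub a b"]) simp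
qed

lemma rexpr_mult:
  assumes "rexpr f" "rexpr g"
  shows "rexpr (\<lambda>s. f s * g s)"
proof -
  obtain a b where "\<forall>s. f s = of_int (aval a s)" "\<forall>s. g s = of_int (aval b s)"
    using assms unfolding rexpr_def by blast
  then show ?thesis
    unfolding rexpr_def by (intro exI[of _ "Mul a b"]) simp
qed

lemma rexpr_floor: "rexpr f \<Longrightarrow> \<exists>a. \<forall>s. aval a s = \<lfloor>f s\<rfloor>"
  unfolding rexpr_def by auto

lemma cexpr_const: "c \<in> gauss \<Longrightarrow> cexpr (\<lambda>_. c)"
  by (simp add: cexpr_def gauss_def rexpr_const)

lemma cexpr_add: "cexpr f \<Longrightarrow> cexpr g \<Longrightarrow> cexpr (\<lambda>s. f s + g s)"
  by (simp add: cexpr_def rexpr_add)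

lemma cexpr_mult: "cexpr f \<Longrightarrow> cexpr g \<Longrightarrow> cexpr (\<lambda>s. f s * g s)"
  by (simp add: cexpr_def rexpr_add rexpr_diff rexpr_mult)

lemma cexpr_sum: "(\<And>x. x \<in> A \<Longrightarrow> cexpr (f x)) \<Longrightarrow> cexpr (\<lambda>s. \<Sum>x\<in>A. f x s)"
  by (induction A rule: infinite_finite_induct) (auto intro: cexpr_add cexpr_const)

lemma rexpr_sum: "(\<And>x. x \<in> A \<Longrightarrow> rexpr (f x)) \<Longrightarrow> rexpr (\<lambda>s. \<Sum>x\<in>A. f x s)"
  by (induction A rule: infinite_finite_induct) (auto intro: rexpr_add rexpr_const)

lemma rexpr_cmod_square: "cexpr f \<Longrightarrow> rexpr (\<lambda>s. (cmod (f s))\<^sup>2)"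
  unfolding cexpr_def cmod_power2 by (simp add: power2_eq_square rexpr_add rexpr_mult)

lemma bexpr_eq:
  assumes "rexpr f" "rexpr g"
  shows "bexpr (\<lambda>s. f s = g s)"
proof -
  obtain a b where "\<forall>s. f s = of_int (aval a s)" "\<forall>s. g s = of_int (aval b s)"
    using assms unfolding rexpr_def by blast
  then show ?thesis
    unfolding bexpr_def by (intro exI[of _ "Eq a b"]) simp
qed

lemma bexpr_less:
  assumes "rexpr f" "rexpr g"
  shows "bexpr (\<lambda>s. f s < g s)"
proof -
  obtain a b where "\<forall>s. f s = of_int (aval a s)" "\<forall>s. g s = of_int (aval b s)"
    using assms unfolding rexpr_def by blast
  then show ?thesis
    unfolding bexpr_def by (intro exI[of _ "Less a b"]) simp
qed

lemma bexpr_not: "bexpr P \<Longrightarrow> bexpr (\<lambda>s. \<not> P s)"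
  unfolding bexpr_def by (metis bval.simps(3))

lemma bexpr_conj: "bexpr P \<Longrightarrow> bexpr Q \<Longrightarrow> bexpr (\<lambda>s. P s \<and> Q s)"
  unfolding bexpr_def by (metis bval.simps(4))

lemma bexpr_ball:
  assumes "finite A" "\<And>x. x \<in> A \<Longrightarrow> bexpr (P x)"
  shows "bexpr (\<lambda>s. \<forall>x\<in>A. P x s)"
  using assms
proof (induction A)
  case empty
  show ?case
    unfolding bexpr_def by (intro exI[of _ "Eq (Const 0) (Const 0)"]) simp
next
  case (insert x A)
  then show ?case
    using bexpr_conj[of "P x" "\<lambda>s. \<forall>x\<in>A. P x s"] by simp
qed

lemma bexpr_all:
  fixes P :: "'a::finite \<Rightarrow> store \<Rightarrow> bool"
  assumes "\<And>x. bexpr (P x)"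
  shows "bexpr (\<lambda>s. \<forall>x. P x s)"
  using bexpr_ball[of UNIV P] assms by simp

lemma bexpr_divide_Ints:
  assumes "rexpr f" "rexpr g"
  shows "bexpr (\<lambda>s. f s / g s \<in> \<int>)"
proof -
  obtain a b where ab: "\<And>s. f s = of_int (aval a s)" "\<And>s. g s = of_int (aval b s)"
    using assms unfolding rexpr_def by blast
  \<comment> \<open>A divisor 0 is accepted by the test, in keeping with the convention x / 0 = 0,
    which is an integer.\<close>
  have "bval (Neg (Conj (Neg (Eq (Rem a b) (Const 0))) (Neg (Eq b (Const 0))))) s \<longleftrightarrow> f s / g s \<in> \<int>" for s
  proof (cases "aval b s = 0")
    case False
    have "aval b s dvd aval a s \<longleftrightarrow> (of_int (aval a s) / of_int (aval b s) :: real) \<in> \<int>"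
    proof
      assume "(of_int (aval a s) / of_int (aval b s) :: real) \<in> \<int>"
      then obtain n where "of_int (aval a s) / of_int (aval b s) = (of_int n :: real)"
        by (auto elim: Ints_cases)
      then have "(of_int (aval a s) :: real) = of_int (aval b s * n)"
        using False by (simp add: field_simps)
      then show "aval b s dvd aval a s"
        unfolding of_int_eq_iff by simp
    qed (use False in auto)
    then show ?thesis
      using False by (simp add: ab dvd_eq_mod_eq_0)
  qed (simp add: ab)
  then show ?thesis
    unfolding bexpr_def by blast
qed

section \<open>Operators in the store\<close>

definition index4 :: "4 \<Rightarrow> nat" where
  "index4 i = (if i = 1 then 0 else if i = 2 then 1 else if i = 3 then 2 else 3)"

definition store_mat :: "store \<Rightarrow> op4" where
  "store_mat s = (\<chi> i j. Complex (of_int (s (1 + (4 * index4 i + index4 j)))) (of_int (s (17 + (4 * index4 i + index4 j)))))"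

lemma length_entries: "length (entries A) = 16"
  by (simp add: entries_def)

lemma entries_index4: "entries A ! (4 * index4 i + index4 j) = A $ i $ j"
proof -
  have "\<forall>i j. entries A ! (4 * index4 i + index4 j) = A $ i $ j"
    unfolding forall_4 by (simp add: entries_def index4_def)
  then show ?thesis by blast
qed

lemma index4_less: "4 * index4 i + index4 j < 16"
  by (simp add: index4_def)

lemma index4_surj:
  assumes "n < 16"
  obtains i j where "n = 4 * index4 i + index4 j"
proof -
  have "\<exists>i. x = index4 i" if "x < 4" for x
  proof -
    have "x = index4 1 \<or> x = index4 2 \<or> x = index4 3 \<or> x = index4 4"
      using that by (simp add: index4_def) linarith
    then show ?thesis by blast
  qed
  moreover have "n div 4 < 4" "n mod 4 < 4"
    using assms by simp_all
  ultimately obtain i j where "n div 4 = index4 i" "n mod 4 = index4 j"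
    by meson
  then show ?thesis
    using that[of i j] mult_div_mod_eq[of 4 n] by simp
qed

lemma cexpr_store_mat: "cexpr (\<lambda>s. store_mat s $ i $ j)"
  by (simp add: store_mat_def cexpr_def rexpr_var)

text \<open>The factor is unknown to the program and changes with every multiplication; being
  positive, it preserves the phase of \<open>U\<close> that the final lookup must recognise.\<close>

definition represents :: "store \<Rightarrow> op4 \<Rightarrow> bool" where
  "represents s U \<longleftrightarrow> (\<exists>c>0. store_mat s = cscale (complex_of_real c) U)"

lemma represents_input_store:
  assumes "U \<in> clifford_CS"
  shows "represents (input_store U) U"
proof -
  define m where "m = gaussian_lde U"
  define A where "A = cscale (complex_of_real (sqrt 2 ^ m)) U"
  have "\<exists>m. \<forall>i j. Re (complex_of_real (sqrt 2 ^ m) * U $ i $ j) \<in> \<int> \<and>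
      Im (complex_of_real (sqrt 2 ^ m) * U $ i $ j) \<in> \<int>"
    using gaussian_exists[OF assms] unfolding gaussian_at_def gauss_def by simp
  then have "\<forall>i j. Re (complex_of_real (sqrt 2 ^ m) * U $ i $ j) \<in> \<int> \<and>
      Im (complex_of_real (sqrt 2 ^ m) * U $ i $ j) \<in> \<int>"
    unfolding m_def gaussian_lde_def by (rule LeastI_ex)
  then have A: "Re (A $ i $ j) \<in> \<int>" "Im (A $ i $ j) \<in> \<int>" for i j
    unfolding A_def cscale_def by simp_all
  have list: "input_list U = int m # map (\<lambda>z. \<lfloor>Re z\<rfloor>) (entries A) @ map (\<lambda>z. \<lfloor>Im z\<rfloor>) (entries A)"
    by (simp add: input_list_def Let_def m_def A_def)
  have "input_store U (1 + n) = \<lfloor>Re (entries A ! n)\<rfloor>" "input_store U (17 + n) = \<lfloor>Im (entries A ! n)\<rfloor>"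
    if "n < 16" for n
  proof -
    have "17 + n = Suc (16 + n)"
      by simp
    then show "input_store U (1 + n) = \<lfloor>Re (entries A ! n)\<rfloor>" "input_store U (17 + n) = \<lfloor>Im (entries A ! n)\<rfloor>"
      using that by (simp_all add: input_store_def list length_entries nth_append)
  qed
  then have "store_mat (input_store U) $ i $ j = A $ i $ j" for i j
    using A[of i j] index4_less[of i j] unfolding store_mat_def
    by (simp add: entries_index4 complex_eq_iff del: One_nat_def)
  then have "store_mat (input_store U) = A"
    by (simp add: vec_eq_iff)
  then show ?thesis
    unfolding represents_def A_def by (intro exI[of _ "sqrt 2 ^ m"]) simp
qed

lemma cexpr_matrix_mult:
  assumes "\<And>p q. cexpr (\<lambda>s. f s $ p $ q)" "\<And>p q. G $ p $ q \<in> gauss"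
  shows "cexpr (\<lambda>s. (G ** f s) $ i $ j)"
  unfolding matrix_matrix_mult_def vec_lambda_beta
  by (intro cexpr_sum cexpr_mult cexpr_const assms)

lemma basisB_gauss: "complex_of_real (sqrt 2) * basisB $ i $ p $ q \<in> gauss"
proof -
  have "\<forall>i p q. complex_of_real (sqrt 2) * basisB $ i $ p $ q \<in> gauss"
    unfolding forall_6 forall_4 basisB_simps
    by (simp add: cscale_def e_wedge_nth gauss_def)
  then show ?thesis by blast
qed

text \<open>The 4 clears the 1/2 of the inner product and the factors 1 / sqrt 2 of two basis
  vectors, leaving a polynomial with Gaussian coefficients.\<close>

lemma cexpr_so6:
  assumes "\<And>p q. cexpr (\<lambda>s. f s $ p $ q)"
  shows "cexpr (\<lambda>s. 4 * so6 (f s) $ i $ j)"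
proof -
  let ?b = "\<lambda>i p q. complex_of_real (sqrt 2) * basisB $ i $ p $ q"
  have "4 * so6 U $ i $ j = (\<Sum>p\<in>UNIV. \<Sum>q\<in>UNIV. \<Sum>a\<in>UNIV. \<Sum>b\<in>UNIV.
      cnj (?b i p q) * ?b j a b * (U $ p $ a * U $ q $ b))" for U
  proof -
    have "cnj (?b i p q) * ?b j a b * x = 2 * (cnj (basisB $ i $ p $ q) * basisB $ j $ a $ b * x)" for p q a b x
    proof -
      have "cnj (?b i p q) * ?b j a b * x =
          (complex_of_real (sqrt 2) * complex_of_real (sqrt 2)) * (cnj (basisB $ i $ p $ q) * basisB $ j $ a $ b * x)"
        by (simp only: complex_cnj_mult complex_cnj_complex_of_real mult_ac)
      then show ?thesis
        by (simp only: csqrt2)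
    qed
    then show ?thesis
      unfolding so6_expand by (simp only: sum_distrib_left[symmetric]) simp
  qed
  then show ?thesis
    by (simp only:) (intro cexpr_sum cexpr_mult cexpr_const gauss_closed basisB_gauss assms)
qed

text \<open>The squared Frobenius norm. On a real multiple of a unitary it recovers the square of
  the factor by integer arithmetic.\<close>

definition frobenius :: "op4 \<Rightarrow> real" where
  "frobenius A = (\<Sum>i\<in>UNIV. \<Sum>j\<in>UNIV. (cmod (A $ i $ j))\<^sup>2)"

lemma rexpr_frobenius: "(\<And>p q. cexpr (\<lambda>s. f s $ p $ q)) \<Longrightarrow> rexpr (\<lambda>s. frobenius (f s))"
  unfolding frobenius_def by (intro rexpr_sum rexpr_cmod_square)

lemma frobenius_unitary:
  assumes "unitary U"
  shows "frobenius (cscale (complex_of_real c) U) = 4 * c\<^sup>2"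
proof -
  have "complex_of_real (\<Sum>j\<in>UNIV. (cmod (U $ i $ j))\<^sup>2) = (U ** adjoint_mat U) $ i $ i" for i
    by (simp add: matrix_matrix_mult_def adjoint_mat_def complex_norm_square[symmetric] del: of_real_power)
  then have "complex_of_real (\<Sum>j\<in>UNIV. (cmod (U $ i $ j))\<^sup>2) = complex_of_real 1" for i
    using assms by (simp add: unitary_def mat_def)
  then have row: "(\<Sum>j\<in>UNIV. (cmod (U $ i $ j))\<^sup>2) = 1" for i
    unfolding of_real_eq_iff .
  have "frobenius (cscale (complex_of_real c) U) = (\<Sum>i\<in>(UNIV :: 4 set). c\<^sup>2 * (\<Sum>j\<in>UNIV. (cmod (U $ i $ j))\<^sup>2))"
    by (simp add: frobenius_def cscale_def norm_mult power_mult_distrib sum_distrib_left)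
  then show ?thesis
    by (simp add: row)
qed

text \<open>The quotient is independent of the unknown positive factor between the stored matrix and the operator.\<close>

lemma so6_cmod_square_ratio:
  assumes "unitary U" "0 < c" "A = cscale (complex_of_real c) U"
  shows "(cmod (4 * so6 A $ i $ j))\<^sup>2 / (frobenius A * frobenius A) = (cmod (so6 U $ i $ j))\<^sup>2"
proof -
  have "(cmod (4 * so6 A $ i $ j))\<^sup>2 = 16 * (c\<^sup>2)\<^sup>2 * (cmod (so6 U $ i $ j))\<^sup>2"
    unfolding assms(3) so6_cscale by (simp add: cscale_def norm_mult power_mult_distrib norm_power)
  moreover have "frobenius A * frobenius A = 16 * (c\<^sup>2)\<^sup>2"
    unfolding assms(3) frobenius_unitary[OF assms(1)] by (simp add: power2_eq_square)
  ultimately show ?thesis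
    using assms(2) by simp
qed

text \<open>One expression has to serve all \<open>n\<close>, so the bound enters through the power
  of two in variable 0. \<open>e\<close> is the lead of that power over the tested bound: 1 in a
  reduction round, 0 in the search for the level.\<close>

lemma level_test:
  assumes G: "\<And>p q. G $ p $ q \<in> gauss" and g: "0 < g" "G = cscale (complex_of_real g) W" and W: "W \<in> clifford_CS"
  obtains b where "\<And>s U n. represents s U \<Longrightarrow> U \<in> clifford_CS \<Longrightarrow> s 0 = 2 ^ (e + n) \<Longrightarrow>
    bval b s \<longleftrightarrow> level (W ** U) \<le> n"
proof -
  let ?M = "\<lambda>s. G ** store_mat s"
  have "bexpr (\<lambda>s. \<forall>i j. (of_int (s 0) * (cmod (4 * so6 (?M s) $ i $ j))\<^sup>2) /
      (2 ^ e * (frobenius (?M s) * frobenius (?M s))) \<in> \<int>)"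
    by (intro bexpr_all bexpr_divide_Ints rexpr_mult rexpr_var rexpr_cmod_square cexpr_so6 rexpr_frobenius
        cexpr_matrix_mult cexpr_store_mat G rexpr_const) simp
  then obtain b where b: "\<And>s. bval b s \<longleftrightarrow> (\<forall>i j. (of_int (s 0) * (cmod (4 * so6 (?M s) $ i $ j))\<^sup>2) /
      (2 ^ e * (frobenius (?M s) * frobenius (?M s))) \<in> \<int>)"
    unfolding bexpr_def by blast
  have "bval b s \<longleftrightarrow> level (W ** U) \<le> n" if s: "represents s U" "U \<in> clifford_CS" "s 0 = 2 ^ (e + n)" for s U n
  proof -
    obtain c where c: "0 < c" "store_mat s = cscale (complex_of_real c) U"
      using s(1) unfolding represents_def by blast
    have WU: "W ** U \<in> clifford_CS"
      using W s(2) by (rule clifford_CS_mult)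
    have M: "?M s = cscale (complex_of_real (g * c)) (W ** U)"
      by (simp add: g(2) c(2) mult.commute)
    have "(of_int (s 0) * (cmod (4 * so6 (?M s) $ i $ j))\<^sup>2) / (2 ^ e * (frobenius (?M s) * frobenius (?M s)))
        = 2 ^ n * (cmod (so6 (W ** U) $ i $ j))\<^sup>2" for i j
      using so6_cmod_square_ratio[OF clifford_CS_unitary[OF WU] mult_pos_pos[OF g(1) c(1)] M, of i j, symmetric]
      by (simp add: s(3) power_add)
    then show ?thesis
      unfolding b level_le_iff[OF WU] by simp
  qed
  then show ?thesis
    by (rule that)
qed

text \<open>The factors in front of both matrices enter through the squared norms. Real and
  imaginary parts are therefore compared by cross-multiplied squares, with opposite signs excluded
  separately.\<close>

lemma identify_test:
  assumes "C \<in> clifford"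
  obtains b where "\<And>s U. represents s U \<Longrightarrow> U \<in> clifford \<Longrightarrow> bval b s \<longleftrightarrow> U = C"
proof -
  obtain m where "gaussian_at m C"
    using gaussian_exists[OF clifford_subset[OF assms]] by blast
  define g where "g = sqrt 2 ^ m"
  define G where "G = cscale (complex_of_real g) C"
  have "0 < g"
    by (simp add: g_def)
  have G: "Re (G $ i $ j) \<in> \<int>" "Im (G $ i $ j) \<in> \<int>" for i j
    using \<open>gaussian_at m C\<close> by (simp_all add: gaussian_at_def gauss_def G_def g_def cscale_def)
  have fG: "frobenius G = 4 * g\<^sup>2"
    unfolding G_def by (rule frobenius_unitary[OF clifford_unitary[OF assms]])
  have fG_int: "frobenius G \<in> \<int>"
  proof -
    have "g\<^sup>2 = 2 ^ m"
      unfolding g_def by (metis abs_numeral power2_eq_square power_mult_distrib real_sqrt_mult_self)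
    then show ?thesis
      by (simp add: fG)
  qed
  let ?test = "\<lambda>s x y. (x * x) * frobenius G = (y * y) * frobenius (store_mat s) \<and> \<not> x * y < 0"
  have re: "rexpr (\<lambda>s. Re (store_mat s $ i $ j))" and im: "rexpr (\<lambda>s. Im (store_mat s $ i $ j))" for i j
    using cexpr_store_mat unfolding cexpr_def by blast+
  have "bexpr (\<lambda>s. \<forall>i j. ?test s (Re (store_mat s $ i $ j)) (Re (G $ i $ j)) \<and>
      ?test s (Im (store_mat s $ i $ j)) (Im (G $ i $ j)))"
    by (intro bexpr_all bexpr_conj bexpr_eq bexpr_not bexpr_less rexpr_mult re im rexpr_frobenius cexpr_store_mat
        rexpr_const G fG_int Ints_0)
  then obtain b where b: "\<And>s. bval b s \<longleftrightarrow> (\<forall>i j. ?test s (Re (store_mat s $ i $ j)) (Re (G $ i $ j)) \<and>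
      ?test s (Im (store_mat s $ i $ j)) (Im (G $ i $ j)))"
    unfolding bexpr_def by blast
  have "bval b s \<longleftrightarrow> U = C" if s: "represents s U" "U \<in> clifford" for s U
  proof -
    obtain c where c: "0 < c" "store_mat s = cscale (complex_of_real c) U"
      using s(1) unfolding represents_def by blast
    have fs: "frobenius (store_mat s) = 4 * c\<^sup>2"
      unfolding c(2) by (rule frobenius_unitary[OF clifford_unitary[OF s(2)]])
    have test: "?test s (c * x) (g * y) \<longleftrightarrow> x = y" for x y
    proof -
      have "(c * x * (c * x)) * frobenius G = (g * y * (g * y)) * frobenius (store_mat s) \<longleftrightarrow>
          (4 * c\<^sup>2 * g\<^sup>2) * (x * x) = (4 * c\<^sup>2 * g\<^sup>2) * (y * y)"
        unfolding fG fs power2_eq_square by (simp only: mult_ac)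
      also have "\<dots> \<longleftrightarrow> x * x = y * y"
        using c(1) \<open>0 < g\<close> by simp
      also have "\<dots> \<longleftrightarrow> x = y \<or> x = - y"
        by (rule square_eq_iff)
      finally have 1: "(c * x * (c * x)) * frobenius G = (g * y * (g * y)) * frobenius (store_mat s) \<longleftrightarrow> x = y \<or> x = - y" .
      have xy: "c * x * (g * y) = (c * g) * (x * y)"
        by (simp only: mult_ac)
      have 2: "c * x * (g * y) < 0 \<longleftrightarrow> x * y < 0"
        unfolding xy using mult_less_cancel_left_pos[OF mult_pos_pos[OF c(1) \<open>0 < g\<close>], of "x * y" 0] by simp
      have 3: "- y * y < 0 \<longleftrightarrow> y \<noteq> 0" "\<not> y * y < 0"
        by (auto simp: zero_less_mult_iff not_less)
      show ?thesis
        unfolding 1 2 using 3 by auto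
    qed
    have "Re (store_mat s $ i $ j) = c * Re (U $ i $ j)" "Im (store_mat s $ i $ j) = c * Im (U $ i $ j)"
      "Re (G $ i $ j) = g * Re (C $ i $ j)" "Im (G $ i $ j) = g * Im (C $ i $ j)" for i j
      by (simp_all add: c(2) G_def cscale_def)
    then have "bval b s \<longleftrightarrow> (\<forall>i j. Re (U $ i $ j) = Re (C $ i $ j) \<and> Im (U $ i $ j) = Im (C $ i $ j))"
      unfolding b by (simp only: test)
    then show ?thesis
      by (simp add: vec_eq_iff complex_eq_iff)
  qed
  then show ?thesis
    by (rule that)
qed

section \<open>The synthesis program\<close>

text \<open>A bound instead of the exact cost lets branches of different cost share one
  estimate.\<close>

definition runs :: "prog \<Rightarrow> store \<Rightarrow> op4 list \<Rightarrow> store \<Rightarrow> nat \<Rightarrow> bool" where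
  "runs p s gs s' T \<longleftrightarrow> (\<exists>t\<le>T. exec p s gs t s')"

lemma runs_Seq:
  assumes "runs p s gs s' T" "runs q s' hs s'' T'"
  shows "runs (Seq p q) s (gs @ hs) s'' (T + T')"
proof -
  obtain t t' where "t \<le> T" "exec p s gs t s'" "t' \<le> T'" "exec q s' hs t' s''"
    using assms unfolding runs_def by blast
  then show ?thesis
    unfolding runs_def by (intro exI[of _ "t + t'"]) (auto intro: exec.Seq)
qed

lemma runs_mono: "runs p s gs s' T \<Longrightarrow> T \<le> T' \<Longrightarrow> runs p s gs s' T'"
  unfolding runs_def by (meson order_trans)

lemma runs_Assign: "runs (Assign x a) s [] (s(x := aval a s)) (acost a + 1)"
  unfolding runs_def by (intro exI[of _ "acost a + 1"] conjI order_refl exec.Assign)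

lemma runs_Emit: "runs (Emit g) s [g] s 1"
  unfolding runs_def by (intro exI[of _ 1] conjI order_refl exec.Emit)

lemma runs_Skip: "runs Skip s [] s 0"
  unfolding runs_def by (intro exI[of _ 0] conjI order_refl exec.Skip)

lemma runs_WhileFalse: "\<not> bval b s \<Longrightarrow> runs (While b p) s [] s (bcost b + 1)"
  unfolding runs_def by (intro exI[of _ "bcost b + 1"] conjI order_refl exec.WhileFalse)

lemma runs_WhileTrue:
  assumes "bval b s" "runs p s gs s' T" "runs (While b p) s' hs s'' T'"
  shows "runs (While b p) s (gs @ hs) s'' (bcost b + 1 + T + T')"
proof -
  obtain t t' where "t \<le> T" "exec p s gs t s'" "t' \<le> T'" "exec (While b p) s' hs t' s''"
    using assms unfolding runs_def by blast
  then show ?thesis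
    unfolding runs_def using exec.WhileTrue[OF assms(1)] by (intro exI[of _ "bcost b + 1 + t + t'"]) auto
qed

primrec chain :: "('a \<Rightarrow> bexp) \<Rightarrow> ('a \<Rightarrow> prog) \<Rightarrow> 'a list \<Rightarrow> prog" where
  "chain b p [] = Skip"
| "chain b p (x # xs) = Ite (b x) (p x) (chain b p xs)"

text \<open>The first true test decides, and it need not be that of the known witness
  \<open>x\<close>; hence only some branch with a true test is promised. The added sum pays for all
  tests.\<close>

lemma runs_chain:
  assumes "x \<in> set xs" "bval (b x) s"
  shows "\<exists>y\<in>set xs. bval (b y) s \<and>
    (\<forall>gs s' T. runs (p y) s gs s' T \<longrightarrow> runs (chain b p xs) s gs s' (T + (\<Sum>y\<leftarrow>xs. bcost (b y) + 1)))"
  using assms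
proof (induction xs)
  case (Cons z zs)
  show ?case
  proof (cases "bval (b z) s")
    case True
    have "runs (chain b p (z # zs)) s gs s' (T + (\<Sum>y\<leftarrow>z # zs. bcost (b y) + 1))"
      if run: "runs (p z) s gs s' T" for gs s' T
    proof -
      obtain t where "t \<le> T" "exec (p z) s gs t s'"
        using run unfolding runs_def by blast
      then show ?thesis
        unfolding runs_def using exec.IteTrue[OF True] by (intro exI[of _ "bcost (b z) + 1 + t"]) auto
    qed
    then show ?thesis
      using True by auto
  next
    case False
    then have "x \<in> set zs"
      using Cons.prems by auto
    then obtain y where y: "y \<in> set zs" "bval (b y) s"
      "\<And>gs s' T. runs (p y) s gs s' T \<Longrightarrow> runs (chain b p zs) s gs s' (T + (\<Sum>y\<leftarrow>zs. bcost (b y) + 1))"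
      using Cons.IH Cons.prems(2) by blast
    have "runs (chain b p (z # zs)) s gs s' (T + (\<Sum>y\<leftarrow>z # zs. bcost (b y) + 1))"
      if run: "runs (p y) s gs s' T" for gs s' T
    proof -
      obtain t where "t \<le> T + (\<Sum>y\<leftarrow>zs. bcost (b y) + 1)" "exec (chain b p zs) s gs t s'"
        using y(3)[OF run] unfolding runs_def by blast
      then show ?thesis
        unfolding runs_def using exec.IteFalse[OF False] by (intro exI[of _ "bcost (b z) + 1 + t"]) auto
    qed
    then show ?thesis
      using y(1,2) by auto
  qed
qed simp

text \<open>All new values depend on old ones, so they are first collected in the variables from
  \<open>n\<close> to 2 n - 1 and then copied back. As \<open>f\<close> reads only variables below
  \<open>n\<close>, writing to this scratch area does no harm.\<close>

lemma parallel_assignment: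
  fixes f :: "nat \<Rightarrow> store \<Rightarrow> int"
  assumes expr: "\<And>x. x < n \<Longrightarrow> \<exists>a. \<forall>s. aval a s = f x s"
    and local: "\<And>x s s'. x < n \<Longrightarrow> (\<And>y. y < n \<Longrightarrow> s y = s' y) \<Longrightarrow> f x s = f x s'"
  obtains p T where "\<And>s. \<exists>s'. runs p s [] s' T \<and> (\<forall>x<n. s' x = f x s)"
proof -
  have compute: "\<exists>p T. \<forall>s. \<exists>s'. runs p s [] s' T \<and> (\<forall>x<n. s' x = s x) \<and> (\<forall>x<m. s' (n + x) = f x s)"
    if "m \<le> n" for m
    using that
  proof (induction m)
    case 0
    show ?case
      using runs_Skip by (intro exI[of _ Skip] exI[of _ 0]) auto
  next
    case (Suc m)
    then obtain p T where p: "\<And>s. \<exists>s'. runs p s [] s' T \<and> (\<forall>x<n. s' x = s x) \<and> (\<forall>x<m. s' (n + x) = f x s)"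
      by auto
    obtain a where a: "\<And>s. aval a s = f m s"
      using expr[of m] Suc.prems by auto
    have "\<exists>s'. runs (Seq p (Assign (n + m) a)) s [] s' (T + (acost a + 1)) \<and> (\<forall>x<n. s' x = s x) \<and>
        (\<forall>x<Suc m. s' (n + x) = f x s)" for s
    proof -
      obtain s' where s': "runs p s [] s' T" "\<forall>x<n. s' x = s x" "\<forall>x<m. s' (n + x) = f x s"
        using p[of s] by blast
      have "f m s' = f m s"
        using Suc.prems s'(2) by (intro local) auto
      then have "\<forall>x<Suc m. (s'(n + m := aval a s')) (n + x) = f x s"
        using s'(3) by (auto simp: less_Suc_eq a)
      moreover have "\<forall>x<n. (s'(n + m := aval a s')) x = s x"
        using s'(2) by auto
      ultimately show ?thesis
        using runs_Seq[OF s'(1) runs_Assign[of "n + m" a s']] by auto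
    qed
    then show ?case
      by blast
  qed
  have copy: "\<exists>p T. \<forall>s. \<exists>s'. runs p s [] s' T \<and> (\<forall>x<m. s' x = s (n + x)) \<and> (\<forall>x\<ge>n. s' x = s x)"
    if "m \<le> n" for m
    using that
  proof (induction m)
    case 0
    show ?case
      using runs_Skip by (intro exI[of _ Skip] exI[of _ 0]) auto
  next
    case (Suc m)
    then obtain p T where p: "\<And>s. \<exists>s'. runs p s [] s' T \<and> (\<forall>x<m. s' x = s (n + x)) \<and> (\<forall>x\<ge>n. s' x = s x)"
      by auto
    have "\<exists>s'. runs (Seq p (Assign m (Var (n + m)))) s [] s' (T + (acost (Var (n + m)) + 1)) \<and>
        (\<forall>x<Suc m. s' x = s (n + x)) \<and> (\<forall>x\<ge>n. s' x = s x)" for s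
    proof -
      obtain s' where s': "runs p s [] s' T" "\<forall>x<m. s' x = s (n + x)" "\<forall>x\<ge>n. s' x = s x"
        using p[of s] by blast
      have "\<forall>x<Suc m. (s'(m := aval (Var (n + m)) s')) x = s (n + x)"
        "\<forall>x\<ge>n. (s'(m := aval (Var (n + m)) s')) x = s x"
        using s'(2,3) Suc.prems by (auto simp: less_Suc_eq)
      then show ?thesis
        using runs_Seq[OF s'(1) runs_Assign[of m "Var (n + m)" s']] by auto
    qed
    then show ?case
      by blast
  qed
  obtain p T where p: "\<And>s. \<exists>s'. runs p s [] s' T \<and> (\<forall>x<n. s' x = s x) \<and> (\<forall>x<n. s' (n + x) = f x s)"
    using compute[OF order_refl] by blast
  obtain q T' where q: "\<And>s. \<exists>s'. runs q s [] s' T' \<and> (\<forall>x<n. s' x = s (n + x)) \<and> (\<forall>x\<ge>n. s' x = s x)"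
    using copy[OF order_refl] by blast
  have "\<exists>s'. runs (Seq p q) s [] s' (T + T') \<and> (\<forall>x<n. s' x = f x s)" for s
  proof -
    obtain s1 where s1: "runs p s [] s1 T" "\<forall>x<n. s1 (n + x) = f x s"
      using p[of s] by blast
    obtain s2 where s2: "runs q s1 [] s2 T'" "\<forall>x<n. s2 x = s1 (n + x)"
      using q[of s1] by blast
    show ?thesis
      using runs_Seq[OF s1(1) s2(1)] s1(2) s2(2) by auto
  qed
  then show ?thesis
    by (rule that)
qed

lemma cexpr_gauss: "cexpr f \<Longrightarrow> f s \<in> gauss"
  unfolding cexpr_def rexpr_def gauss_def by auto

text \<open>Halving variable 0 keeps it in step with a level that drops by one. The 33 variables in
  the proof are this one and the 16 real and 16 imaginary parts.\<close>

lemma multiply_store_mat: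
  assumes "\<And>p q. G $ p $ q \<in> gauss"
  obtains p T where "\<And>s. \<exists>s'. runs p s [] s' T \<and> s' 0 = s 0 div 2 \<and> store_mat s' = G ** store_mat s"
proof -
  define M where "M = (\<lambda>s. G ** store_mat s)"
  have M: "cexpr (\<lambda>s. M s $ i $ j)" for i j
    unfolding M_def by (intro cexpr_matrix_mult cexpr_store_mat assms)
  define f where "f x s = (if x = 0 then s 0 div 2 else if x < 17 then \<lfloor>Re (entries (M s) ! (x - 1))\<rfloor>
    else \<lfloor>Im (entries (M s) ! (x - 17))\<rfloor>)" for x :: nat and s :: store
  have entry: "\<exists>a. \<forall>s. aval a s = \<lfloor>Re (entries (M s) ! n)\<rfloor>" "\<exists>a. \<forall>s. aval a s = \<lfloor>Im (entries (M s) ! n)\<rfloor>"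
    if less: "n < 16" for n
  proof -
    obtain i j where n: "n = 4 * index4 i + index4 j"
      by (rule index4_surj[OF less])
    show "\<exists>a. \<forall>s. aval a s = \<lfloor>Re (entries (M s) ! n)\<rfloor>" "\<exists>a. \<forall>s. aval a s = \<lfloor>Im (entries (M s) ! n)\<rfloor>"
      unfolding n entries_index4 using M[of i j] rexpr_floor unfolding cexpr_def by auto
  qed
  have expr: "\<exists>a. \<forall>s. aval a s = f x s" if "x < 33" for x
  proof -
    consider "x = 0" | "x \<noteq> 0" "x < 17" | "\<not> x < 17"
      by blast
    then show ?thesis
    proof cases
      case 1
      then show ?thesis
        by (intro exI[of _ "Div (Var 0) (Const 2)"]) (simp add: f_def)
    next
      case 2
      then show ?thesis
        using entry(1)[of "x - 1"] by (simp add: f_def)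
    next
      case 3
      then show ?thesis
        using entry(2)[of "x - 17"] that by (simp add: f_def)
    qed
  qed
  have local: "f x s = f x s'" if "\<And>y. y < 33 \<Longrightarrow> s y = s' y" for x s s'
  proof -
    have "1 + (4 * index4 i + index4 j) < 33" "17 + (4 * index4 i + index4 j) < 33" for i j
      using index4_less[of i j] by linarith+
    then have "store_mat s = store_mat s'"
      unfolding store_mat_def using that by presburger
    then have "M s = M s'"
      by (simp add: M_def)
    then show ?thesis
      unfolding f_def using that[of 0] by simp
  qed
  obtain p T where p: "\<And>s. \<exists>s'. runs p s [] s' T \<and> (\<forall>x<33. s' x = f x s)"
    by (rule parallel_assignment[of 33 f]) (use expr local that in blast)+
  have "\<exists>s'. runs p s [] s' T \<and> s' 0 = s 0 div 2 \<and> store_mat s' = G ** store_mat s" for s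
  proof -
    obtain s' where s': "runs p s [] s' T" "\<forall>x<33. s' x = f x s"
      using p[of s] by blast
    have "store_mat s' $ i $ j = M s $ i $ j" for i j
    proof -
      let ?n = "4 * index4 i + index4 j"
      have n: "1 + ?n < 33" "17 + ?n < 33" "1 + ?n \<noteq> 0" "17 + ?n \<noteq> 0" "1 + ?n < 17" "\<not> 17 + ?n < 17"
        using index4_less[of i j] by linarith+
      have "s' (1 + ?n) = \<lfloor>Re (M s $ i $ j)\<rfloor>" "s' (17 + ?n) = \<lfloor>Im (M s $ i $ j)\<rfloor>"
        using s'(2) n by (simp_all only: f_def if_False if_True diff_add_inverse entries_index4 simp_thms)
      then show ?thesis
        using cexpr_gauss[OF M[of i j], of s] by (simp add: store_mat_def gauss_def complex_eq_iff)
    qed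
    then have "store_mat s' = G ** store_mat s"
      by (simp add: vec_eq_iff M_def)
    moreover have "s' 0 = s 0 div 2"
      using s'(2) by (simp add: f_def)
    ultimately show ?thesis
      using s'(1) by blast
  qed
  then show ?thesis
    by (rule that)
qed

text \<open>The syllable is emitted while its inverse is applied to the store, so output times
  stored operator stays equal to the input. With 2 ^ (l + 1) in variable 0 the test asks whether the
  level falls to \<open>l\<close> or below.\<close>

lemma syllable_branch:
  assumes C: "C \<in> clifford"
  shows "\<exists>b p T.
    (\<forall>s U l. represents s U \<longrightarrow> U \<in> clifford_CS \<longrightarrow> s 0 = 2 ^ Suc l \<longrightarrow>
      (bval b s \<longleftrightarrow> level (adjoint_mat (syllable C) ** U) \<le> l)) \<and>
    (\<forall>s U. represents s U \<longrightarrow> (\<exists>s'. runs p s [C, CS_gate, adjoint_mat C] s' T \<and>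
      represents s' (adjoint_mat (syllable C) ** U) \<and> s' 0 = s 0 div 2))"
proof -
  define W where "W = adjoint_mat (syllable C)"
  have W: "W \<in> clifford_CS"
    unfolding W_def using C by (intro clifford_CS_adjoint syllable_in_clifford_CS)
  obtain m where m: "gaussian_at m W"
    using gaussian_exists[OF W] by blast
  define g where "g = sqrt 2 ^ m"
  define G where "G = cscale (complex_of_real g) W"
  have "0 < g"
    by (simp add: g_def)
  have G: "G $ p $ q \<in> gauss" for p q
    using m by (simp add: gaussian_at_def G_def g_def cscale_def)
  obtain b where b: "\<And>s U n. represents s U \<Longrightarrow> U \<in> clifford_CS \<Longrightarrow> s 0 = 2 ^ (1 + n) \<Longrightarrow>
      bval b s \<longleftrightarrow> level (W ** U) \<le> n"
    by (rule level_test[OF G \<open>0 < g\<close> G_def W, of 1]) (rule that)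
  obtain q T where q: "\<And>s. \<exists>s'. runs q s [] s' T \<and> s' 0 = s 0 div 2 \<and> store_mat s' = G ** store_mat s"
    by (rule multiply_store_mat[OF G]) (rule that)
  define p where "p = Seq (Emit C) (Seq (Emit CS_gate) (Seq (Emit (adjoint_mat C)) q))"
  have "\<exists>s'. runs p s [C, CS_gate, adjoint_mat C] s' (3 + T) \<and> represents s' (W ** U) \<and> s' 0 = s 0 div 2"
    if rep: "represents s U" for s U
  proof -
    obtain s' where s': "runs q s [] s' T" "s' 0 = s 0 div 2" "store_mat s' = G ** store_mat s"
      using q[of s] by blast
    have "runs p s ([C] @ [CS_gate] @ [adjoint_mat C] @ []) s' (1 + (1 + (1 + T)))"
      unfolding p_def by (rule runs_Seq[OF runs_Emit] s'(1))+
    then have "runs p s [C, CS_gate, adjoint_mat C] s' (3 + T)"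
      by (simp add: numeral_3_eq_3)
    moreover have "represents s' (W ** U)"
    proof -
      obtain c where "0 < c" "store_mat s = cscale (complex_of_real c) U"
        using rep unfolding represents_def by blast
      then show ?thesis
        unfolding represents_def using \<open>0 < g\<close>
        by (intro exI[of _ "c * g"]) (simp add: s'(3) G_def)
    qed
    ultimately show ?thesis
      using s'(2) by blast
  qed
  then show ?thesis
    using b unfolding W_def[symmetric]
    by (intro exI[of _ b] exI[of _ p] exI[of _ "3 + T"]) auto
qed

section \<open>The stages of the program and their composition\<close>

lemma store_mat_upd_0: "store_mat (s(0 := x)) = store_mat s"
  by (simp add: store_mat_def)

lemma represents_upd_0: "represents (s(0 := x)) U \<longleftrightarrow> represents s U"
  by (simp add: represents_def store_mat_upd_0)

text \<open>Expressions have no exponentiation, so the power is reached by doubling from 1 until the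
  test succeeds, in \<open>level U\<close> rounds of constant cost.\<close>

lemma level_program:
  obtains p T where "\<And>s U. represents s U \<Longrightarrow> U \<in> clifford_CS \<Longrightarrow>
    \<exists>s'. runs p s [] s' (T * level U + T) \<and> represents s' U \<and> s' 0 = 2 ^ level U"
proof -
  have one: "mat 1 \<in> clifford_CS"
    using clifford_one by (rule clifford_subset)
  have "mat 1 $ i $ j \<in> gauss" for i j :: 4
    by (simp add: mat_def)
  then obtain b where b: "\<And>s U n. represents s U \<Longrightarrow> U \<in> clifford_CS \<Longrightarrow> s 0 = 2 ^ (0 + n) \<Longrightarrow>
      bval b s \<longleftrightarrow> level (mat 1 ** U) \<le> n"
    using level_test[of "mat 1" 1 "mat 1" 0] one by auto
  define body where "body = Assign 0 (Mul (Const 2) (Var 0))"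
  \<comment> \<open>One round costs \<open>bcost (Neg b) + 1\<close> for the guard and 2 for the
    doubling.\<close>
  define c where "c = bcost b + 4"
  have loop: "runs (While (Neg b) body) s [] (s(0 := 2 ^ level U)) (c * (level U - n) + c)"
    if "represents s U" "U \<in> clifford_CS" "s 0 = 2 ^ n" "n \<le> level U" for s U n
    using that
  proof (induction "level U - n" arbitrary: s n)
    case 0
    then have "bval b s"
      using b[of s U n] by simp
    then have "runs (While (Neg b) body) s [] s (bcost (Neg b) + 1)"
      by (intro runs_WhileFalse) simp
    moreover have "s(0 := 2 ^ level U) = s"
      using 0 by (simp add: fun_upd_idem)
    ultimately show ?case
      by (auto simp: c_def elim: runs_mono)
  next
    case (Suc d)
    then have "\<not> bval b s"
      using b[of s U n] by simp
    let ?s = "s(0 := aval (Mul (Const 2) (Var 0)) s)"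
    have body: "runs body s [] ?s 2"
      unfolding body_def using runs_Assign[of 0 "Mul (Const 2) (Var 0)" s] by (simp add: numeral_2_eq_2)
    have "runs (While (Neg b) body) ?s [] (?s(0 := 2 ^ level U)) (c * (level U - Suc n) + c)"
      using Suc by (intro Suc.hyps(1)) (auto simp: represents_upd_0)
    then have "runs (While (Neg b) body) s ([] @ []) (?s(0 := 2 ^ level U))
        (bcost (Neg b) + 1 + 2 + (c * (level U - Suc n) + c))"
      using \<open>\<not> bval b s\<close> by (intro runs_WhileTrue[OF _ body]) simp_all
    moreover have "level U - n = Suc (level U - Suc n)"
      using Suc(2) by simp
    ultimately show ?case
      by (auto simp: c_def elim: runs_mono)
  qed
  define p where "p = Seq (Assign 0 (Const 1)) (While (Neg b) body)"
  have "\<exists>s'. runs p s [] s' ((c + 1) * level U + (c + 1)) \<and> represents s' U \<and> s' 0 = 2 ^ level U"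
    if "represents s U" "U \<in> clifford_CS" for s U
  proof -
    let ?s = "s(0 := aval (Const 1) s)"
    have init: "runs (Assign 0 (Const 1)) s [] ?s 1"
      using runs_Assign[of 0 "Const 1" s] by simp
    have "runs (While (Neg b) body) ?s [] (?s(0 := 2 ^ level U)) (c * (level U - 0) + c)"
      using that by (intro loop) (auto simp: represents_upd_0)
    then have "runs p s ([] @ []) (?s(0 := 2 ^ level U)) (1 + (c * (level U - 0) + c))"
      unfolding p_def by (rule runs_Seq[OF init])
    then have "runs p s [] (?s(0 := 2 ^ level U)) ((c + 1) * level U + (c + 1))"
      by (auto elim: runs_mono)
    moreover have "represents (?s(0 := 2 ^ level U)) U"
      unfolding represents_upd_0 by (rule that(1))
    ultimately show ?thesis
      by (intro exI[of _ "?s(0 := 2 ^ level U)"]) simp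
  qed
  then show ?thesis
    by (rule that)
qed

lemma reduction_program:
  obtains p T where "\<And>s U. represents s U \<Longrightarrow> U \<in> clifford_CS \<Longrightarrow> s 0 = 2 ^ level U \<Longrightarrow>
    \<exists>gs s' U'. runs p s gs s' (T * level U + T) \<and> represents s' U' \<and> U' \<in> clifford \<and>
      circuit_product gs ** U' = U \<and> set gs \<subseteq> clifford \<union> {CS_gate} \<and> CS_count gs = level U"
proof -
  obtain Cs where Cs: "set Cs = clifford"
    using finite_clifford finite_list by blast
  obtain b p T where
    b: "\<And>C s U l. C \<in> clifford \<Longrightarrow> represents s U \<Longrightarrow> U \<in> clifford_CS \<Longrightarrow> s 0 = 2 ^ Suc l \<Longrightarrow>
      bval (b C) s \<longleftrightarrow> level (adjoint_mat (syllable C) ** U) \<le> l"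
    and p: "\<And>C s U. C \<in> clifford \<Longrightarrow> represents s U \<Longrightarrow> \<exists>s'. runs (p C) s [C, CS_gate, adjoint_mat C] s' (T C) \<and>
      represents s' (adjoint_mat (syllable C) ** U) \<and> s' 0 = s 0 div 2"
  proof -
    define Q where "Q C b p T \<longleftrightarrow>
      (\<forall>s U l. represents s U \<longrightarrow> U \<in> clifford_CS \<longrightarrow> s 0 = 2 ^ Suc l \<longrightarrow>
        (bval b s \<longleftrightarrow> level (adjoint_mat (syllable C) ** U) \<le> l)) \<and>
      (\<forall>s U. represents s U \<longrightarrow> (\<exists>s'. runs p s [C, CS_gate, adjoint_mat C] s' T \<and>
        represents s' (adjoint_mat (syllable C) ** U) \<and> s' 0 = s 0 div 2))" for C b p and T :: nat
    have "\<forall>C. \<exists>b p T. C \<in> clifford \<longrightarrow> Q C b p T"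
      using syllable_branch unfolding Q_def by blast
    then obtain b p T where "\<And>C. C \<in> clifford \<Longrightarrow> Q C (b C) (p C) (T C)"
      by metis
    then show ?thesis
      unfolding Q_def by (intro that[of b p T]) blast+
  qed
  \<comment> \<open>With 2 ^ level U in variable 0, this asks whether the level is positive.\<close>
  define guard where "guard = Less (Const 1) (Var 0)"
  \<comment> \<open>A bound for a round whichever branch is taken: all branches, all tests, and 2
    for the guard of the loop.\<close>
  define c where "c = (\<Sum>C\<leftarrow>Cs. T C) + (\<Sum>C\<leftarrow>Cs. bcost (b C) + 1) + 2"
  define loop where "loop = While guard (chain b p Cs)"
  have "\<exists>gs s' U'. runs loop s gs s' (c * level U + c) \<and> represents s' U' \<and> U' \<in> clifford \<and>
      circuit_product gs ** U' = U \<and> set gs \<subseteq> clifford \<union> {CS_gate} \<and> CS_count gs = level U"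
    if "represents s U" "U \<in> clifford_CS" "s 0 = 2 ^ level U" for s U
    using that
  proof (induction "level U" arbitrary: s U)
    case 0
    then have "U \<in> clifford"
      by (intro level_0_imp_clifford) simp_all
    moreover have "runs loop s [] s (bcost guard + 1)"
      unfolding loop_def using 0 by (intro runs_WhileFalse) (simp add: guard_def)
    then have "runs loop s [] s (c * level U + c)"
      by (rule runs_mono) (simp add: c_def guard_def)
    ultimately show ?case
      using 0 by (intro exI[of _ "[]"] exI[of _ s] exI[of _ U]) (simp add: circuit_product_def CS_count_def)
  next
    case (Suc l)
    note rep = Suc.prems(1) and U = Suc.prems(2)
    have s0: "s 0 = 2 ^ Suc l"
      using Suc.prems(3) Suc.hyps(2) by simp
    obtain D where D: "D \<in> clifford" "so6_integral l (adjoint_mat (syllable D) ** U)"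
      by (rule level_reduction[OF U Suc.hyps(2)[symmetric]]) (rule that)
    have "bval (b D) s"
      using b[OF D(1) rep U s0] level_le[OF D(2)] by simp
    then obtain C where C: "C \<in> clifford" "bval (b C) s"
      "\<And>gs s' T. runs (p C) s gs s' T \<Longrightarrow> runs (chain b p Cs) s gs s' (T + (\<Sum>C\<leftarrow>Cs. bcost (b C) + 1))"
      using runs_chain[of D Cs b s p] D(1) Cs by blast
    define U1 where "U1 = adjoint_mat (syllable C) ** U"
    obtain s1 where s1: "runs (p C) s [C, CS_gate, adjoint_mat C] s1 (T C)" "represents s1 U1" "s1 0 = s 0 div 2"
      using p[OF C(1) rep] unfolding U1_def by blast
    have uC: "unitary (syllable C)"
      using C(1) by (rule unitary_syllable)
    have U1: "U1 \<in> clifford_CS"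
      unfolding U1_def using C(1) by (intro clifford_CS_mult[OF _ U] clifford_CS_adjoint syllable_in_clifford_CS)
    have "U = (syllable C ** adjoint_mat (syllable C)) ** U"
      using uC by (simp add: unitary_def)
    then have eq: "U = syllable C ** U1"
      by (simp add: U1_def matrix_mul_assoc)
    \<comment> \<open>The branch taken may belong to another \<open>C\<close> than the
      \<open>D\<close> known to succeed. Its test bounds the new level by \<open>l\<close> from
      above; restoring one syllable adds at most one, which bounds it from below.\<close>
    have "so6_integral (1 + level U1) U"
      using integral_mult[OF integral_syllable[OF C(1)] integral_level[OF U1] uC clifford_CS_unitary[OF U1]] eq
      by simp
    then have "level U \<le> 1 + level U1"
      by (rule level_le)
    moreover have "level U1 \<le> l"
      using b[OF C(1) rep U s0] C(2) unfolding U1_def by simp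
    ultimately have l: "l = level U1"
      using Suc.hyps(2) by linarith
    moreover have "s1 0 = 2 ^ level U1"
      using s1(3) s0 l by simp
    ultimately obtain gs s' U' where IH: "runs loop s1 gs s' (c * level U1 + c)" "represents s' U'" "U' \<in> clifford"
      "circuit_product gs ** U' = U1" "set gs \<subseteq> clifford \<union> {CS_gate}" "CS_count gs = level U1"
      using Suc.hyps(1)[OF _ s1(2) U1] by blast
    have "T C \<le> (\<Sum>C\<leftarrow>Cs. T C)"
      using C(1) Cs member_le_sum_list[of "T C" "map T Cs"] by simp
    then have "runs (chain b p Cs) s [C, CS_gate, adjoint_mat C] s1 (c - 2)"
      using runs_mono[OF C(3)[OF s1(1)], of "c - 2"] by (simp add: c_def)
    then have "runs loop s ([C, CS_gate, adjoint_mat C] @ gs) s' (bcost guard + 1 + (c - 2) + (c * level U1 + c))"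
      unfolding loop_def using IH(1)[unfolded loop_def]
      by (rule runs_WhileTrue[rotated]) (use s0 power_gt1[of "2 :: int" l] in \<open>simp add: guard_def\<close>)
    then have "runs loop s ([C, CS_gate, adjoint_mat C] @ gs) s' (c * level U + c)"
      by (rule runs_mono) (simp add: Suc.hyps(2)[symmetric] l guard_def c_def)
    moreover have "circuit_product ([C, CS_gate, adjoint_mat C] @ gs) ** U' = U"
    proof -
      have "circuit_product [C, CS_gate, adjoint_mat C] = syllable C"
        by (simp add: circuit_product_def syllable_def matrix_mul_assoc)
      then show ?thesis
        unfolding circuit_product_append using IH(4) eq by (simp flip: matrix_mul_assoc)
    qed
    moreover have "set ([C, CS_gate, adjoint_mat C] @ gs) \<subseteq> clifford \<union> {CS_gate}"
      using C(1) clifford_adjoint[OF C(1)] IH(5) by auto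
    moreover have "CS_count ([C, CS_gate, adjoint_mat C] @ gs) = level U"
      using CS_notin_clifford C(1) clifford_adjoint[OF C(1)] IH(6) Suc.hyps(2) l by (auto simp: CS_count_def)
    ultimately show ?case
      using IH(2,3) by blast
  qed
  then show ?thesis
    by (rule that)
qed

lemma clifford_program:
  obtains p T where "\<And>s U. represents s U \<Longrightarrow> U \<in> clifford \<Longrightarrow> runs p s [U] s T"
proof -
  obtain Cs where Cs: "set Cs = clifford"
    using finite_clifford finite_list by blast
  have "\<forall>C\<in>clifford. \<exists>b. \<forall>s U. represents s U \<longrightarrow> U \<in> clifford \<longrightarrow> (bval b s \<longleftrightarrow> U = C)"
    using identify_test by metis
  from bchoice[OF this] obtain b where
    b: "\<And>C s U. C \<in> clifford \<Longrightarrow> represents s U \<Longrightarrow> U \<in> clifford \<Longrightarrow> bval (b C) s \<longleftrightarrow> U = C"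
    by blast
  have "runs (chain b Emit Cs) s [U] s (1 + (\<Sum>C\<leftarrow>Cs. bcost (b C) + 1))"
    if rep: "represents s U" and U: "U \<in> clifford" for s U
  proof -
    obtain C where C: "C \<in> set Cs" "bval (b C) s"
      "\<And>gs s' T. runs (Emit C) s gs s' T \<Longrightarrow> runs (chain b Emit Cs) s gs s' (T + (\<Sum>C\<leftarrow>Cs. bcost (b C) + 1))"
      using runs_chain[of U Cs b s Emit] b[OF U rep U] U Cs by blast
    have "U = C"
      using b[of C s U] C(1,2) Cs rep U by blast
    then show ?thesis
      using C(3)[OF runs_Emit] by simp
  qed
  then show ?thesis
    by (rule that)
qed

theorem theorem4p15:
  shows "\<exists>(P :: prog) (f :: nat \<Rightarrow> real). f \<in> O(\<lambda>k. real k) \<and>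
    (\<forall>U \<in> clifford_CS. \<forall>V \<in> so6_images U. \<forall>k. k = lde V \<longrightarrow>
      (\<exists>gs t s.
        is_circuit_for U gs \<and> CS_count gs = k \<and>
        (\<forall>gs'. is_circuit_for U gs' \<longrightarrow> k \<le> CS_count gs') \<and>
        exec P (input_store U) gs t s \<and> real t \<le> f k))"
proof -
  obtain p1 T1 where p1: "\<And>s U. represents s U \<Longrightarrow> U \<in> clifford_CS \<Longrightarrow>
    \<exists>s'. runs p1 s [] s' (T1 * level U + T1) \<and> represents s' U \<and> s' 0 = 2 ^ level U"
    by (rule level_program) (rule that)
  obtain p2 T2 where p2: "\<And>s U. represents s U \<Longrightarrow> U \<in> clifford_CS \<Longrightarrow> s 0 = 2 ^ level U \<Longrightarrow>
    \<exists>gs s' U'. runs p2 s gs s' (T2 * level U + T2) \<and> represents s' U' \<and> U' \<in> clifford \<and>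
      circuit_product gs ** U' = U \<and> set gs \<subseteq> clifford \<union> {CS_gate} \<and> CS_count gs = level U"
    by (rule reduction_program) (rule that)
  obtain p3 T3 where p3: "\<And>s U. represents s U \<Longrightarrow> U \<in> clifford \<Longrightarrow> runs p3 s [U] s T3"
    by (rule clifford_program) (rule that)
  define P where "P = Seq p1 (Seq p2 p3)"
  define f where "f k = real (T1 * k + T1 + (T2 * k + T2 + T3))" for k
  have "f \<in> O(\<lambda>k. real k)"
  proof (rule bigoI[where c = "real (2 * T1 + 2 * T2 + T3)"])
    \<comment> \<open>For k >= 1 the constant terms are absorbed into the linear one.\<close>
    have "T1 * k + T1 + (T2 * k + T2 + T3) \<le> (2 * T1 + 2 * T2 + T3) * k" if "1 \<le> k" for k
    proof -
      obtain j where "k = Suc j"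
        using \<open>1 \<le> k\<close> by (cases k) simp_all
      then show ?thesis
        by (simp add: algebra_simps)
    qed
    then have "f k \<le> real (2 * T1 + 2 * T2 + T3) * real k" if "1 \<le> k" for k
      using that unfolding f_def of_nat_mult[symmetric] of_nat_le_iff by blast
    then show "\<forall>\<^sub>F k in at_top. norm (f k) \<le> real (2 * T1 + 2 * T2 + T3) * norm (real k)"
      by (intro eventually_at_top_linorderI[of 1]) (simp add: f_def)
  qed
  moreover have "\<exists>gs t s. is_circuit_for U gs \<and> CS_count gs = k \<and>
      (\<forall>gs'. is_circuit_for U gs' \<longrightarrow> k \<le> CS_count gs') \<and> exec P (input_store U) gs t s \<and> real t \<le> f k"
    if U: "U \<in> clifford_CS" and V: "V \<in> so6_images U" and "k = lde V" for U V k
  proof -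
    have k: "k = level U"
      using lde_eq_level[OF V] \<open>k = lde V\<close> by simp
    obtain s1 where s1: "runs p1 (input_store U) [] s1 (T1 * k + T1)" "represents s1 U" "s1 0 = 2 ^ level U"
      using p1[OF represents_input_store[OF U] U] k by blast
    obtain gs s2 U' where s2: "runs p2 s1 gs s2 (T2 * k + T2)" "represents s2 U'" "U' \<in> clifford"
      "circuit_product gs ** U' = U" "set gs \<subseteq> clifford \<union> {CS_gate}" "CS_count gs = k"
      using p2[OF s1(2) U s1(3)] k by blast
    have "runs P (input_store U) ([] @ (gs @ [U'])) s2 (T1 * k + T1 + (T2 * k + T2 + T3))"
      unfolding P_def by (intro runs_Seq[OF s1(1)] runs_Seq[OF s2(1)] p3 s2(2,3))
    then obtain t where t: "t \<le> T1 * k + T1 + (T2 * k + T2 + T3)" "exec P (input_store U) (gs @ [U']) t s2"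
      unfolding runs_def by auto
    have "is_circuit_for U (gs @ [U'])"
      unfolding is_circuit_for_def circuit_product_append using s2(3-5) by (simp add: circuit_product_def)
    moreover have "CS_count (gs @ [U']) = k"
      using s2(3,6) CS_notin_clifford by (auto simp: CS_count_def)
    moreover have "\<forall>gs'. is_circuit_for U gs' \<longrightarrow> k \<le> CS_count gs'"
      unfolding k using level_le_CS_count by blast
    moreover have "real t \<le> f k"
      unfolding f_def of_nat_le_iff by (rule t(1))
    ultimately show ?thesis
      using t(2) by blast
  qed
  ultimately show ?thesis
    by (intro exI[of _ P] exI[of _ f]) blast
qed

end
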